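(* Let $N\ge1$ be an integer, $\lambda,\mu>0$ real numbers and $\mathbf n\in\mathbb Z^N$. Define $$P_{\mathbf n}=\sum_{\mathbf m\in\mathbb Z^N}\alpha_{\mathbf n}(\mathbf m)\,f_{\mathbf m},$$ where the functions $f_{\mathbf m}$ are as in the context and $$\alpha_{\mathbf n}(\mathbf m)=\delta_{\mathbf n}(\mathbf m)+\sum_{s=1}^\infty\frac{1}{4^s s!}\sum_{j_1\le k_1}\cdots\sum_{j_s\le k_s}\ \sum_{\nu_1,\dots,\nu_s=0}^\infty \delta_{\mathbf n}\Bigl(\mathbf m+\sum_{r=1}^s\mathbf E_{j_rk_r}^{\nu_r}\Bigr)\prod_{r=1}^s g_{j_rk_r}\Bigl(\nu_r;\ \mathbf n-\sum_{\ell=1}^r\mathbf E_{j_\ell k_\ell}^{\nu_\ell}\Bigr),$$ each sum $\sum_{j_r\le k_r}$ being over $1\le j_r\le k_r\le N$, with $$g_{jk}(\nu;\mathbf m)=4\lambda(\lambda-1)(2\nu-1)(1-\delta_{\nu 0})(1-\delta_{jk})-2\bigl(2(\tilde m_j+\mu-\lambda)+1\bigr)\tilde m_j\,\delta_{\nu0}\,\delta_{jk},$$ $$\tilde m_j=m_j+\lambda(N+1-j),\qquad \mathbf E_{jk}^\nu=(1-\nu)\mathbf e_j+\nu\,\mathbf e_k .$$ (For each $\mathbf m$ only finitely many terms of the sum defining $\alpha_{\mathbf n}(\mathbf m)$ are non-zero, and only finitely many terms $\alpha_{\mathbf n}(\mathbf m)f_{\mathbf m}$ are non-zero.) Then $P_{\mathbf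 n}$ is a reduced polynomial eigenfunction of the $B_N$ Calogero model with eigenvalue $E_{\mathbf n}=4(n_1+\cdots+n_N)+N(1+2\mu+2\lambda(N-1))$; that is, $P_{\mathbf n}$ is a symmetric polynomial in $x_1,\dots,x_N$ and $$H_{B_N}(\psi_0P_{\mathbf n})=E_{\mathbf n}\,\psi_0P_{\mathbf n}.$$
   Context: The $B_N$ Calogero Hamiltonian is the differential operator $$H_{B_N}=\sum_{j=1}^N\left(-\partial_{x_j}^2+x_j^2+\frac{\mu(\mu-1)}{x_j^2}\right)+4\lambda(\lambda-1)\sum_{1\le j<k\le N}\frac{x_j^2+x_k^2}{(x_j^2-x_k^2)^2},$$ and $$\psi_0(\mathbf x)=\prod_{j=1}^N\left(e^{-\frac12x_j^2}x_j^\mu\right)\prod_{1\le j<k\le N}(x_k^2-x_j^2)^\lambda .$$ The eigenvalue equation is a differential identity at points $\mathbf x\in\mathbb R^N$ with all $x_j\neq0$ and the $x_j^2$ pairwise distinct; one may take the region $0<x_1<x_2<\cdots<x_N$, where $\psi_0>0$. $\mathbf e_j$ is the $j$-th standard basis vector, $(\mathbf e_j)_k=\delta_{jk}$, and $\delta_{\mathbf n}(\mathbf m)=\delta_{\mathbf n,\mathbf m}$ is the Kronecker delta ($1$ if $\mathbf m=\mathbf n$ and $0$ otherwise). For $\mathbf n\in\mathbb Z^N$, $\mathbf x\in\mathbb R^N$ and $\epsilon>0$ let $\mathcal C_j$ ($j=1,\dots,N$) be the positively oriented circle in the complex plane centred at $0$ of radius $\max_{1\le k\le N}|x_k|+\epsilon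 j$, and let $$f_{\mathbf n}(\mathbf x)=\prod_{j=1}^N\left(\oint_{\mathcal C_j}\frac{dy_j}{2\pi i\,y_j}\,y_j^{2n_j}\right)\frac{\prod_{1\le j<k\le N}(1-y_j^2/y_k^2)^\lambda}{\prod_{j,k=1}^N(1-x_j^2/y_k^2)^\lambda},$$ where powers are given by the principal branch (equivalently, by the binomial series in $y_j^2/y_k^2$, $j<k$, and in $x_j^2/y_k^2$, which converge on the contours). The functions $f_{\mathbf n}$ do not depend on $\epsilon$. "Reduced polynomial eigenfunction with eigenvalue $E$" means a symmetric polynomial $P$ with $H_{B_N}(\psi_0P)=E\psi_0P$; non-vanishing of $P$ is not part of the assertion. *)

theory Defs
  imports "HOL-Complex_Analysis.Complex_Analysis" "HOL-Library.Poly_Mapping" "HOL-Library.FuncSet"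
begin

text \<open>
  Vectors of length \<open>N\<close> are functions on \<open>nat\<close> of which the coordinates \<open>1, \<dots>, N\<close> matter.
  Points of \<open>\<real>\<^sup>N\<close> are arbitrary functions \<open>nat \<Rightarrow> real\<close>: everything below reads only the coordinates
  \<open>1, \<dots>, N\<close>. Index vectors in \<open>\<int>\<^sup>N\<close> are summed over and compared, so for them the other
  coordinates are fixed to be \<open>0\<close>.
\<close>

definition int_vecs :: "nat \<Rightarrow> (nat \<Rightarrow> int) set" where
  "int_vecs N = {m. \<forall>i. i \<notin> {1..N} \<longrightarrow> m i = 0}"


subsection \<open>The \<open>B\<^sub>N\<close> Calogero Hamiltonian\<close>

definition partial2 :: "nat \<Rightarrow> ((nat \<Rightarrow> real) \<Rightarrow> complex) \<Rightarrow> (nat \<Rightarrow> real) \<Rightarrow> complex" where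
  "partial2 j \<phi> x =
     vector_derivative (\<lambda>t. vector_derivative (\<lambda>s. \<phi> (x(j := s))) (at t)) (at (x j))"

definition H_BN ::
  "nat \<Rightarrow> real \<Rightarrow> real \<Rightarrow> ((nat \<Rightarrow> real) \<Rightarrow> complex) \<Rightarrow> (nat \<Rightarrow> real) \<Rightarrow> complex" where
  "H_BN N lam \<mu> \<phi> x =
     (\<Sum>j=1..N. - partial2 j \<phi> x + of_real ((x j)\<^sup>2 + \<mu> * (\<mu> - 1) / (x j)\<^sup>2) * \<phi> x)
     + of_real (4 * lam * (lam - 1) *
         (\<Sum>j=1..N. \<Sum>k\<in>{j<..N}. ((x j)\<^sup>2 + (x k)\<^sup>2) / ((x j)\<^sup>2 - (x k)\<^sup>2)\<^sup>2)) * \<phi> x"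

definition psi0 :: "nat \<Rightarrow> real \<Rightarrow> real \<Rightarrow> (nat \<Rightarrow> real) \<Rightarrow> real" where
  "psi0 N lam \<mu> x =
     (\<Prod>j=1..N. exp (- (x j)\<^sup>2 / 2) * x j powr \<mu>) *
     (\<Prod>j=1..N. \<Prod>k\<in>{j<..N}. ((x k)\<^sup>2 - (x j)\<^sup>2) powr lam)"

definition chamber :: "nat \<Rightarrow> (nat \<Rightarrow> real) set" where
  "chamber N = {x. (\<forall>j\<in>{1..N}. 0 < x j) \<and> (\<forall>j\<in>{1..N}. \<forall>k\<in>{j<..N}. x j < x k)}"

text \<open>Polynomials in variables indexed by \<open>nat\<close>, as finitely supported families of coefficients
  indexed by exponent vectors.\<close>

definition poly_eval :: "((nat \<Rightarrow>\<^sub>0 nat) \<Rightarrow>\<^sub>0 complex) \<Rightarrow> (nat \<Rightarrow> real) \<Rightarrow> complex" where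
  "poly_eval p x =
     (\<Sum>e\<in>Poly_Mapping.keys p. Poly_Mapping.lookup p e *
        (\<Prod>i\<in>Poly_Mapping.keys e. of_real (x i) ^ Poly_Mapping.lookup e i))"

definition symmetric_polynomial :: "nat \<Rightarrow> ((nat \<Rightarrow> real) \<Rightarrow> complex) \<Rightarrow> bool" where
  "symmetric_polynomial N P \<longleftrightarrow>
     (\<exists>p. (\<forall>e\<in>Poly_Mapping.keys p. Poly_Mapping.keys e \<subseteq> {1..N}) \<and> (\<forall>x. P x = poly_eval p x)) \<and>
     (\<forall>\<pi> x. \<pi> permutes {1..N} \<longrightarrow> P (\<lambda>i. x (\<pi> i)) = P x)"

definition reduced_polynomial_eigenfunction ::
  "nat \<Rightarrow> real \<Rightarrow> real \<Rightarrow> ((nat \<Rightarrow> real) \<Rightarrow> complex) \<Rightarrow> real \<Rightarrow> bool" where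
  "reduced_polynomial_eigenfunction N lam \<mu> P E \<longleftrightarrow>
     symmetric_polynomial N P \<and>
     (\<forall>x\<in>chamber N.
        H_BN N lam \<mu> (\<lambda>z. of_real (psi0 N lam \<mu> z) * P z) x
          = of_real E * (of_real (psi0 N lam \<mu> x) * P x))"


subsection \<open>The functions \<open>f\<^sub>n\<close>\<close>

text \<open>Iterated contour integral over \<open>y\<^sub>1, \<dots>, y\<^sub>N\<close>, where \<open>y\<^sub>j\<close> runs over the path \<open>\<gamma> j\<close>
  (the integral over \<open>y\<^sub>1\<close> is innermost).\<close>

primrec iterated_contour_integral ::
  "(nat \<Rightarrow> real \<Rightarrow> complex) \<Rightarrow> nat \<Rightarrow> ((nat \<Rightarrow> complex) \<Rightarrow> complex) \<Rightarrow> complex" where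
  "iterated_contour_integral \<gamma> 0 F = F (\<lambda>_. 0)"
| "iterated_contour_integral \<gamma> (Suc N) F =
     contour_integral (\<gamma> (Suc N))
       (\<lambda>w. iterated_contour_integral \<gamma> N (\<lambda>y. F (y(Suc N := w))))"

definition f_contour :: "nat \<Rightarrow> real \<Rightarrow> (nat \<Rightarrow> real) \<Rightarrow> nat \<Rightarrow> real \<Rightarrow> complex" where
  "f_contour N \<epsilon> x j = circlepath 0 (Max ((\<lambda>k. \<bar>x k\<bar>) ` {1..N}) + \<epsilon> * real j)"

definition f_fun ::
  "nat \<Rightarrow> real \<Rightarrow> real \<Rightarrow> (nat \<Rightarrow> int) \<Rightarrow> (nat \<Rightarrow> real) \<Rightarrow> complex" where
  "f_fun N lam \<epsilon> n x =
     iterated_contour_integral (f_contour N \<epsilon> x) N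
       (\<lambda>y. (\<Prod>j=1..N. 1 / (2 * of_real pi * \<i> * y j) * y j powi (2 * n j)) *
            (\<Prod>j=1..N. \<Prod>k\<in>{j<..N}. (1 - (y j)\<^sup>2 / (y k)\<^sup>2) powr of_real lam) /
            (\<Prod>j=1..N. \<Prod>k=1..N. (1 - of_real ((x j)\<^sup>2) / (y k)\<^sup>2) powr of_real lam))"


subsection \<open>The coefficients \<open>\<alpha>\<^sub>n(m)\<close>\<close>

definition shift_vec :: "nat \<Rightarrow> nat \<Rightarrow> nat \<Rightarrow> nat \<Rightarrow> int" where
  "shift_vec j k \<nu> i = (1 - int \<nu>) * of_bool (i = j) + int \<nu> * of_bool (i = k)"

definition m_tilde :: "nat \<Rightarrow> real \<Rightarrow> (nat \<Rightarrow> int) \<Rightarrow> nat \<Rightarrow> real" where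
  "m_tilde N lam m j = of_int (m j) + lam * (real N + 1 - real j)"

definition g_coeff ::
  "nat \<Rightarrow> real \<Rightarrow> real \<Rightarrow> nat \<Rightarrow> nat \<Rightarrow> nat \<Rightarrow> (nat \<Rightarrow> int) \<Rightarrow> real" where
  "g_coeff N lam \<mu> j k \<nu> m =
     4 * lam * (lam - 1) * (2 * real \<nu> - 1) * (1 - of_bool (\<nu> = 0)) * (1 - of_bool (j = k))
     - 2 * (2 * (m_tilde N lam m j + \<mu> - lam) + 1) * m_tilde N lam m j
         * of_bool (\<nu> = 0) * of_bool (j = k)"

text \<open>The sequences \<open>(j\<^sub>1,k\<^sub>1), \<dots>, (j\<^sub>s,k\<^sub>s)\<close> and \<open>\<nu>\<^sub>1, \<dots>, \<nu>\<^sub>s\<close> are extensional functions on \<open>{1..s}\<close>.\<close>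

definition pair_seqs :: "nat \<Rightarrow> nat \<Rightarrow> (nat \<Rightarrow> nat \<times> nat) set" where
  "pair_seqs N s = {1..s} \<rightarrow>\<^sub>E {(j, k). 1 \<le> j \<and> j \<le> k \<and> k \<le> N}"

definition nat_seqs :: "nat \<Rightarrow> (nat \<Rightarrow> nat) set" where
  "nat_seqs s = {1..s} \<rightarrow>\<^sub>E UNIV"

definition shift_sum :: "(nat \<Rightarrow> nat \<times> nat) \<Rightarrow> (nat \<Rightarrow> nat) \<Rightarrow> nat \<Rightarrow> nat \<Rightarrow> int" where
  "shift_sum jk \<nu> r i = (\<Sum>l=1..r. shift_vec (fst (jk l)) (snd (jk l)) (\<nu> l) i)"

definition alpha_term ::
  "nat \<Rightarrow> real \<Rightarrow> real \<Rightarrow> (nat \<Rightarrow> int) \<Rightarrow> (nat \<Rightarrow> int) \<Rightarrow>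
   nat \<Rightarrow> (nat \<Rightarrow> nat \<times> nat) \<Rightarrow> (nat \<Rightarrow> nat) \<Rightarrow> real" where
  "alpha_term N lam \<mu> n m s jk \<nu> =
     of_bool ((\<lambda>i. m i + shift_sum jk \<nu> s i) = n) *
     (\<Prod>r=1..s. g_coeff N lam \<mu> (fst (jk r)) (snd (jk r)) (\<nu> r) (\<lambda>i. n i - shift_sum jk \<nu> r i))"

definition alpha ::
  "nat \<Rightarrow> real \<Rightarrow> real \<Rightarrow> (nat \<Rightarrow> int) \<Rightarrow> (nat \<Rightarrow> int) \<Rightarrow> real" where
  "alpha N lam \<mu> n m =
     of_bool (m = n) +
     (\<Sum>\<^sub>\<infinity>s\<in>{1..}. 1 / (4 ^ s * fact s) *
        (\<Sum>jk\<in>pair_seqs N s. \<Sum>\<^sub>\<infinity>\<nu>\<in>nat_seqs s. alpha_term N lam \<mu> n m s jk \<nu>))"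

definition P_fun ::
  "nat \<Rightarrow> real \<Rightarrow> real \<Rightarrow> real \<Rightarrow> (nat \<Rightarrow> int) \<Rightarrow> (nat \<Rightarrow> real) \<Rightarrow> complex" where
  "P_fun N lam \<mu> \<epsilon> n x =
     (\<Sum>\<^sub>\<infinity>m\<in>int_vecs N. of_real (alpha N lam \<mu> n m) * f_fun N lam \<epsilon> m x)"

definition E_val :: "nat \<Rightarrow> real \<Rightarrow> real \<Rightarrow> (nat \<Rightarrow> int) \<Rightarrow> real" where
  "E_val N lam \<mu> n =
     4 * of_int (\<Sum>j=1..N. n j) + real N * (1 + 2 * \<mu> + 2 * lam * (real N - 1))"

end

(* In the variables z_j = x_j^2 the conjugated Hamiltonian is E_0 + 4 D - 4 L with D the Euler
   operator and L of degree -1, so a homogeneous f with D f = |n| f gives the eigenfunction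
   exp(-L) f.  The coefficients alpha_n(m) are exactly those of exp(-L) f_n once L f_n is known as
   a combination of functions f_m.

   Expanding the integrand, f_n is a finite sum of products of the coefficients g_m(z) of
   prod_j (1 - z_j t)^(-lambda).  On a product g_{m_1} ... g_{m_N} the operator L acts like the dual
   of a differential operator in w_1, ..., w_N.  For an integer lambda >= 2 the factor
   prod_{j<k} (1 - w_j/w_k)^lambda is a Laurent polynomial, and conjugating by it is an identity of
   Laurent polynomials resting on the cancellation of three-body terms; expanding the potential
   (w_j + w_k) / (w_j - w_k)^2 geometrically yields the coefficients g_{jk}.  All terms are
   polynomials in lambda, hence the formula for L f_n holds for every real lambda. *)

theory Submission
  imports Defs "HOL-Computational_Algebra.Polynomial_Factorial"
begin

subsection \<open>Laurent polynomials\<close>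

text \<open>The duality is a kernel-function identity: on K(z,t) = prod_j (1 - z_j t)^(-\<lambda>)
  the operator L in the variables z acts as a second-order operator in t alone. A product of several
  coefficients of K brings cross terms, one for each pair of factors, and these are controlled only
  in differences, raising one index against the other. In Laurent terms such a difference is
  multiplication by w_k - w_l, so the Laurent polynomial that carries the index n must be divisible
  by w_k - w_l, and by its square once the potential appears. Hence integers \<lambda> >= 2 come
  before real \<lambda>.

  The geometric expansion of the potential does not end, so it is cut off with an explicit
  remainder, which disappears because coefficients of K with negative index are 0. The same
  vanishing gives f_m = 0 as soon as some tail sum m_l + ... + m_N is negative, and tail sums never
  grow along the steps leading from n to m; this reduces every sum to a finite one.\<close>

lemma poly_mapping_additive_induct [case_names single add]:
  fixes P :: "('a \<Rightarrow>\<^sub>0 'b::comm_monoid_add) \<Rightarrow> bool"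
  assumes single: "\<And>m c. P (Poly_Mapping.single m c)"
    and add: "\<And>p q. P p \<Longrightarrow> P q \<Longrightarrow> P (p + q)"
  shows "P p"
proof -
  have "P (\<Sum>m\<in>A. Poly_Mapping.single m (Poly_Mapping.lookup p m))" if "finite A" for A
    using that
  proof (induction A)
    case empty
    then show ?case using single[of undefined 0] by simp
  next
    case (insert x A)
    then show ?case by (simp add: single add)
  qed
  moreover have "(\<Sum>m\<in>Poly_Mapping.keys p. Poly_Mapping.single m (Poly_Mapping.lookup p m)) = p"
    by (rule poly_mapping_eqI)
      (simp add: lookup_sum lookup_single when_def sum.delta in_keys_iff)
  ultimately show ?thesis
    by (metis finite_keys)
qed

section \<open>Linear functionals given by their values on monomials\<close>

definition lin_ext :: "('a \<Rightarrow> 'b) \<Rightarrow> ('a \<Rightarrow>\<^sub>0 'b::comm_ring_1) \<Rightarrow> 'b" where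
  "lin_ext G p = (\<Sum>m\<in>Poly_Mapping.keys p. Poly_Mapping.lookup p m * G m)"

text \<open>Two polynomials have different supports; a common finite superset of the keys makes
  their functionals comparable term by term.\<close>

lemma lin_ext_superset:
  assumes "finite A" "Poly_Mapping.keys p \<subseteq> A"
  shows "lin_ext G p = (\<Sum>m\<in>A. Poly_Mapping.lookup p m * G m)"
  unfolding lin_ext_def
  by (rule sum.mono_neutral_left) (use assms in \<open>auto simp: in_keys_iff\<close>)

lemma lin_ext_add: "lin_ext G (p + q) = lin_ext G p + lin_ext G q"
proof -
  let ?A = "Poly_Mapping.keys p \<union> Poly_Mapping.keys q"
  have "Poly_Mapping.keys (p + q) \<subseteq> ?A" by (rule Poly_Mapping.keys_add)
  then show ?thesis
    by (simp add: lin_ext_superset[of ?A] lookup_add distrib_right sum.distrib)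
qed

lemma lin_ext_single: "lin_ext G (Poly_Mapping.single m c) = c * G m"
  by (cases "c = 0") (simp_all add: lin_ext_def)

lemma lin_ext_zero [simp]: "lin_ext G 0 = 0"
  by (simp add: lin_ext_def)

lemma lin_ext_uminus: "lin_ext G (- p) = - lin_ext G p"
  by (simp add: lin_ext_def sum_negf)

lemma lin_ext_diff: "lin_ext G (p - q) = lin_ext G p - lin_ext G q"
  using lin_ext_add[of G p "- q"] by (simp add: lin_ext_uminus)

lemma lin_ext_sum: "lin_ext G (\<Sum>i\<in>A. p i) = (\<Sum>i\<in>A. lin_ext G (p i))"
  by (induction A rule: infinite_finite_induct) (simp_all add: lin_ext_add)

lemma lin_ext_plus_fun: "lin_ext (\<lambda>m. G m + H m) p = lin_ext G p + lin_ext H p"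
  by (simp add: lin_ext_def distrib_left sum.distrib)

lemma lin_ext_sum_fun: "lin_ext (\<lambda>m. \<Sum>i\<in>A. G i m) p = (\<Sum>i\<in>A. lin_ext (G i) p)"
  unfolding lin_ext_def sum_distrib_left by (rule sum.swap)

lemma lin_ext_scale_fun: "lin_ext (\<lambda>m. c * G m) p = c * lin_ext G p"
  by (simp add: lin_ext_def sum_distrib_left mult_ac)

section \<open>Monomials, constants and variables of the Laurent ring\<close>

type_synonym laurent = "(nat \<Rightarrow>\<^sub>0 int) \<Rightarrow>\<^sub>0 real"

definition lmonom :: "(nat \<Rightarrow>\<^sub>0 int) \<Rightarrow> laurent" where
  "lmonom m = Poly_Mapping.single m 1"

definition lconst :: "real \<Rightarrow> laurent" where
  "lconst = Poly_Mapping.single 0"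

definition lvar :: "nat \<Rightarrow> laurent" where
  "lvar k = lmonom (Poly_Mapping.single k 1)"

definition lvar_inv :: "nat \<Rightarrow> laurent" where
  "lvar_inv k = lmonom (Poly_Mapping.single k (-1))"

lemma lmonom_add: "lmonom (m + m') = lmonom m * lmonom m'"
  by (simp add: lmonom_def mult_single)

lemma lmonom_0: "lmonom 0 = 1"
  by (simp add: lmonom_def)

lemma lvar_inverse: "lvar_inv k * lvar k = 1" "lvar k * lvar_inv k = 1"
  by (simp_all add: lvar_def lvar_inv_def flip: lmonom_add single_add lmonom_0)

lemma lmonom_nonzero: "lmonom m \<noteq> 0"
proof
  assume "lmonom m = 0"
  then have "Poly_Mapping.lookup (lmonom m) m = 0" by simp
  then show False by (simp add: lmonom_def)
qed

lemma lmonom_eq_iff: "lmonom m = lmonom m' \<longleftrightarrow> m = m'"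
proof
  assume "lmonom m = lmonom m'"
  then have "Poly_Mapping.lookup (lmonom m) m = Poly_Mapping.lookup (lmonom m') m" by simp
  then show "m = m'" by (simp add: lmonom_def lookup_single when_def split: if_splits)
qed simp

lemma lvar_eq_iff: "lvar k = lvar l \<longleftrightarrow> k = l"
proof
  assume "lvar k = lvar l"
  then have "Poly_Mapping.single k (1::int) = Poly_Mapping.single l 1"
    by (simp add: lvar_def lmonom_eq_iff)
  then have "Poly_Mapping.lookup (Poly_Mapping.single k (1::int)) k = Poly_Mapping.lookup (Poly_Mapping.single l 1) k"
    by simp
  then show "k = l" by (simp add: lookup_single when_def split: if_splits)
qed simp

lemma lvar_nonzero: "lvar k \<noteq> 0"
  by (simp add: lvar_def lmonom_nonzero)

lemma lconst_hom:
  "lconst (a + b) = lconst a + lconst b" "lconst (a - b) = lconst a - lconst b"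
  "lconst (a * b) = lconst a * lconst b" "lconst 0 = 0" "lconst 1 = 1"
  "lconst (- a) = - lconst a" "lconst (of_nat k) = of_nat k" "lconst (of_int i) = of_int i"
  "lconst (numeral v) = numeral v"
  by (simp_all add: lconst_def single_add single_diff mult_single single_uminus)

lemma lin_ext_lconst: "lin_ext G (lconst c * p) = c * lin_ext G p"
proof (induction p rule: poly_mapping_additive_induct)
  case (single m d)
  then show ?case by (simp add: lconst_def mult_single lin_ext_single)
next
  case (add p q)
  then show ?case by (simp add: distrib_left lin_ext_add)
qed

lemma lin_ext_lmonom_mult: "lin_ext G (lmonom m' * p) = lin_ext (\<lambda>m. G (m' + m)) p"
proof (induction p rule: poly_mapping_additive_induct)
  case (single m d)
  then show ?case by (simp add: lmonom_def mult_single lin_ext_single)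
next
  case (add p q)
  then show ?case by (simp add: distrib_left lin_ext_add)
qed

text \<open>The Euler derivation \<open>w\<^sub>k \<partial>/\<partial>w\<^sub>k\<close>.\<close>

lift_definition theta :: "nat \<Rightarrow> laurent \<Rightarrow> laurent" is
  "\<lambda>k p m. of_int (Poly_Mapping.lookup m k) * p m"
  by (rule finite_subset) auto

lemma theta_add: "theta k (p + q) = theta k p + theta k q"
  by (rule poly_mapping_eqI) (simp add: theta.rep_eq lookup_add distrib_left)

lemma theta_diff: "theta k (p - q) = theta k p - theta k q"
  by (rule poly_mapping_eqI) (simp add: theta.rep_eq lookup_minus right_diff_distrib)

lemma theta_0: "theta k 0 = 0"
  by (rule poly_mapping_eqI) (simp add: theta.rep_eq)

lemma theta_sum: "theta k (\<Sum>i\<in>A. p i) = (\<Sum>i\<in>A. theta k (p i))"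
  by (induction A rule: infinite_finite_induct) (simp_all add: theta_add theta_0)

lemma theta_single:
  "theta k (Poly_Mapping.single m c) = Poly_Mapping.single m (of_int (Poly_Mapping.lookup m k) * c)"
  by (rule poly_mapping_eqI) (simp add: theta.rep_eq lookup_single when_def)

lemma theta_mult: "theta k (p * q) = theta k p * q + p * theta k q"
proof (induction p rule: poly_mapping_additive_induct)
  case (single m c)
  show ?case
  proof (induction q rule: poly_mapping_additive_induct)
    case (single m' c')
    show ?case
      by (simp add: mult_single theta_single lookup_add algebra_simps flip: single_add)
  next
    case (add p q)
    then show ?case by (simp add: distrib_left theta_add algebra_simps)
  qed
next
  case (add p q)
  then show ?case by (simp add: distrib_right theta_add algebra_simps)
qed

lemma theta_lmonom: "theta k (lmonom m) = of_int (Poly_Mapping.lookup m k) * lmonom m"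
  unfolding lconst_hom(8)[symmetric] lconst_def lmonom_def theta_single mult_single by simp

lemma theta_lvar: "theta k (lvar l) = of_bool (k = l) * lvar l"
  by (simp add: lvar_def theta_lmonom lookup_single when_def)

lemma theta_lconst_mult: "theta k (lconst c * p) = lconst c * theta k p"
  by (simp add: theta_mult lconst_def theta_single)

text \<open>Transposition: under the functional, \<open>theta k\<close> becomes multiplication of
  the values by the exponent at \<open>k\<close>, just as a monomial factor becomes a shift of the
  argument. Operators acting on the index of \<open>G\<close> can therefore be moved to the Laurent
  polynomial.\<close>

lemma lin_ext_theta: "lin_ext G (theta k p) = lin_ext (\<lambda>m. of_int (Poly_Mapping.lookup m k) * G m) p"
proof (induction p rule: poly_mapping_additive_induct)
  case (single m d)
  then show ?case by (simp add: theta_single lin_ext_single)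
next
  case (add p q)
  then show ?case by (simp add: theta_add lin_ext_add)
qed

subsection \<open>Partial fraction identities\<close>

lemma sum_offdiag_swap:
  assumes "finite I"
  shows "(\<Sum>k\<in>I. \<Sum>l\<in>I - {k}. f k l) = (\<Sum>k\<in>I. \<Sum>l\<in>I - {k}. f l k)"
proof -
  have "(\<Sum>k\<in>I. \<Sum>l\<in>I - {k}. f k l) = (\<Sum>k\<in>I. \<Sum>l\<in>{l\<in>I. l \<noteq> k}. f k l)"
    by (intro sum.cong) auto
  also have "\<dots> = (\<Sum>l\<in>I. \<Sum>k\<in>{k\<in>I. l \<noteq> k}. f k l)"
    by (rule sum.swap_restrict) (use assms in auto)
  also have "\<dots> = (\<Sum>k\<in>I. \<Sum>l\<in>I - {k}. f l k)"
    by (intro sum.cong) auto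
  finally show ?thesis .
qed

lemma sum_offdiag_symmetrize:
  fixes f :: "'i \<Rightarrow> 'i \<Rightarrow> 'a::comm_ring_1"
  assumes "finite I"
  shows "2 * (\<Sum>k\<in>I. \<Sum>l\<in>I - {k}. f k l) = (\<Sum>k\<in>I. \<Sum>l\<in>I - {k}. f k l + f l k)"
  unfolding sum.distrib sum_offdiag_swap[OF assms, of "\<lambda>k l. f l k"] by (rule mult_2)

lemma sum_offdiag_pairs:
  fixes f :: "nat \<Rightarrow> nat \<Rightarrow> 'a::comm_monoid_add"
  shows "(\<Sum>k=1..N. \<Sum>l\<in>{1..N} - {k}. f k l) = (\<Sum>k=1..N. \<Sum>l\<in>{k<..N}. f k l + f l k)"
proof -
  have "(\<Sum>k=1..N. \<Sum>l\<in>{1..N} - {k}. f k l)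
      = (\<Sum>k=1..N. (\<Sum>l\<in>{k<..N}. f k l) + (\<Sum>l\<in>{l\<in>{1..N}. l < k}. f k l))"
  proof (rule sum.cong[OF refl])
    fix k assume "k \<in> {1..N}"
    then have *: "{1..N} - {k} = {k<..N} \<union> {l\<in>{1..N}. l < k}" by auto
    show "(\<Sum>l\<in>{1..N} - {k}. f k l) = (\<Sum>l\<in>{k<..N}. f k l) + (\<Sum>l\<in>{l\<in>{1..N}. l < k}. f k l)"
      unfolding * by (rule sum.union_disjoint) auto
  qed
  moreover have "(\<Sum>k=1..N. (\<Sum>l\<in>{l\<in>{1..N}. l < k}. f k l)) = (\<Sum>l=1..N. (\<Sum>k\<in>{k\<in>{1..N}. l < k}. f k l))"
    by (rule sum.swap_restrict) auto
  moreover have "\<dots> = (\<Sum>l=1..N. (\<Sum>k\<in>{l<..N}. f k l))"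
    by (intro sum.cong) auto
  ultimately show ?thesis by (simp add: sum.distrib)
qed

text \<open>Partial fractions for three points; \<open>x\<close> will be the point added in the
  induction for \<open>three_body_identity\<close>.\<close>

lemma partial_fraction_pair:
  fixes a b x :: "'a::field"
  assumes "a \<noteq> x" "b \<noteq> x" "a \<noteq> b"
  shows "a / ((a - x) * (a - b)) + b / ((b - x) * (b - a)) = - x * (1 / ((x - a) * (x - b)))"
proof -
  define P Q R where "P = inverse (a - x)" "Q = inverse (b - x)" "R = inverse (a - b)"
  have *: "(a - x) * P = 1" "(b - x) * Q = 1" "(a - b) * R = 1"
    using assms by (simp_all add: P_Q_R_def)
  have inv: "inverse (x - a) = - P" "inverse (x - b) = - Q" "inverse (b - a) = - R"
    unfolding P_Q_R_def by (metis inverse_minus_eq minus_diff_eq)+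
  have "a * (P * R) - b * (Q * R) = - x * (P * Q)"
    using * by algebra
  then show ?thesis
    by (simp add: divide_inverse inv flip: P_Q_R_def)
qed

text \<open>Expanding the squares, the terms with three distinct indices cancel: the sum of w_k /
  ((w_k - w_l) (w_k - w_i)) over the three choices of the distinguished index is the second divided
  difference of the identity function, hence 0. The induction on \<open>I\<close> only has to see
  this for triples containing the new point \<open>x\<close>.\<close>

lemma three_body_identity:
  fixes w :: "'i \<Rightarrow> 'a::field"
  assumes "finite I" "inj_on w I"
  shows "(\<Sum>k\<in>I. w k * (\<Sum>l\<in>I - {k}. 1 / (w k - w l))\<^sup>2) = (\<Sum>k\<in>I. \<Sum>l\<in>I - {k}. w k / (w k - w l)\<^sup>2)"
  using assms
proof (induction I rule: finite_induct)
  case empty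
  then show ?case by simp
next
  case (insert x I)
  define A where "A k = (\<Sum>l\<in>I - {k}. 1 / (w k - w l))" for k
  have ne: "w k \<noteq> w l" if "k \<in> I" "l \<in> I" "k \<noteq> l" for k l
    using insert.prems that by (auto simp: inj_on_def)
  have nx: "w k \<noteq> w x" if "k \<in> I" for k
    using insert.prems insert.hyps that by (auto simp: inj_on_def)
  have IH: "(\<Sum>k\<in>I. w k * (A k)\<^sup>2) = (\<Sum>k\<in>I. \<Sum>l\<in>I - {k}. w k / (w k - w l)\<^sup>2)"
    using insert.IH insert.prems unfolding A_def by simp
  have Ix: "insert x I - {k} = insert x (I - {k})" if "k \<in> I" for k
    using insert.hyps that by auto
  have Ax: "insert x I - {x} = I"
    using insert.hyps by auto
  have Axx: "I - {x} = I" using insert.hyps by auto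
  have sq: "(\<Sum>l\<in>I. 1 / (w x - w l))\<^sup>2 =
      (\<Sum>l\<in>I. 1 / (w x - w l)\<^sup>2) + (\<Sum>k\<in>I. \<Sum>l\<in>I - {k}. 1 / ((w x - w k) * (w x - w l)))"
    unfolding power2_eq_square sum_product sum.distrib[symmetric]
  proof (intro sum.cong refl)
    fix k assume "k \<in> I"
    show "(\<Sum>l\<in>I. 1 / (w x - w k) * (1 / (w x - w l))) =
        1 / ((w x - w k) * (w x - w k)) + (\<Sum>l\<in>I - {k}. 1 / ((w x - w k) * (w x - w l)))"
      by (subst sum.remove[OF insert.hyps(1) \<open>k \<in> I\<close>]) simp
  qed
  have cross: "2 * (\<Sum>k\<in>I. w k * A k / (w k - w x)) =
      - w x * (\<Sum>k\<in>I. \<Sum>l\<in>I - {k}. 1 / ((w x - w k) * (w x - w l)))"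
  proof -
    have "2 * (\<Sum>k\<in>I. w k * A k / (w k - w x)) =
       2 * (\<Sum>k\<in>I. \<Sum>l\<in>I - {k}. w k / ((w k - w x) * (w k - w l)))"
      by (simp add: A_def sum_distrib_left sum_divide_distrib mult.commute)
    also have "\<dots> = (\<Sum>k\<in>I. \<Sum>l\<in>I - {k}. w k / ((w k - w x) * (w k - w l)) + w l / ((w l - w x) * (w l - w k)))"
      by (rule sum_offdiag_symmetrize[OF insert.hyps(1)])
    also have "\<dots> = (\<Sum>k\<in>I. \<Sum>l\<in>I - {k}. - w x * (1 / ((w x - w k) * (w x - w l))))"
    proof (intro sum.cong refl)
      fix k l assume "k \<in> I" "l \<in> I - {k}"
      then have nz: "w k - w x \<noteq> 0" "w l - w x \<noteq> 0" "w k - w l \<noteq> 0"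
        using ne[of k l] nx[of k] nx[of l] by auto
      then show "w k / ((w k - w x) * (w k - w l)) + w l / ((w l - w x) * (w l - w k)) =
          - w x * (1 / ((w x - w k) * (w x - w l)))"
        by (intro partial_fraction_pair) auto
    qed
    finally show ?thesis by (simp add: sum_distrib_left)
  qed
  have "(\<Sum>k\<in>insert x I. w k * (\<Sum>l\<in>insert x I - {k}. 1 / (w k - w l))\<^sup>2)
      = w x * (\<Sum>l\<in>I. 1 / (w x - w l))\<^sup>2 + (\<Sum>k\<in>I. w k * (1 / (w k - w x) + A k)\<^sup>2)"
  proof -
    have "(\<Sum>l\<in>insert x I - {k}. 1 / (w k - w l)) = 1 / (w k - w x) + A k" if "k \<in> I" for k
      using insert.hyps that by (simp add: Ix A_def)
    then show ?thesis
      using insert.hyps by (simp add: Axx)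
  qed
  also have "(\<Sum>k\<in>I. w k * (1 / (w k - w x) + A k)\<^sup>2) =
     (\<Sum>k\<in>I. w k / (w k - w x)\<^sup>2) + 2 * (\<Sum>k\<in>I. w k * A k / (w k - w x)) + (\<Sum>k\<in>I. w k * (A k)\<^sup>2)"
    unfolding sum_distrib_left sum.distrib[symmetric]
  proof (intro sum.cong refl)
    fix k
    show "w k * (1 / (w k - w x) + A k)\<^sup>2 = w k / (w k - w x)\<^sup>2 + 2 * (w k * A k / (w k - w x)) + w k * (A k)\<^sup>2"
      unfolding divide_inverse power2_eq_square inverse_mult_distrib by algebra
  qed
  also have "w x * (\<Sum>l\<in>I. 1 / (w x - w l))\<^sup>2 + ((\<Sum>k\<in>I. w k / (w k - w x)\<^sup>2) +
      2 * (\<Sum>k\<in>I. w k * A k / (w k - w x)) + (\<Sum>k\<in>I. w k * (A k)\<^sup>2)) =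
      (\<Sum>l\<in>I. w x / (w x - w l)\<^sup>2) + (\<Sum>k\<in>I. w k / (w k - w x)\<^sup>2) + (\<Sum>k\<in>I. \<Sum>l\<in>I - {k}. w k / (w k - w l)\<^sup>2)"
  proof -
    have "w x * (a + b) + (c + - w x * b + d) = w x * a + c + d" for a b c d
      by algebra
    moreover have "(\<Sum>l\<in>I. w x / (w x - w l)\<^sup>2) = w x * (\<Sum>l\<in>I. 1 / (w x - w l)\<^sup>2)"
      by (simp add: sum_distrib_left)
    ultimately show ?thesis
      unfolding sq cross IH by simp
  qed
  also have "\<dots> = (\<Sum>k\<in>insert x I. \<Sum>l\<in>insert x I - {k}. w k / (w k - w l)\<^sup>2)"
  proof -
    have "(\<Sum>l\<in>insert x I - {k}. w k / (w k - w l)\<^sup>2) =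
        w k / (w k - w x)\<^sup>2 + (\<Sum>l\<in>I - {k}. w k / (w k - w l)\<^sup>2)" if "k \<in> I" for k
      using insert.hyps that by (simp add: Ix)
    then show ?thesis
      using insert.hyps by (simp add: Axx sum.distrib)
  qed
  finally show ?case .
qed

text \<open>Here \<open>nu k + M * W k * A k\<close> stands for the logarithmic derivative of
  \<open>f\<close>, so all derivatives have already been substituted. The mixed terms
  \<open>nu k * A k\<close> of the two sums cancel, the \<open>A k\<close> add up to 0 by
  antisymmetry, and \<open>three_body_identity\<close> identifies the sum of
  \<open>W k * (A k)^2\<close> with the pair sum S. What remains is (M^2 - M) S + 2 (M - M^2) S = -
  M (M - 1) S, times \<open>f\<close>.\<close>

lemma calogero_field_identity:
  fixes W nu :: "nat \<Rightarrow> 'a::field" and M c1 c2 f :: 'a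
  assumes W0: "\<And>k. k \<in> {1..N} \<Longrightarrow> W k \<noteq> 0" and inj: "inj_on W {1..N}"
  defines "A \<equiv> \<lambda>k. \<Sum>l\<in>{1..N} - {k}. 1 / (W k - W l)"
  shows "(\<Sum>k=1..N. (f * nu k * (nu k + M * W k * A k)
            + M * (\<Sum>l\<in>{1..N} - {k}. f * (W k / (W k - W l)) * (1 + (nu k + M * W k * A k) - W k / (W k - W l)))
            + (c1 + c2) * (f * (nu k + M * W k * A k)) + c1 * c2 * f) / W k)
        + 2 * M * (\<Sum>k=1..N. \<Sum>l\<in>{k<..N}. f / (W k - W l) *
             ((nu l + M * W l * A l) - (nu k + M * W k * A k) + (W k + W l) / (W k - W l)))
     = (\<Sum>k=1..N. (nu k + c1) * (nu k + c2) * (f / W k))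
        - M * (M - 1) * (\<Sum>k=1..N. \<Sum>l\<in>{k<..N}. (W k + W l) * (f / (W k - W l)\<^sup>2))"
proof -
  define S where "S = (\<Sum>k=1..N. \<Sum>l\<in>{1..N} - {k}. W k / (W k - W l)\<^sup>2)"
  define B where "B = (\<Sum>k=1..N. nu k * A k)"
  define B2 where "B2 = (\<Sum>k=1..N. W k * (A k)\<^sup>2)"
  have ne: "W k \<noteq> W l" if "k \<in> {1..N}" "l \<in> {1..N}" "k \<noteq> l" for k l
    using inj_onD[OF inj] that by blast
  have B2: "B2 = S"
    unfolding B2_def S_def A_def by (rule three_body_identity) (use inj in auto)
  have A0: "(\<Sum>k=1..N. A k) = 0"
    unfolding A_def sum_offdiag_pairs
  proof (intro sum.neutral ballI)
    fix k l
    have inv: "inverse (W l - W k) = - inverse (W k - W l)"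
      by (metis inverse_minus_eq minus_diff_eq)
    show "1 / (W k - W l) + 1 / (W l - W k) = 0"
      unfolding divide_inverse inv by simp
  qed
  have S2: "(\<Sum>k=1..N. \<Sum>l\<in>{k<..N}. (W k + W l) * (f / (W k - W l)\<^sup>2)) = f * S"
    unfolding S_def sum_offdiag_pairs sum_distrib_left
  proof (intro sum.cong refl)
    fix k l
    have "(W l - W k)\<^sup>2 = (W k - W l)\<^sup>2" by (rule power2_commute)
    then show "(W k + W l) * (f / (W k - W l)\<^sup>2) = f * (W k / (W k - W l)\<^sup>2 + W l / (W l - W k)\<^sup>2)"
      by (simp add: divide_inverse algebra_simps)
  qed
  have T1: "(f * nu k * (nu k + M * W k * A k)
            + M * (\<Sum>l\<in>{1..N} - {k}. f * (W k / (W k - W l)) * (1 + (nu k + M * W k * A k) - W k / (W k - W l)))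
            + (c1 + c2) * (f * (nu k + M * W k * A k)) + c1 * c2 * f) / W k
      = (nu k + c1) * (nu k + c2) * (f / W k) + f * M * (2 * (nu k * A k) + (c1 + c2 + 1) * A k)
         + f * M * M * (W k * (A k)\<^sup>2) - f * M * (\<Sum>l\<in>{1..N} - {k}. W k / (W k - W l)\<^sup>2)"
    if k: "k \<in> {1..N}" for k
  proof -
    define R where "R = (\<Sum>l\<in>{1..N} - {k}. W k / (W k - W l)\<^sup>2)"
    define x where "x = 1 + (nu k + M * W k * A k)"
    have "(\<Sum>l\<in>{1..N} - {k}. f * (W k / (W k - W l)) * (x - W k / (W k - W l)))
       = (\<Sum>l\<in>{1..N} - {k}. f * W k * x * (1 / (W k - W l)) - f * W k * (W k / (W k - W l)\<^sup>2))"
      unfolding divide_inverse power2_eq_square inverse_mult_distrib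
      by (intro sum.cong refl) algebra
    also have "\<dots> = f * W k * x * A k - f * W k * R"
      unfolding A_def R_def sum_subtractf sum_distrib_left ..
    finally have eq: "(\<Sum>l\<in>{1..N} - {k}. f * (W k / (W k - W l)) * (x - W k / (W k - W l))) = f * W k * x * A k - f * W k * R" .
    define V where "V = inverse (W k)"
    have V: "W k * V = 1" using W0[OF k] by (simp add: V_def)
    define Q where "Q = f * M * (2 * (nu k * A k) + (c1 + c2 + 1) * A k) + f * M * M * (W k * (A k)\<^sup>2) - f * M * R"
    have "f * nu k * (nu k + M * W k * A k) + M * (f * W k * x * A k - f * W k * R)
            + (c1 + c2) * (f * (nu k + M * W k * A k)) + c1 * c2 * f = (nu k + c1) * (nu k + c2) * f + W k * Q"
      unfolding x_def Q_def power2_eq_square by (simp add: algebra_simps)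
    moreover have "(P + W k * Q) * V = P * V + Q" for P
      using V by (simp add: distrib_right mult.assoc mult.left_commute[of Q])
    moreover have "P / W k = P * V" for P
      by (simp add: V_def divide_inverse)
    ultimately show ?thesis
      unfolding x_def[symmetric] eq R_def[symmetric] by (simp only: Q_def) (simp add: algebra_simps)
  qed
  have T2: "(\<Sum>k=1..N. \<Sum>l\<in>{k<..N}. f / (W k - W l) *
             ((nu l + M * W l * A l) - (nu k + M * W k * A k) + (W k + W l) / (W k - W l)))
     = f * (S - B - M * B2)"
  proof -
    define b where "b k = nu k + M * W k * A k" for k
    have "(\<Sum>k=1..N. \<Sum>l\<in>{k<..N}. f / (W k - W l) * (b l - b k + (W k + W l) / (W k - W l)))
       = (\<Sum>k=1..N. \<Sum>l\<in>{k<..N}. f * (W k / (W k - W l)\<^sup>2 - b k * (1 / (W k - W l)))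
              + f * (W l / (W l - W k)\<^sup>2 - b l * (1 / (W l - W k))))"
    proof (intro sum.cong refl)
      fix k l
      have inv: "inverse (W l - W k) = - inverse (W k - W l)"
        by (metis inverse_minus_eq minus_diff_eq)
      show "f / (W k - W l) * (b l - b k + (W k + W l) / (W k - W l))
        = f * (W k / (W k - W l)\<^sup>2 - b k * (1 / (W k - W l)))
              + f * (W l / (W l - W k)\<^sup>2 - b l * (1 / (W l - W k)))"
        unfolding divide_inverse power2_eq_square inverse_mult_distrib inv by algebra
    qed
    also have "\<dots> = (\<Sum>k=1..N. \<Sum>l\<in>{1..N} - {k}. f * (W k / (W k - W l)\<^sup>2 - b k * (1 / (W k - W l))))"
      by (rule sum_offdiag_pairs[symmetric])
    also have "\<dots> = f * (S - (\<Sum>k=1..N. b k * A k))"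
      unfolding S_def A_def by (simp only: sum_distrib_left[symmetric] sum_subtractf)
    also have "(\<Sum>k=1..N. b k * A k) = B + M * B2"
      by (simp add: b_def B_def B2_def sum_distrib_left power2_eq_square algebra_simps flip: sum.distrib)
    finally show ?thesis by (simp add: b_def algebra_simps)
  qed
  have "(\<Sum>k=1..N. (f * nu k * (nu k + M * W k * A k)
            + M * (\<Sum>l\<in>{1..N} - {k}. f * (W k / (W k - W l)) * (1 + (nu k + M * W k * A k) - W k / (W k - W l)))
            + (c1 + c2) * (f * (nu k + M * W k * A k)) + c1 * c2 * f) / W k)
     = (\<Sum>k=1..N. (nu k + c1) * (nu k + c2) * (f / W k)) + f * M * (2 * B + (c1 + c2 + 1) * (\<Sum>k=1..N. A k))
         + f * M * M * B2 - f * M * S"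
    unfolding S_def B_def B2_def
    by (subst sum.cong[OF refl T1], assumption)
      (simp only: sum.distrib sum_subtractf sum_distrib_left[symmetric])
  note eq = this[unfolded A0 B2]
  show ?thesis
    unfolding T2 S2 B2 eq by (simp add: algebra_simps)
qed

text \<open>The derivations \<open>theta k\<close> are only needed on the ring; in the field of fractions it is enough to
  know their logarithmic derivatives.\<close>

definition log_theta :: "nat \<Rightarrow> laurent \<Rightarrow> laurent fract" where
  "log_theta k p = to_fract (theta k p) / to_fract p"

lemma to_fract_theta: "p \<noteq> 0 \<Longrightarrow> to_fract (theta k p) = to_fract p * log_theta k p"
  by (simp add: log_theta_def)

lemma log_theta_mult: "p \<noteq> 0 \<Longrightarrow> q \<noteq> 0 \<Longrightarrow> log_theta k (p * q) = log_theta k p + log_theta k q"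
  by (simp add: log_theta_def theta_mult add_divide_distrib)

lemma log_theta_one: "log_theta k 1 = 0"
  by (simp add: log_theta_def theta_lmonom flip: lmonom_0)

lemma log_theta_power: "p \<noteq> 0 \<Longrightarrow> log_theta k (p ^ M) = of_nat M * log_theta k p"
  by (induction M) (simp_all add: log_theta_one log_theta_mult algebra_simps)

lemma log_theta_prod: "(\<And>i. i \<in> A \<Longrightarrow> p i \<noteq> 0) \<Longrightarrow> log_theta k (\<Prod>i\<in>A. p i) = (\<Sum>i\<in>A. log_theta k (p i))"
  by (induction A rule: infinite_finite_induct) (simp_all add: log_theta_one log_theta_mult)

lemma to_fract_of_nat: "to_fract (of_nat n) = of_nat n"
  by (induction n) simp_all

lemma to_fract_of_int: "to_fract (of_int n) = of_int n"
  by (cases n) (simp_all add: to_fract_of_nat del: of_nat_Suc)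

lemma to_fract_sum: "to_fract (\<Sum>i\<in>A. p i) = (\<Sum>i\<in>A. to_fract (p i))"
  by (induction A rule: infinite_finite_induct) simp_all

lemma to_fract_power: "to_fract (p ^ n) = to_fract p ^ n"
  by (induction n) simp_all

lemma log_theta_lmonom: "log_theta k (lmonom m) = of_int (Poly_Mapping.lookup m k)"
  by (simp add: log_theta_def theta_lmonom lmonom_nonzero to_fract_of_int)

lemma log_theta_lvar: "log_theta k (lvar l) = of_bool (k = l)"
  by (simp add: lvar_def log_theta_lmonom lookup_single when_def)

text \<open>Written with differences w_l - w_k instead of 1 - w_k / w_l, so that up to sign all
  variables enter alike and the logarithmic derivative takes the same form for every index.\<close>

definition lambda_ground :: "nat \<Rightarrow> (nat \<Rightarrow>\<^sub>0 int) \<Rightarrow> nat \<Rightarrow> laurent" where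
  "lambda_ground N m M = lmonom m * (\<Prod>k=1..N. \<Prod>l\<in>{k<..N}. (lvar l - lvar k) ^ M)"

lemma lambda_ground_nonzero: "lambda_ground N m M \<noteq> 0"
  unfolding lambda_ground_def by (auto simp: lmonom_nonzero lvar_eq_iff)

lemma log_theta_lvar_diff:
  "log_theta k (lvar j - lvar i) = (of_bool (k = j) * to_fract (lvar j) - of_bool (k = i) * to_fract (lvar i))
      / (to_fract (lvar j) - to_fract (lvar i))"
  by (simp add: log_theta_def theta_diff theta_lvar)

text \<open>Only the pairs containing \<open>k\<close> contribute. The antisymmetry of 1 / (w_j -
  w_i) merges the pairs with \<open>k\<close> on the left and those with \<open>k\<close> on the
  right into one sum over all other indices.\<close>

lemma log_theta_lambda_ground:
  assumes k: "k \<in> {1..N}"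
  shows "log_theta k (lambda_ground N m M) = of_int (Poly_Mapping.lookup m k) +
     of_nat M * to_fract (lvar k) * (\<Sum>l\<in>{1..N} - {k}. 1 / (to_fract (lvar k) - to_fract (lvar l)))"
proof -
  define W where "W k = to_fract (lvar k)" for k
  have "log_theta k (lambda_ground N m M) = of_int (Poly_Mapping.lookup m k) +
     (\<Sum>i=1..N. \<Sum>j\<in>{i<..N}. of_nat M * ((of_bool (k = j) * W j - of_bool (k = i) * W i) / (W j - W i)))"
  proof -
    have nz: "lvar l - lvar i \<noteq> 0" if "l \<in> {i<..N}" for i l
      using that by (simp add: lvar_eq_iff)
    have "(\<Prod>l\<in>{i<..N}. (lvar l - lvar i) ^ M) \<noteq> 0" for i
      using nz by simp
    moreover have "log_theta k (\<Prod>l\<in>{i<..N}. (lvar l - lvar i) ^ M) =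
        (\<Sum>l\<in>{i<..N}. of_nat M * ((of_bool (k = l) * W l - of_bool (k = i) * W i) / (W l - W i)))" for i
    proof -
      have "log_theta k (\<Prod>l\<in>{i<..N}. (lvar l - lvar i) ^ M) = (\<Sum>l\<in>{i<..N}. log_theta k ((lvar l - lvar i) ^ M))"
        by (rule log_theta_prod) (use nz in simp)
      also have "\<dots> = (\<Sum>l\<in>{i<..N}. of_nat M * ((of_bool (k = l) * W l - of_bool (k = i) * W i) / (W l - W i)))"
        unfolding W_def log_theta_lvar_diff[symmetric] by (intro sum.cong refl log_theta_power nz)
      finally show ?thesis .
    qed
    ultimately show ?thesis
      unfolding lambda_ground_def by (subst log_theta_mult) (auto simp: lmonom_nonzero log_theta_lmonom log_theta_prod)
  qed
  also have "(\<Sum>i=1..N. \<Sum>j\<in>{i<..N}. of_nat M * ((of_bool (k = j) * W j - of_bool (k = i) * W i) / (W j - W i)))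
     = (\<Sum>i=1..N. \<Sum>j\<in>{i<..N}. of_bool (k = i) * (of_nat M * W i * (1 / (W i - W j)))
          + of_bool (k = j) * (of_nat M * W j * (1 / (W j - W i))))"
  proof (intro sum.cong refl)
    fix i j
    have inv: "inverse (W j - W i) = - inverse (W i - W j)"
      by (metis inverse_minus_eq minus_diff_eq)
    show "of_nat M * ((of_bool (k = j) * W j - of_bool (k = i) * W i) / (W j - W i)) =
       of_bool (k = i) * (of_nat M * W i * (1 / (W i - W j))) + of_bool (k = j) * (of_nat M * W j * (1 / (W j - W i)))"
      unfolding divide_inverse inv by algebra
  qed
  also have "\<dots> = (\<Sum>i=1..N. of_bool (k = i) * (of_nat M * W i * (\<Sum>j\<in>{1..N} - {i}. 1 / (W i - W j))))"
    unfolding sum_distrib_left by (rule sum_offdiag_pairs[symmetric])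
  also have "\<dots> = of_nat M * W k * (\<Sum>j\<in>{1..N} - {k}. 1 / (W k - W j))"
    using k by (simp add: of_bool_def if_distrib[of "\<lambda>x. x * _"] cong: if_cong)
  finally show ?thesis by (simp add: W_def)
qed

text \<open>Conjugation by \<open>\<Prod> (w\<^sub>l - w\<^sub>k)\<^sup>M\<close> removes the first-order interaction of the reduced operator and
  leaves the potential \<open>M (M - 1) (w\<^sub>k + w\<^sub>l) / (w\<^sub>k - w\<^sub>l)\<^sup>2\<close>.\<close>

lemma laurent_identity:
  fixes N M :: nat and m :: "nat \<Rightarrow>\<^sub>0 int" and c1 c2 :: real
  defines "F \<equiv> lambda_ground N m M" and "nu \<equiv> \<lambda>k. real_of_int (Poly_Mapping.lookup m k)"
  assumes H: "\<And>k l. k \<in> {1..N} \<Longrightarrow> l \<in> {1..N} \<Longrightarrow> k \<noteq> l \<Longrightarrow> F = (lvar k - lvar l) * H k l"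
    and X: "\<And>k l. k \<in> {1..N} \<Longrightarrow> l \<in> {k<..N} \<Longrightarrow> F = (lvar k - lvar l)\<^sup>2 * X k l"
  shows "(\<Sum>k=1..N. lvar_inv k * (theta k (theta k F) + lconst (c1 + c2) * theta k F + lconst (c1 * c2) * F))
      + lconst (2 * real M) * (\<Sum>k=1..N. \<Sum>l\<in>{k<..N}. theta l (H k l) - theta k (H k l))
    = (\<Sum>k=1..N. lconst ((nu k + c1) * (nu k + c2)) * (lvar_inv k * F))
      - lconst (real M * (real M - 1)) * (\<Sum>k=1..N. \<Sum>l\<in>{k<..N}. (lvar k + lvar l) * X k l)"
proof -
  define W where "W k = to_fract (lvar k)" for k
  define A where "A k = (\<Sum>l\<in>{1..N} - {k}. 1 / (W k - W l))" for k
  define f where "f = to_fract F"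
  define \<kappa> where "\<kappa> r = to_fract (lconst r)" for r
  define b where "b k = \<kappa> (nu k) + \<kappa> (real M) * W k * A k" for k
  have F0: "F \<noteq> 0" unfolding F_def by (rule lambda_ground_nonzero)
  have \<kappa>: "\<kappa> (r + s) = \<kappa> r + \<kappa> s" "\<kappa> (r - s) = \<kappa> r - \<kappa> s" "\<kappa> (r * s) = \<kappa> r * \<kappa> s" "\<kappa> 1 = 1" "\<kappa> 2 = 2" for r s
    by (simp_all add: \<kappa>_def lconst_hom to_fract_of_nat[of 2, simplified])
  have W0: "W k \<noteq> 0" for k by (simp add: W_def lvar_nonzero)
  have ne: "W k \<noteq> W l" if "k \<noteq> l" for k l using that by (simp add: W_def lvar_eq_iff)
  have ldF: "log_theta k F = b k" if "k \<in> {1..N}" for k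
    unfolding F_def log_theta_lambda_ground[OF that] b_def A_def W_def \<kappa>_def nu_def
    by (simp add: lconst_hom to_fract_of_nat to_fract_of_int)
  have thF: "to_fract (theta k F) = f * b k" if "k \<in> {1..N}" for k
    using to_fract_theta[OF F0, of k] ldF[OF that] by (simp add: f_def)
  have Hf: "to_fract (H k l) = f / (W k - W l)" if "k \<in> {1..N}" "l \<in> {1..N}" "k \<noteq> l" for k l
    using arg_cong[OF H[OF that], of to_fract] ne[OF that(3)] by (simp add: f_def W_def)
  have H0: "H k l \<noteq> 0" if "k \<in> {1..N}" "l \<in> {1..N}" "k \<noteq> l" for k l
    using H[OF that] F0 by auto
  have Xf: "to_fract (X k l) = f / (W k - W l)\<^sup>2" if "k \<in> {1..N}" "l \<in> {k<..N}" for k l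
    using arg_cong[OF X[OF that], of to_fract] ne[of k l] that by (simp add: f_def W_def to_fract_power)
  have ldH: "log_theta i (H k l) = b i - (of_bool (i = k) * W k - of_bool (i = l) * W l) / (W k - W l)"
    if "k \<in> {1..N}" "l \<in> {1..N}" "k \<noteq> l" "i \<in> {1..N}" for i k l
  proof -
    have "log_theta i F = log_theta i (lvar k - lvar l) + log_theta i (H k l)"
      by (subst H[OF that(1-3)], rule log_theta_mult) (use H0 that in \<open>auto simp: lvar_eq_iff\<close>)
    then show ?thesis by (simp add: ldF[OF that(4)] log_theta_lvar_diff W_def)
  qed
  \<comment> \<open>The first derivative is written with the quotients \<open>H k l\<close>, hence
    inside the ring, so that \<open>theta k\<close> can be applied a second time.\<close>
  have thF': "theta k F = lconst (nu k) * F + lconst (real M) * (\<Sum>l\<in>{1..N} - {k}. lvar k * H k l)" if "k \<in> {1..N}" for k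
  proof -
    have "to_fract (theta k F) = to_fract (lconst (nu k) * F + lconst (real M) * (\<Sum>l\<in>{1..N} - {k}. lvar k * H k l))"
      using that by (simp add: thF to_fract_sum Hf b_def f_def[symmetric] \<kappa>_def[symmetric] W_def[symmetric] A_def
          sum_distrib_left algebra_simps)
    then show ?thesis by (simp only: to_fract_eq_iff)
  qed
  have ththF: "to_fract (theta k (theta k F)) = f * \<kappa> (nu k) * b k +
      \<kappa> (real M) * (\<Sum>l\<in>{1..N} - {k}. f * (W k / (W k - W l)) * (1 + b k - W k / (W k - W l)))" if k: "k \<in> {1..N}" for k
  proof -
    have *: "to_fract (theta k (lvar k * H k l)) = f * (W k / (W k - W l)) * (1 + b k - W k / (W k - W l))"
      if l: "l \<in> {1..N} - {k}" for l
      using k l by (subst to_fract_theta) (auto simp: lvar_nonzero H0 log_theta_mult log_theta_lvar ldH Hf W_def[symmetric] algebra_simps)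
    show ?thesis
      by (subst thF'[OF k], simp only: theta_add theta_lconst_mult theta_sum to_fract_add to_fract_mult to_fract_sum)
        (simp add: * thF[OF k] flip: \<kappa>_def)
  qed
  have inv: "to_fract (lvar_inv k) = 1 / W k" for k
  proof -
    have "to_fract (lvar_inv k) * W k = 1"
      using arg_cong[OF lvar_inverse(1), of to_fract k] by (simp add: W_def)
    then show ?thesis using W0[of k] by (simp add: field_simps)
  qed
  have thH: "to_fract (theta l (H k l) - theta k (H k l)) = f / (W k - W l) * (b l - b k + (W k + W l) / (W k - W l))"
    if "k \<in> {1..N}" "l \<in> {k<..N}" for k l
  proof -
    have kl: "k \<in> {1..N}" "l \<in> {1..N}" "k \<noteq> l" using that by auto
    show ?thesis
      using kl by (simp add: to_fract_theta[OF H0] ldH Hf)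
        (simp add: divide_inverse algebra_simps)
  qed
  have "to_fract ((\<Sum>k=1..N. lvar_inv k * (theta k (theta k F) + lconst (c1 + c2) * theta k F + lconst (c1 * c2) * F))
      + lconst (2 * real M) * (\<Sum>k=1..N. \<Sum>l\<in>{k<..N}. theta l (H k l) - theta k (H k l)))
    = (\<Sum>k=1..N. (f * \<kappa> (nu k) * b k +
      \<kappa> (real M) * (\<Sum>l\<in>{1..N} - {k}. f * (W k / (W k - W l)) * (1 + b k - W k / (W k - W l)))
        + (\<kappa> c1 + \<kappa> c2) * (f * b k) + \<kappa> c1 * \<kappa> c2 * f) / W k)
     + 2 * \<kappa> (real M) * (\<Sum>k=1..N. \<Sum>l\<in>{k<..N}. f / (W k - W l) * (b l - b k + (W k + W l) / (W k - W l)))"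
    unfolding to_fract_add to_fract_mult to_fract_sum inv
    by (intro arg_cong2[of _ _ _ _ "(+)"] arg_cong2[of _ _ _ _ "(*)"] sum.cong refl thH)
      (simp_all add: ththF thF \<kappa> f_def[symmetric] \<kappa>_def[symmetric])
  also have "\<dots> = (\<Sum>k=1..N. (\<kappa> (nu k) + \<kappa> c1) * (\<kappa> (nu k) + \<kappa> c2) * (f / W k))
        - \<kappa> (real M) * (\<kappa> (real M) - 1) * (\<Sum>k=1..N. \<Sum>l\<in>{k<..N}. (W k + W l) * (f / (W k - W l)\<^sup>2))"
    unfolding b_def A_def
    by (rule calogero_field_identity) (use W0 ne in \<open>auto simp: inj_on_def\<close>)
  also have "\<dots> = to_fract ((\<Sum>k=1..N. lconst ((nu k + c1) * (nu k + c2)) * (lvar_inv k * F))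
      - lconst (real M * (real M - 1)) * (\<Sum>k=1..N. \<Sum>l\<in>{k<..N}. (lvar k + lvar l) * X k l))"
    unfolding to_fract_diff to_fract_mult to_fract_sum inv
    by (intro arg_cong2[of _ _ _ _ "(-)"] arg_cong2[of _ _ _ _ "(*)"] sum.cong refl)
      (simp_all add: Xf \<kappa> f_def[symmetric] \<kappa>_def[symmetric] W_def[symmetric])
  finally show ?thesis by (simp only: to_fract_eq_iff)
qed

subsection \<open>Polynomial functions and the generating series\<close>

text \<open>An inductive certificate of polynomiality in the variables \<open>V\<close>. Induction
  over it yields restriction to a line as a univariate polynomial, closure under partial
  derivatives, and an explicit family of coefficients.\<close>

inductive polyfun :: "nat set \<Rightarrow> ((nat \<Rightarrow> real) \<Rightarrow> real) \<Rightarrow> bool" for V where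
  polyfun_const: "polyfun V (\<lambda>_. c)"
| polyfun_var: "i \<in> V \<Longrightarrow> polyfun V (\<lambda>z. z i)"
| polyfun_add: "polyfun V f \<Longrightarrow> polyfun V g \<Longrightarrow> polyfun V (\<lambda>z. f z + g z)"
| polyfun_mult: "polyfun V f \<Longrightarrow> polyfun V g \<Longrightarrow> polyfun V (\<lambda>z. f z * g z)"

lemma polyfun_sum: "(\<And>i. i \<in> A \<Longrightarrow> polyfun V (f i)) \<Longrightarrow> polyfun V (\<lambda>z. \<Sum>i\<in>A. f i z)"
  by (induction A rule: infinite_finite_induct) (auto intro: polyfun_const polyfun_add)

lemma polyfun_prod: "(\<And>i. i \<in> A \<Longrightarrow> polyfun V (f i)) \<Longrightarrow> polyfun V (\<lambda>z. \<Prod>i\<in>A. f i z)"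
  by (induction A rule: infinite_finite_induct) (auto intro: polyfun_const polyfun_mult)

lemma polyfun_power: "polyfun V f \<Longrightarrow> polyfun V (\<lambda>z. f z ^ n)"
  by (induction n) (auto intro: polyfun_const polyfun_mult)

lemma polyfun_diff:
  assumes "polyfun V f" "polyfun V g"
  shows "polyfun V (\<lambda>z. f z - g z)"
  using polyfun_add[OF assms(1) polyfun_mult[OF polyfun_const[of V "- 1"] assms(2)]] by simp

lemma polyfun_line_poly: "polyfun V f \<Longrightarrow> \<exists>p. \<forall>s. f (z(i := s)) = poly p s"
proof (induction rule: polyfun.induct)
  case (polyfun_const c)
  show ?case by (rule exI[of _ "[:c:]"]) simp
next
  case (polyfun_var k)
  show ?case
    by (rule exI[of _ "if k = i then [:0, 1:] else [:z k:]"]) simp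
next
  case (polyfun_add f g)
  then obtain p q where "\<forall>s. f (z(i := s)) = poly p s" "\<forall>s. g (z(i := s)) = poly q s" by blast
  then show ?case by (intro exI[of _ "p + q"]) (simp del: fun_upd_apply)
next
  case (polyfun_mult f g)
  then obtain p q where "\<forall>s. f (z(i := s)) = poly p s" "\<forall>s. g (z(i := s)) = poly q s" by blast
  then show ?case by (intro exI[of _ "p * q"]) (simp del: fun_upd_apply)
qed

lemma polyfun_has_derivative_ex:
  "polyfun V f \<Longrightarrow> \<exists>f'. polyfun V f' \<and> (\<forall>z t. ((\<lambda>s. f (z(j := s))) has_real_derivative f' (z(j := t))) (at t))"
proof (induction rule: polyfun.induct)
  case (polyfun_const c)
  show ?case by (rule exI[of _ "\<lambda>_. 0"]) (auto intro: polyfun.intros)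
next
  case (polyfun_var k)
  show ?case
    by (rule exI[of _ "\<lambda>_. of_bool (k = j)"]) (auto intro: polyfun.intros)
next
  case (polyfun_add f g)
  then obtain f' g' where "polyfun V f'" "polyfun V g'"
    "\<forall>z t. ((\<lambda>s. f (z(j := s))) has_real_derivative f' (z(j := t))) (at t)"
    "\<forall>z t. ((\<lambda>s. g (z(j := s))) has_real_derivative g' (z(j := t))) (at t)" by blast
  then show ?case
    by (intro exI[of _ "\<lambda>z. f' z + g' z"]) (auto simp del: fun_upd_apply intro: polyfun.intros intro!: DERIV_add)
next
  case (polyfun_mult f g)
  then obtain f' g' where "polyfun V f'" "polyfun V g'"
    "\<forall>z t. ((\<lambda>s. f (z(j := s))) has_real_derivative f' (z(j := t))) (at t)"
    "\<forall>z t. ((\<lambda>s. g (z(j := s))) has_real_derivative g' (z(j := t))) (at t)" by blast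
  with polyfun_mult.hyps show ?case
    by (intro exI[of _ "\<lambda>z. f' z * g z + g' z * f z"]) (auto simp del: fun_upd_apply intro!: polyfun.intros DERIV_mult)
qed

section \<open>Partial derivatives of polynomial functions\<close>

definition pd :: "nat \<Rightarrow> ((nat \<Rightarrow> real) \<Rightarrow> real) \<Rightarrow> (nat \<Rightarrow> real) \<Rightarrow> real" where
  "pd j f z = deriv (\<lambda>s. f (z(j := s))) (z j)"

lemma
  assumes "polyfun V f"
  shows polyfun_pd: "polyfun V (pd j f)"
    and has_derivative_pd: "((\<lambda>s. f (z(j := s))) has_real_derivative pd j f (z(j := t))) (at t)"
proof -
  obtain f' where f': "polyfun V f'" "\<And>z t. ((\<lambda>s. f (z(j := s))) has_real_derivative f' (z(j := t))) (at t)"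
    using polyfun_has_derivative_ex[OF assms] by blast
  have "pd j f z = f' z" for z
    using DERIV_imp_deriv[OF f'(2)[of z "z j"]] by (simp add: pd_def)
  then have "pd j f = f'" ..
  then show "polyfun V (pd j f)" "((\<lambda>s. f (z(j := s))) has_real_derivative pd j f (z(j := t))) (at t)"
    using f' by simp_all
qed

lemma pd_eqI:
  assumes "((\<lambda>s. f (z(j := s))) has_real_derivative d) (at (z j))"
  shows "pd j f z = d"
  unfolding pd_def by (rule DERIV_imp_deriv) (rule assms)

lemma has_derivative_pd': "polyfun V f \<Longrightarrow> ((\<lambda>s. f (z(j := s))) has_real_derivative pd j f z) (at (z j))"
  using has_derivative_pd[of V f z j "z j"] by simp

lemma pd_independent:
  assumes "\<And>s. f (z(j := s)) = f z"
  shows "pd j f z = 0"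
  by (rule pd_eqI) (simp add: assms)

lemma pd_const [simp]: "pd j (\<lambda>_. c) z = 0"
  by (rule pd_independent) simp

lemma pd_add:
  assumes "polyfun V f" "polyfun V g"
  shows "pd j (\<lambda>z. f z + g z) z = pd j f z + pd j g z"
  by (rule pd_eqI) (intro DERIV_add has_derivative_pd'[OF assms(1)] has_derivative_pd'[OF assms(2)])

lemma pd_mult:
  assumes "polyfun V f" "polyfun V g"
  shows "pd j (\<lambda>z. f z * g z) z = pd j f z * g z + f z * pd j g z"
proof (rule pd_eqI)
  show "((\<lambda>s. f (z(j := s)) * g (z(j := s))) has_real_derivative pd j f z * g z + f z * pd j g z) (at (z j))"
    using DERIV_mult[OF has_derivative_pd'[OF assms(1), of z j] has_derivative_pd'[OF assms(2), of z j]]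
    by (simp add: mult.commute)
qed

lemma pd_cmult: "polyfun V f \<Longrightarrow> pd j (\<lambda>z. c * f z) z = c * pd j f z"
  by (subst pd_mult[OF polyfun_const]) simp_all

lemma pd_sum:
  assumes "\<And>i. i \<in> A \<Longrightarrow> polyfun V (f i)"
  shows "pd j (\<lambda>z. \<Sum>i\<in>A. f i z) z = (\<Sum>i\<in>A. pd j (f i) z)"
  using assms
proof (induction A rule: infinite_finite_induct)
  case (insert x A)
  then show ?case by (simp add: pd_add[of V] polyfun_sum)
qed simp_all

lemma pd_prod:
  assumes "finite A" "\<And>i. i \<in> A \<Longrightarrow> polyfun V (f i)"
  shows "pd j (\<lambda>z. \<Prod>i\<in>A. f i z) z = (\<Sum>i\<in>A. pd j (f i) z * (\<Prod>k\<in>A - {i}. f k z))"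
  using assms
proof (induction A rule: finite_induct)
  case (insert x A)
  have "insert x A - {i} = insert x (A - {i})" if "i \<in> A" for i
    using that insert.hyps by auto
  moreover have "insert x A - {x} = A" using insert.hyps by auto
  ultimately show ?case
    using insert by (simp add: pd_mult[of V] polyfun_prod sum_distrib_left mult_ac)
qed simp

subsection \<open>Coefficients of the generating series\<close>

text \<open>The coefficient of q^a in the binomial series of (1 - q)^l.\<close>

definition bcoeff :: "real \<Rightarrow> nat \<Rightarrow> real" where
  "bcoeff l a = (- 1) ^ a * (l gchoose a)"

lemma bcoeff_0 [simp]: "bcoeff l 0 = 1"
  by (simp add: bcoeff_def)

lemma bcoeff_Suc: "of_nat (Suc a) * bcoeff l (Suc a) = (of_nat a - l) * bcoeff l a"
  using gbinomial_absorb_comp[of l a] gbinomial_absorption'[of "Suc a" l] Suc_times_gbinomial[of a "l - 1"]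
  by (simp add: bcoeff_def) (metis gbinomial_absorption gbinomial_absorb_comp minus_diff_eq mult.commute mult.left_commute mult_minus_left)

lemma bcoeff_Suc': "bcoeff l (Suc a) = (of_nat a - l) / of_nat (Suc a) * bcoeff l a"
  using bcoeff_Suc[of a l] by (simp add: field_simps)

text \<open>By the recursion \<open>bcoeff_Suc'\<close> the coefficient is a polynomial in the
  exponent; this is what later allows the coupling constant to be treated as a variable.\<close>

lemma polyfun_bcoeff: "polyfun V f \<Longrightarrow> polyfun V (\<lambda>z. bcoeff (f z) a)"
proof (induction a)
  case 0
  then show ?case by (simp add: polyfun_const)
next
  case (Suc a)
  have "polyfun V (\<lambda>z. (1 / of_nat (Suc a)) * (of_nat a - f z) * bcoeff (f z) a)"
    by (intro polyfun_mult polyfun_diff polyfun_const Suc)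
  then show ?case by (simp add: bcoeff_Suc' del: of_nat_Suc)
qed

section \<open>Power series whose coefficients are polynomial functions\<close>

definition fps_polyfun :: "nat set \<Rightarrow> ((nat \<Rightarrow> real) \<Rightarrow> real fps) \<Rightarrow> bool" where
  "fps_polyfun V f \<longleftrightarrow> (\<forall>m. polyfun V (\<lambda>z. fps_nth (f z) m))"

definition fps_pd :: "nat \<Rightarrow> ((nat \<Rightarrow> real) \<Rightarrow> real fps) \<Rightarrow> (nat \<Rightarrow> real) \<Rightarrow> real fps" where
  "fps_pd j f z = Abs_fps (\<lambda>m. pd j (\<lambda>z. fps_nth (f z) m) z)"

lemma fps_polyfun_const: "fps_polyfun V (\<lambda>_. c)"
  by (simp add: fps_polyfun_def polyfun_const)

lemma fps_polyfun_mult: "fps_polyfun V f \<Longrightarrow> fps_polyfun V g \<Longrightarrow> fps_polyfun V (\<lambda>z. f z * g z)"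
  by (auto simp: fps_polyfun_def fps_mult_nth intro!: polyfun_sum polyfun_mult)

lemma fps_polyfun_prod: "(\<And>i. i \<in> A \<Longrightarrow> fps_polyfun V (f i)) \<Longrightarrow> fps_polyfun V (\<lambda>z. \<Prod>i\<in>A. f i z)"
  by (induction A rule: infinite_finite_induct) (auto intro: fps_polyfun_const fps_polyfun_mult)

lemma fps_pd_mult:
  assumes "fps_polyfun V f" "fps_polyfun V g"
  shows "fps_pd j (\<lambda>z. f z * g z) z = fps_pd j f z * g z + f z * fps_pd j g z"
proof (rule fps_ext)
  fix m
  have *: "polyfun V (\<lambda>z. fps_nth (f z) i)" "polyfun V (\<lambda>z. fps_nth (g z) i)" for i
    using assms by (simp_all add: fps_polyfun_def)
  show "fps_nth (fps_pd j (\<lambda>z. f z * g z) z) m = fps_nth (fps_pd j f z * g z + f z * fps_pd j g z) m"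
    by (simp add: fps_pd_def fps_mult_nth pd_sum[of _ V] pd_mult[of V] polyfun_mult * sum.distrib)
qed

lemma fps_pd_independent:
  assumes "\<And>s. f (z(j := s)) = f z"
  shows "fps_pd j f z = 0"
  by (rule fps_ext) (simp add: fps_pd_def pd_independent assms)

text \<open>The formal series (1 - s X)^(-l).\<close>

definition gen_factor :: "real \<Rightarrow> real \<Rightarrow> real fps" where
  "gen_factor l s = Abs_fps (\<lambda>m. bcoeff (- l) m * s ^ m)"

text \<open>The formal series 1 / (1 - s X).\<close>

definition geo :: "real \<Rightarrow> real fps" where
  "geo s = Abs_fps (\<lambda>m. s ^ m)"

definition gen_series :: "real \<Rightarrow> nat set \<Rightarrow> (nat \<Rightarrow> real) \<Rightarrow> real fps" where
  "gen_series l J z = (\<Prod>j\<in>J. gen_factor l (z j))"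

text \<open>Since 1 - s X is invertible, the derivatives of \<open>geo\<close> and
  \<open>gen_factor\<close> can be checked coefficientwise after clearing this denominator and are
  then recovered from this relation by \<open>algebra\<close>.\<close>

lemma geo_inverse: "(1 - fps_const s * fps_X) * geo s = 1"
proof (rule fps_ext)
  fix m
  show "fps_nth ((1 - fps_const s * fps_X) * geo s) m = fps_nth 1 m"
    by (cases m) (simp_all add: geo_def left_diff_distrib mult.assoc)
qed

lemma fps_polyfun_geo: "j \<in> V \<Longrightarrow> fps_polyfun V (\<lambda>z. geo (z j))"
  by (auto simp: fps_polyfun_def geo_def intro!: polyfun_power polyfun_var)

lemma fps_polyfun_gen_factor: "j \<in> V \<Longrightarrow> fps_polyfun V (\<lambda>z. gen_factor l (z j))"
  by (auto simp: fps_polyfun_def gen_factor_def intro!: polyfun_mult polyfun_const polyfun_power polyfun_var)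

lemma fps_polyfun_gen_series: "J \<subseteq> V \<Longrightarrow> fps_polyfun V (gen_series l J)"
  unfolding gen_series_def by (intro fps_polyfun_prod fps_polyfun_gen_factor) auto

lemma pd_coord_power: "pd j (\<lambda>z. c * z j ^ m) z = c * (of_nat m * z j ^ (m - 1))"
  by (rule pd_eqI) (auto intro!: derivative_eq_intros)

lemma fps_pd_geo: "fps_pd j (\<lambda>z. geo (z j)) z = fps_X * (geo (z j))\<^sup>2"
proof -
  have d: "fps_pd j (\<lambda>z. geo (z j)) z = Abs_fps (\<lambda>m. of_nat m * z j ^ (m - 1))"
    unfolding fps_pd_def geo_def using pd_coord_power[of j 1] by simp
  have "(1 - fps_const (z j) * fps_X) * fps_pd j (\<lambda>z. geo (z j)) z = fps_X * geo (z j)"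
  proof (rule fps_ext)
    fix m
    show "fps_nth ((1 - fps_const (z j) * fps_X) * fps_pd j (\<lambda>z. geo (z j)) z) m = fps_nth (fps_X * geo (z j)) m"
    proof (cases m)
      case (Suc k)
      then show ?thesis
        unfolding d by (cases k) (simp_all add: geo_def left_diff_distrib mult.assoc algebra_simps)
    qed (simp add: d)
  qed
  then show ?thesis
    using geo_inverse[of "z j"] by algebra
qed

lemma fps_pd_gen_factor: "fps_pd j (\<lambda>z. gen_factor l (z j)) z = fps_const l * fps_X * geo (z j) * gen_factor l (z j)"
proof -
  have d: "fps_pd j (\<lambda>z. gen_factor l (z j)) z = Abs_fps (\<lambda>m. bcoeff (- l) m * (of_nat m * z j ^ (m - 1)))"
    unfolding fps_pd_def gen_factor_def by (simp add: pd_coord_power)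
  have "(1 - fps_const (z j) * fps_X) * fps_pd j (\<lambda>z. gen_factor l (z j)) z = fps_const l * fps_X * gen_factor l (z j)"
  proof (rule fps_ext)
    fix m
    show "fps_nth ((1 - fps_const (z j) * fps_X) * fps_pd j (\<lambda>z. gen_factor l (z j)) z) m
        = fps_nth (fps_const l * fps_X * gen_factor l (z j)) m"
    proof (cases m)
      case (Suc k)
      have *: "bcoeff (- l) (Suc k) * of_nat (Suc k) = (of_nat k + l) * bcoeff (- l) k"
        using bcoeff_Suc[of k "- l"] by (simp add: mult.commute)
      show ?thesis
      proof (cases k)
        case 0
        then show ?thesis unfolding d using * Suc by (simp add: gen_factor_def left_diff_distrib mult.assoc)
      next
        case (Suc i)
        have "fps_nth ((1 - fps_const (z j) * fps_X) * fps_pd j (\<lambda>z. gen_factor l (z j)) z) m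
          = (bcoeff (- l) (Suc k) * of_nat (Suc k)) * z j ^ k - z j * (bcoeff (- l) k * (of_nat k * z j ^ (k - 1)))"
          using \<open>m = Suc k\<close> by (simp add: d left_diff_distrib mult.assoc del: of_nat_Suc)
        also have "z j * (bcoeff (- l) k * (of_nat k * z j ^ (k - 1))) = of_nat k * bcoeff (- l) k * z j ^ k"
          using Suc by simp
        finally show ?thesis unfolding * using \<open>m = Suc k\<close>
          by (simp add: gen_factor_def mult.assoc algebra_simps)
      qed
    qed (simp add: d mult.assoc)
  qed
  then show ?thesis
    using geo_inverse[of "z j"] by algebra
qed

lemma fps_pd_gen_series:
  assumes "finite J"
  shows "fps_pd j (gen_series l J) z = of_bool (j \<in> J) * fps_const l * fps_X * geo (z j) * gen_series l J z"
  using assms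
proof (induction J rule: finite_induct)
  case empty
  show ?case by (simp add: gen_series_def fps_pd_independent)
next
  case (insert i J)
  have *: "gen_series l (insert i J) = (\<lambda>z. gen_factor l (z i) * gen_series l J z)"
    using insert.hyps by (simp add: gen_series_def fun_eq_iff)
  have "fps_pd j (\<lambda>z. gen_factor l (z i)) z = of_bool (j = i) * fps_const l * fps_X * geo (z j) * gen_factor l (z j)"
    by (cases "i = j") (auto simp: fps_pd_gen_factor fps_pd_independent)
  then have "fps_pd j (gen_series l (insert i J)) z = of_bool (j = i) * fps_const l * fps_X * geo (z j) * gen_factor l (z j) * gen_series l J z
     + gen_factor l (z i) * (of_bool (j \<in> J) * fps_const l * fps_X * geo (z j) * gen_series l J z)"
    unfolding * by (subst fps_pd_mult[of UNIV]) (simp_all add: fps_polyfun_gen_factor fps_polyfun_gen_series insert.IH)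
  then show ?case
    using insert.hyps by (auto simp: * of_bool_def algebra_simps)
qed

lemma fps_pd_pd_gen_series:
  assumes "finite J" "j \<in> J"
  shows "fps_pd j (fps_pd j (gen_series l J)) z = fps_const (l * (l + 1)) * fps_X\<^sup>2 * (geo (z j))\<^sup>2 * gen_series l J z"
proof -
  have *: "fps_pd j (gen_series l J) = (\<lambda>z. (fps_const l * fps_X) * (geo (z j) * gen_series l J z))"
    using assms by (simp add: fps_pd_gen_series fun_eq_iff mult.assoc)
  have "fps_pd j (fps_pd j (gen_series l J)) z =
     (fps_const l * fps_X) * (fps_X * (geo (z j))\<^sup>2 * gen_series l J z + geo (z j) * (fps_const l * fps_X * geo (z j) * gen_series l J z))"
    unfolding * using assms
    by (subst fps_pd_mult[of UNIV] | simp add: fps_polyfun_const fps_polyfun_mult fps_polyfun_geo fps_polyfun_gen_series fps_pd_independent fps_pd_geo fps_pd_gen_series mult.assoc)+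
  moreover have "fps_const (l * (l + 1)) = fps_const l * (fps_const l + 1)"
    by (simp only: fps_const_mult[symmetric] fps_const_add[symmetric] fps_const_1_eq_1)
  ultimately show ?thesis
    by (simp only:) (simp add: power2_eq_square distrib_left distrib_right mult_ac del: fps_const_mult fps_const_add)
qed

text \<open>Differentiating \<open>geo_inverse\<close>; the factor s X that appears is turned into
  \<open>geo s - 1\<close> by the same relation.\<close>

lemma deriv_geo: "fps_X * fps_deriv (geo s) = (geo s - 1) * geo s"
proof -
  have "fps_deriv ((1 - fps_const s * fps_X) * geo s) = 0"
    by (simp only: geo_inverse) simp
  then have "(1 - fps_const s * fps_X) * fps_deriv (geo s) - fps_const s * geo s = 0"
    by (simp add: algebra_simps)
  then show ?thesis
    using geo_inverse[of s] by algebra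
qed

lemma deriv_gen_factor: "fps_X * fps_deriv (gen_factor l s) = fps_const l * (geo s - 1) * gen_factor l s"
proof -
  have "fps_X * fps_deriv (gen_factor l s) = fps_const s * fps_pd 0 (\<lambda>z. gen_factor l (z 0)) (\<lambda>_. s)"
  proof (rule fps_ext)
    fix m
    have "fps_nth (fps_X * fps_deriv (Abs_fps (\<lambda>m. bcoeff (- l) m * s ^ m))) m
       = fps_nth (fps_const s * Abs_fps (\<lambda>m. bcoeff (- l) m * (of_nat m * s ^ (m - 1)))) m"
      by (cases m) (simp_all add: algebra_simps)
    then show "fps_nth (fps_X * fps_deriv (gen_factor l s)) m = fps_nth (fps_const s * fps_pd 0 (\<lambda>z. gen_factor l (z 0)) (\<lambda>_. s)) m"
      by (simp add: fps_pd_def gen_factor_def pd_coord_power)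
  qed
  then show ?thesis
    unfolding fps_pd_gen_factor using geo_inverse[of s] by algebra
qed

lemma deriv_gen_series:
  assumes "finite J"
  shows "fps_X * fps_deriv (gen_series l J z) = fps_const l * (\<Sum>j\<in>J. geo (z j) - 1) * gen_series l J z"
  using assms
proof (induction J rule: finite_induct)
  case empty
  show ?case by (simp add: gen_series_def)
next
  case (insert i J)
  have "fps_X * fps_deriv (gen_series l (insert i J) z) =
     (fps_X * fps_deriv (gen_factor l (z i))) * gen_series l J z + gen_factor l (z i) * (fps_X * fps_deriv (gen_series l J z))"
    using insert.hyps by (simp add: gen_series_def algebra_simps)
  also have "\<dots> = fps_const l * (geo (z i) - 1 + (\<Sum>j\<in>J. geo (z j) - 1)) * (gen_factor l (z i) * gen_series l J z)"
    unfolding insert.IH deriv_gen_factor by algebra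
  finally show ?case using insert.hyps by (simp add: gen_series_def)
qed

subsection \<open>The reduced operator on the generating coefficients\<close>

text \<open>With \<open>z\<^sub>j = x\<^sub>j\<^sup>2\<close>, conjugating the Hamiltonian by \<open>\<psi>\<^sub>0\<close> gives
  \<open>E\<^sub>0 + 4 \<Sum>\<^sub>j z\<^sub>j \<partial>\<^sub>j - 4 reduced_op\<close>.\<close>

definition reduced_op :: "nat \<Rightarrow> real \<Rightarrow> real \<Rightarrow> ((nat \<Rightarrow> real) \<Rightarrow> real) \<Rightarrow> (nat \<Rightarrow> real) \<Rightarrow> real" where
  "reduced_op N l mu f z = (\<Sum>j=1..N. z j * pd j (pd j f) z + (mu + 1 / 2) * pd j f z)
     + 2 * l * (\<Sum>j=1..N. \<Sum>i\<in>{1..N} - {j}. z j / (z j - z i) * pd j f z)"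

text \<open>Partial fractions in the variable X. It replaces the singular denominators z_j - z_i of
  the operator by products of two geometric series.\<close>

lemma geo_pair:
  fixes a b :: real
  assumes "a \<noteq> b"
  shows "fps_const (a / (a - b)) * geo a + fps_const (b / (b - a)) * geo b = geo a * geo b"
proof -
  define c where "c = fps_const (1 / (a - b))"
  have c: "c * (fps_const a - fps_const b) = 1"
    using assms by (simp add: c_def)
  have *: "fps_const (a / (a - b)) = fps_const a * c" "fps_const (b / (b - a)) = - (fps_const b * c)"
    using assms by (simp_all add: c_def field_simps)
  show ?thesis
    unfolding * using c geo_inverse[of a] geo_inverse[of b] by algebra
qed

text \<open>Everything is expressed through U, the sum of 1 / (1 - z_j X), and U2, the sum of the
  squares. On the left these arise from the derivatives in z and from symmetrising the pair sum,
  which gives U^2 - U2. On the right, with E = X d/dX, they arise from (E + l N) K = l U K and E U =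
  U2 - U. The extra factor X on the right is what lowers the index of a coefficient by 1.\<close>

lemma gen_series_L_identity:
  fixes N :: nat and l mu :: real and z :: "nat \<Rightarrow> real"
  assumes z: "inj_on z {1..N}"
  defines "K \<equiv> gen_series l {1..N}" and "c \<equiv> 1 / 2 + mu - l"
  shows "(\<Sum>j=1..N. fps_const (z j) * fps_pd j (fps_pd j K) z + fps_const (mu + 1 / 2) * fps_pd j K z)
       + fps_const (2 * l) * (\<Sum>j=1..N. \<Sum>i\<in>{1..N} - {j}. fps_const (z j / (z j - z i)) * fps_pd j K z)
     = fps_X * (fps_X * fps_deriv (fps_X * fps_deriv (K z) + fps_const (l * N) * K z)
           + fps_const (l * N + c) * (fps_X * fps_deriv (K z) + fps_const (l * N) * K z))"
proof -
  define u where "u j = geo (z j)" for j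
  define U where "U = (\<Sum>j=1..N. u j)"
  define U2 where "U2 = (\<Sum>j=1..N. (u j)\<^sup>2)"
  define k where "k = K z"
  have pd1: "fps_pd j K z = fps_const l * fps_X * u j * k" if "j \<in> {1..N}" for j
    using that by (simp add: K_def fps_pd_gen_series u_def k_def)
  have pd2: "fps_const (z j) * fps_pd j (fps_pd j K) z = fps_const l * (fps_const l + 1) * fps_X * ((u j)\<^sup>2 - u j) * k"
    if "j \<in> {1..N}" for j
  proof -
    have "fps_const (l * (l + 1)) = fps_const l * (fps_const l + 1)"
      by (simp only: fps_const_mult[symmetric] fps_const_add[symmetric] fps_const_1_eq_1)
    then have "fps_pd j (fps_pd j K) z = fps_const l * (fps_const l + 1) * fps_X\<^sup>2 * (u j)\<^sup>2 * k"
      unfolding K_def k_def u_def by (subst fps_pd_pd_gen_series) (use that in auto)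
    then show ?thesis
      using geo_inverse[of "z j", folded u_def] by algebra
  qed
  have off: "fps_const 2 * (\<Sum>j=1..N. \<Sum>i\<in>{1..N} - {j}. fps_const (z j / (z j - z i)) * u j) = U\<^sup>2 - U2"
  proof -
    have "2 * (\<Sum>j=1..N. \<Sum>i\<in>{1..N} - {j}. fps_const (z j / (z j - z i)) * u j) =
       (\<Sum>j=1..N. \<Sum>i\<in>{1..N} - {j}. fps_const (z j / (z j - z i)) * u j + fps_const (z i / (z i - z j)) * u i)"
      by (rule sum_offdiag_symmetrize) simp
    also have "\<dots> = (\<Sum>j=1..N. \<Sum>i\<in>{1..N} - {j}. u j * u i)"
      unfolding u_def by (intro sum.cong refl geo_pair) (use z in \<open>auto dest: inj_onD\<close>)
    also have "\<dots> = U\<^sup>2 - U2"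
    proof -
      have "(\<Sum>i=1..N. u j * u i) = (u j)\<^sup>2 + (\<Sum>i\<in>{1..N} - {j}. u j * u i)" if "j \<in> {1..N}" for j
        using that by (subst sum.remove[of "{1..N}" j]) (simp_all add: power2_eq_square)
      then have "U\<^sup>2 = U2 + (\<Sum>j=1..N. \<Sum>i\<in>{1..N} - {j}. u j * u i)"
        unfolding U_def U2_def power2_eq_square[of "sum _ _"] sum_product by (simp add: sum.distrib)
      then show ?thesis by simp
    qed
    finally show ?thesis by (simp add: numeral_fps_const)
  qed
  have cN: "fps_const (l * N) = fps_const l * of_nat N"
    by (simp only: fps_const_mult[symmetric] fps_of_nat)
  have th: "fps_X * fps_deriv k + fps_const (l * N) * k = fps_const l * U * k"
  proof -
    have "fps_X * fps_deriv k = fps_const l * (\<Sum>j\<in>{1..N}. u j - 1) * k"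
      unfolding k_def K_def u_def by (rule deriv_gen_series) simp
    also have "(\<Sum>j\<in>{1..N}. u j - 1) = U - of_nat N"
      by (simp add: U_def sum_subtractf)
    finally show ?thesis by (simp add: cN algebra_simps)
  qed
  have dU: "fps_X * fps_deriv U = U2 - U"
  proof -
    have "fps_X * fps_deriv U = (\<Sum>j=1..N. (u j - 1) * u j)"
      by (simp add: U_def fps_deriv_sum sum_distrib_left u_def deriv_geo)
    then show ?thesis
      by (simp add: U2_def U_def sum_subtractf algebra_simps power2_eq_square)
  qed
  have LHS1: "(\<Sum>j=1..N. fps_const (z j) * fps_pd j (fps_pd j K) z + fps_const (mu + 1 / 2) * fps_pd j K z)
     = fps_const l * (fps_const l + 1) * fps_X * (U2 - U) * k + fps_const (mu + 1 / 2) * (fps_const l * fps_X * U * k)"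
  proof -
    have "(\<Sum>j=1..N. fps_const (z j) * fps_pd j (fps_pd j K) z + fps_const (mu + 1 / 2) * fps_pd j K z)
     = (\<Sum>j=1..N. (fps_const l * (fps_const l + 1) * fps_X * k) * (u j)\<^sup>2
         + (fps_const (mu + 1 / 2) * fps_const l * fps_X * k - fps_const l * (fps_const l + 1) * fps_X * k) * u j)"
      by (intro sum.cong refl, simp only: pd1 pd2) (simp only: algebra_simps)
    also have "\<dots> = (fps_const l * (fps_const l + 1) * fps_X * k) * U2
         + (fps_const (mu + 1 / 2) * fps_const l * fps_X * k - fps_const l * (fps_const l + 1) * fps_X * k) * U"
      by (simp only: sum.distrib U_def U2_def sum_distrib_left)
    finally show ?thesis by (simp only: algebra_simps)
  qed
  have LHS2: "fps_const (2 * l) * (\<Sum>j=1..N. \<Sum>i\<in>{1..N} - {j}. fps_const (z j / (z j - z i)) * fps_pd j K z)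
     = fps_const l * fps_const l * fps_X * k * (U\<^sup>2 - U2)"
  proof -
    have "(\<Sum>j=1..N. \<Sum>i\<in>{1..N} - {j}. fps_const (z j / (z j - z i)) * fps_pd j K z) =
       (fps_const l * fps_X * k) * (\<Sum>j=1..N. \<Sum>i\<in>{1..N} - {j}. fps_const (z j / (z j - z i)) * u j)"
      unfolding sum_distrib_left by (intro sum.cong refl, simp only: pd1) (simp only: mult_ac)
    moreover have "fps_const (2 * l) = fps_const 2 * fps_const l" by simp
    ultimately show ?thesis
      unfolding off[symmetric] by (simp only: mult_ac)
  qed
  have "fps_X * fps_deriv (fps_const l * U * k) = fps_const l * (fps_X * fps_deriv U) * k + fps_const l * U * (fps_X * fps_deriv k)"
    by (simp add: algebra_simps)
  also have "fps_X * fps_deriv k = fps_const l * U * k - fps_const (l * N) * k"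
    using th by (simp add: algebra_simps)
  finally have d2: "fps_X * fps_deriv (fps_const l * U * k) =
     fps_const l * (U2 - U) * k + fps_const l * U * (fps_const l * U * k - fps_const (l * N) * k)"
    unfolding dU .
  have cc: "fps_const (l * N + c) = fps_const (l * N) + fps_const (mu + 1 / 2) - fps_const l"
    by (simp add: c_def)
  show ?thesis
    unfolding LHS1 LHS2 k_def[symmetric] th d2 cc power2_eq_square by algebra
qed

text \<open>The index is an integer and the value is 0 below 0, so that shifts of the index need no
  side conditions; this vanishing is also the source of all later cutoffs.\<close>

definition gen_coeff :: "real \<Rightarrow> nat \<Rightarrow> int \<Rightarrow> (nat \<Rightarrow> real) \<Rightarrow> real" where
  "gen_coeff l N m z = (if m < 0 then 0 else fps_nth (gen_series l {1..N} z) (nat m))"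

lemma polyfun_gen_coeff: "polyfun {1..N} (gen_coeff l N m)"
  using fps_polyfun_gen_series[of "{1..N}" "{1..N}" l] unfolding gen_coeff_def fps_polyfun_def
  by (cases "m < 0") (simp_all add: polyfun_const)

lemma gen_coeff_neg: "m < 0 \<Longrightarrow> gen_coeff l N m = (\<lambda>_. 0)"
  by (simp add: gen_coeff_def fun_eq_iff)

lemma pd_gen_coeff: "pd j (gen_coeff l N m) z = (if m < 0 then 0 else fps_nth (fps_pd j (gen_series l {1..N}) z) (nat m))"
  by (cases "m < 0") (simp_all add: gen_coeff_neg gen_coeff_def[abs_def] fps_pd_def)

lemma pd_pd_gen_coeff: "pd j (pd j (gen_coeff l N m)) z = (if m < 0 then 0 else fps_nth (fps_pd j (fps_pd j (gen_series l {1..N})) z) (nat m))"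
proof (cases "m < 0")
  case True
  then have "pd j (gen_coeff l N m) = (\<lambda>_. 0)" by (simp add: pd_gen_coeff fun_eq_iff)
  then show ?thesis using True by simp
next
  case False
  then have "pd j (gen_coeff l N m) = (\<lambda>z. fps_nth (fps_pd j (gen_series l {1..N}) z) (nat m))" by (simp add: pd_gen_coeff fun_eq_iff)
  then show ?thesis using False by (simp add: fps_pd_def)
qed

lemma reduced_op_gen_coeff:
  fixes m :: int
  assumes z: "inj_on z {1..N}"
  shows "reduced_op N l mu (gen_coeff l N m) z = (of_int m - 1 + l * N) * (of_int m - 1 + l * N + 1 / 2 + mu - l) * gen_coeff l N (m - 1) z"
proof (cases "m < 0")
  case True
  then show ?thesis by (simp add: reduced_op_def pd_gen_coeff pd_pd_gen_coeff gen_coeff_def)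
next
  case False
  define K where "K = gen_series l {1..N}"
  let ?R = "fps_nth (fps_X * (fps_X * fps_deriv (fps_X * fps_deriv (gen_series l {1..N} z) + fps_const (l * N) * gen_series l {1..N} z)
           + fps_const (l * N + (1 / 2 + mu - l)) * (fps_X * fps_deriv (gen_series l {1..N} z) + fps_const (l * N) * gen_series l {1..N} z))) (nat m)
        = (of_int m - 1 + l * N) * (of_int m - 1 + l * N + 1 / 2 + mu - l) * gen_coeff l N (m - 1) z"
  have "reduced_op N l mu (gen_coeff l N m) z = fps_nth ((\<Sum>j=1..N. fps_const (z j) * fps_pd j (fps_pd j K) z + fps_const (mu + 1 / 2) * fps_pd j K z)
       + fps_const (2 * l) * (\<Sum>j=1..N. \<Sum>i\<in>{1..N} - {j}. fps_const (z j / (z j - z i)) * fps_pd j K z)) (nat m)"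
    using False by (simp add: reduced_op_def pd_gen_coeff pd_pd_gen_coeff K_def fps_sum_nth)
  also have "\<dots> = (of_int m - 1 + l * N) * (of_int m - 1 + l * N + 1 / 2 + mu - l) * gen_coeff l N (m - 1) z"
    unfolding K_def gen_series_L_identity[OF z]
  proof (cases "nat m")
    case 0
    then have "m = 0" using False by simp
    then show "?R"
      by (simp add: gen_coeff_def)
  next
    case (Suc i)
    have X: "fps_nth (fps_X * fps_deriv f) i = of_nat i * fps_nth f i" for f :: "real fps"
      by (cases i) simp_all
    have "of_int m - 1 = real i" "nat (m - 1) = i" "\<not> m - 1 < 0"
      using Suc False by linarith+
    then show "?R"
      unfolding Suc gen_coeff_def fps_X_mult_nth[of _ "Suc i"] fps_add_nth fps_mult_left_const_nth X diff_Suc_1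
      by (simp add: algebra_simps)
  qed
  finally show ?thesis .
qed

text \<open>The coefficient form of (1 - z_j X) dK/dz_j = l X K. At \<open>m = -1\<close> it says
  that the constant coefficient does not depend on z.\<close>

lemma pd_gen_coeff_Suc:
  assumes "j \<in> {1..N}"
  shows "pd j (gen_coeff l N (m + 1)) z = z j * pd j (gen_coeff l N m) z + l * gen_coeff l N m z"
proof -
  have pd: "fps_pd j (gen_series l {1..N}) z = fps_const l * fps_X * geo (z j) * gen_series l {1..N} z"
    using assms by (simp add: fps_pd_gen_series)
  then have eq: "fps_pd j (gen_series l {1..N}) z = fps_X * (fps_const (z j) * fps_pd j (gen_series l {1..N}) z + fps_const l * gen_series l {1..N} z)"
    using geo_inverse[of "z j"] by algebra
  consider "m < -1" | "m = -1" | "m \<ge> 0" by linarith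
  then show ?thesis
  proof cases
    case 1
    then show ?thesis by (simp add: pd_gen_coeff gen_coeff_neg)
  next
    case 2
    then show ?thesis by (simp add: pd_gen_coeff gen_coeff_neg pd[unfolded One_nat_def] mult.assoc)
  next
    case 3
    then have "nat (m + 1) = Suc (nat m)" by linarith
    then have "pd j (gen_coeff l N (m + 1)) z = fps_nth (fps_pd j (gen_series l {1..N}) z) (Suc (nat m))"
      using 3 by (simp add: pd_gen_coeff)
    also have "\<dots> = z j * fps_nth (fps_pd j (gen_series l {1..N}) z) (nat m) + l * fps_nth (gen_series l {1..N} z) (nat m)"
      by (subst eq) (simp del: One_nat_def)
    finally show ?thesis using 3 by (simp add: pd_gen_coeff gen_coeff_def)
  qed
qed

lemma gen_coeff_euler: "(\<Sum>j=1..N. z j * pd j (gen_coeff l N m) z) = of_int m * gen_coeff l N m z"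
proof (cases "m < 0")
  case True
  then show ?thesis by (simp add: pd_gen_coeff gen_coeff_neg)
next
  case False
  have eq: "(\<Sum>j=1..N. fps_const (z j) * fps_pd j (gen_series l {1..N}) z) = fps_X * fps_deriv (gen_series l {1..N} z)"
  proof -
    have "fps_const (z j) * fps_pd j (gen_series l {1..N}) z = fps_const l * (geo (z j) - 1) * gen_series l {1..N} z" if "j \<in> {1..N}" for j
    proof -
      have "fps_pd j (gen_series l {1..N}) z = fps_const l * fps_X * geo (z j) * gen_series l {1..N} z"
        using that by (simp add: fps_pd_gen_series)
      then show ?thesis
        using geo_inverse[of "z j"] by algebra
    qed
    then have "(\<Sum>j=1..N. fps_const (z j) * fps_pd j (gen_series l {1..N}) z) = (\<Sum>j=1..N. fps_const l * (geo (z j) - 1) * gen_series l {1..N} z)"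
      by (rule sum.cong[OF refl])
    then show ?thesis
      unfolding deriv_gen_series[OF finite_atLeastAtMost] by (simp only: sum_distrib_left sum_distrib_right)
  qed
  have X: "fps_nth (fps_X * fps_deriv f) i = of_nat i * fps_nth f i" for f :: "real fps" and i
    by (cases i) simp_all
  have "(\<Sum>j=1..N. z j * pd j (gen_coeff l N m) z) = fps_nth (\<Sum>j=1..N. fps_const (z j) * fps_pd j (gen_series l {1..N}) z) (nat m)"
    using False by (simp add: pd_gen_coeff fps_sum_nth)
  then show ?thesis
    unfolding eq X using False by (simp add: gen_coeff_def)
qed

text \<open>The cross term that the second derivatives, weighted with z_j, produce on a product of
  two coefficients.\<close>

definition gen_coeff_gamma :: "real \<Rightarrow> nat \<Rightarrow> int \<Rightarrow> int \<Rightarrow> (nat \<Rightarrow> real) \<Rightarrow> real" where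
  "gen_coeff_gamma l N m m' z = (\<Sum>j=1..N. z j * (pd j (gen_coeff l N m) z * pd j (gen_coeff l N m') z))"

text \<open>Raising an index by \<open>pd_gen_coeff_Suc\<close> gives a term with one more factor
  z_j and a term without the derivative of that coefficient. The former is the same whichever of the
  two indices is raised, so it cancels in the difference; Euler's relation evaluates the
  latter.\<close>

lemma gen_coeff_gamma_rec: "gen_coeff_gamma l N (m + 1) m' z - gen_coeff_gamma l N m (m' + 1) z = l * (of_int m' - of_int m) * (gen_coeff l N m z * gen_coeff l N m' z)"
proof -
  have "gen_coeff_gamma l N (m + 1) m' z - gen_coeff_gamma l N m (m' + 1) z
     = (\<Sum>j=1..N. l * gen_coeff l N m z * (z j * pd j (gen_coeff l N m') z) - l * gen_coeff l N m' z * (z j * pd j (gen_coeff l N m) z))"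
    unfolding gen_coeff_gamma_def sum_subtractf[symmetric]
    by (intro sum.cong refl, simp only: pd_gen_coeff_Suc) (simp only: algebra_simps)
  also have "\<dots> = l * gen_coeff l N m z * (of_int m' * gen_coeff l N m' z) - l * gen_coeff l N m' z * (of_int m * gen_coeff l N m z)"
    unfolding sum_subtractf sum_distrib_left[symmetric] gen_coeff_euler ..
  finally show ?thesis by (simp add: algebra_simps)
qed

definition gen_prod :: "real \<Rightarrow> nat \<Rightarrow> (nat \<Rightarrow> int) \<Rightarrow> (nat \<Rightarrow> real) \<Rightarrow> real" where
  "gen_prod l N m z = (\<Prod>k=1..N. gen_coeff l N (m k) z)"

lemma polyfun_gen_prod: "polyfun {1..N} (gen_prod l N m)"
  unfolding gen_prod_def[abs_def] by (intro polyfun_prod polyfun_gen_coeff)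

definition gen_prod_gamma :: "real \<Rightarrow> nat \<Rightarrow> nat \<Rightarrow> nat \<Rightarrow> (nat \<Rightarrow> int) \<Rightarrow> (nat \<Rightarrow> real) \<Rightarrow> real" where
  "gen_prod_gamma l N k i m z = gen_coeff_gamma l N (m k) (m i) z * (\<Prod>r\<in>{1..N} - {k} - {i}. gen_coeff l N (m r) z)"

lemma gen_prod_gamma_rec:
  assumes "k \<in> {1..N}" "i \<in> {1..N}" "k \<noteq> i"
  shows "gen_prod_gamma l N k i (m(k := m k + 1)) z - gen_prod_gamma l N k i (m(i := m i + 1)) z = l * (of_int (m i) - of_int (m k)) * gen_prod l N m z"
proof -
  define R where "R = (\<Prod>r\<in>{1..N} - {k} - {i}. gen_coeff l N (m r) z)"
  have R: "(\<Prod>r\<in>{1..N} - {k} - {i}. gen_coeff l N ((m(k := a)) r) z) = R" "(\<Prod>r\<in>{1..N} - {k} - {i}. gen_coeff l N ((m(i := a)) r) z) = R" for a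
    unfolding R_def by (auto intro!: prod.cong)
  have G: "gen_prod l N m z = gen_coeff l N (m k) z * gen_coeff l N (m i) z * R"
    unfolding gen_prod_def R_def using assms
    by (subst prod.remove[of _ k], simp, simp, subst prod.remove[of _ i], auto)
  show ?thesis
    unfolding gen_prod_gamma_def R G using assms(3) gen_coeff_gamma_rec[of l N "m k" "m i" z]
    by (simp flip: left_diff_distrib)
qed

lemma gen_coeff_gamma_commute: "gen_coeff_gamma l N m m' z = gen_coeff_gamma l N m' m z"
  by (simp add: gen_coeff_gamma_def mult.commute)

lemma gen_prod_gamma_commute: "gen_prod_gamma l N k i m z = gen_prod_gamma l N i k m z"
proof -
  have "{1..N} - {k} - {i} = {1..N} - {i} - {k}" by auto
  then show ?thesis unfolding gen_prod_gamma_def by (simp only: gen_coeff_gamma_commute[of l N "m k"])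
qed

text \<open>Leibniz rule: the operator acts on one factor at a time, and only its second-order part
  adds cross terms, twice for each unordered pair of factors.\<close>

lemma reduced_op_gen_prod:
  assumes z: "inj_on z {1..N}"
  shows "reduced_op N l mu (gen_prod l N m) z =
     (\<Sum>k=1..N. (of_int (m k) - 1 + l * N) * (of_int (m k) - 1 + l * N + 1 / 2 + mu - l) * gen_prod l N (m(k := m k - 1)) z)
     + 2 * (\<Sum>k=1..N. \<Sum>i\<in>{k<..N}. gen_prod_gamma l N k i m z)"
proof -
  define g where "g k = gen_coeff l N (m k)" for k
  define P where "P A z = (\<Prod>k\<in>A. g k z)" for A z
  have g: "polyfun {1..N} (g k)" for k unfolding g_def by (rule polyfun_gen_coeff)
  have P: "polyfun {1..N} (P A)" for A unfolding P_def[abs_def] by (intro polyfun_prod g)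
  have pdP: "pd j (P A) z = (\<Sum>k\<in>A. pd j (g k) z * P (A - {k}) z)" if "finite A" for j A z
    unfolding P_def[abs_def] using pd_prod[OF that g] .
  have pd1: "pd j (gen_prod l N m) = (\<lambda>z. \<Sum>k=1..N. pd j (g k) z * P ({1..N} - {k}) z)" for j
    using pdP[of "{1..N}" j] by (simp add: P_def[abs_def] gen_prod_def[abs_def] g_def fun_eq_iff)
  have pd2: "pd j (pd j (gen_prod l N m)) z = (\<Sum>k=1..N. pd j (pd j (g k)) z * P ({1..N} - {k}) z
      + (\<Sum>i\<in>{1..N} - {k}. pd j (g k) z * pd j (g i) z * P ({1..N} - {k} - {i}) z))" for j
    unfolding pd1
    by (subst pd_sum[of _ "{1..N}"], intro polyfun_mult polyfun_pd g P, intro sum.cong refl,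
        subst pd_mult[of "{1..N}"], intro polyfun_pd g, rule P)
      (simp add: pdP sum_distrib_left mult.assoc)
  have a1: "(\<Sum>j=1..N. z j * pd j (pd j (gen_prod l N m)) z) =
     (\<Sum>k=1..N. (\<Sum>j=1..N. z j * pd j (pd j (g k)) z) * P ({1..N} - {k}) z)
     + (\<Sum>k=1..N. \<Sum>i\<in>{1..N} - {k}. gen_prod_gamma l N k i m z)"
  proof -
    have "(\<Sum>j=1..N. z j * pd j (pd j (gen_prod l N m)) z) =
       (\<Sum>j=1..N. \<Sum>k=1..N. z j * (pd j (pd j (g k)) z) * P ({1..N} - {k}) z) +
       (\<Sum>j=1..N. \<Sum>k=1..N. \<Sum>i\<in>{1..N} - {k}. z j * (pd j (g k) z * pd j (g i) z) * P ({1..N} - {k} - {i}) z)"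
      unfolding pd2 by (simp only: sum.distrib[symmetric] sum_distrib_left distrib_left mult.assoc)
    also have "(\<Sum>j=1..N. \<Sum>k=1..N. z j * (pd j (pd j (g k)) z) * P ({1..N} - {k}) z) =
       (\<Sum>k=1..N. (\<Sum>j=1..N. z j * pd j (pd j (g k)) z) * P ({1..N} - {k}) z)"
      unfolding sum_distrib_right by (rule sum.swap)
    also have "(\<Sum>j=1..N. \<Sum>k=1..N. \<Sum>i\<in>{1..N} - {k}. z j * (pd j (g k) z * pd j (g i) z) * P ({1..N} - {k} - {i}) z)
       = (\<Sum>k=1..N. \<Sum>i\<in>{1..N} - {k}. gen_prod_gamma l N k i m z)"
      unfolding gen_prod_gamma_def gen_coeff_gamma_def P_def g_def sum_distrib_right
      by (rule trans[OF sum.swap], rule sum.cong[OF refl], rule sum.swap)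
    finally show ?thesis .
  qed
  have a2: "(\<Sum>j=1..N. (mu + 1 / 2) * pd j (gen_prod l N m) z) = (\<Sum>k=1..N. (\<Sum>j=1..N. (mu + 1 / 2) * pd j (g k) z) * P ({1..N} - {k}) z)"
    unfolding pd1 sum_distrib_right sum_distrib_left
    by (rule trans[OF _ sum.swap]) (simp only: mult.assoc)
  have a3: "(\<Sum>j=1..N. \<Sum>i\<in>{1..N} - {j}. z j / (z j - z i) * pd j (gen_prod l N m) z) =
      (\<Sum>k=1..N. (\<Sum>j=1..N. \<Sum>i\<in>{1..N} - {j}. z j / (z j - z i) * pd j (g k) z) * P ({1..N} - {k}) z)"
  proof -
    have "(\<Sum>j=1..N. \<Sum>i\<in>{1..N} - {j}. z j / (z j - z i) * pd j (gen_prod l N m) z) =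
      (\<Sum>j=1..N. \<Sum>k=1..N. \<Sum>i\<in>{1..N} - {j}. z j / (z j - z i) * pd j (g k) z * P ({1..N} - {k}) z)"
      unfolding pd1 sum_distrib_left
      by (rule sum.cong[OF refl], rule trans[OF _ sum.swap]) (simp only: mult.assoc)
    also have "\<dots> = (\<Sum>k=1..N. (\<Sum>j=1..N. \<Sum>i\<in>{1..N} - {j}. z j / (z j - z i) * pd j (g k) z) * P ({1..N} - {k}) z)"
      unfolding sum_distrib_right by (rule sum.swap)
    finally show ?thesis .
  qed
  have "reduced_op N l mu (gen_prod l N m) z = (\<Sum>k=1..N. reduced_op N l mu (g k) z * P ({1..N} - {k}) z)
     + (\<Sum>k=1..N. \<Sum>i\<in>{1..N} - {k}. gen_prod_gamma l N k i m z)"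
  proof -
    define a where "a k = (\<Sum>j=1..N. z j * pd j (pd j (g k)) z)" for k
    define b where "b k = (\<Sum>j=1..N. (mu + 1 / 2) * pd j (g k) z)" for k
    define c where "c k = (\<Sum>j=1..N. \<Sum>i\<in>{1..N} - {j}. z j / (z j - z i) * pd j (g k) z)" for k
    have split: "reduced_op N l mu f z = (\<Sum>j=1..N. z j * pd j (pd j f) z) + (\<Sum>j=1..N. (mu + 1 / 2) * pd j f z)
        + 2 * l * (\<Sum>j=1..N. \<Sum>i\<in>{1..N} - {j}. z j / (z j - z i) * pd j f z)" for f
      unfolding reduced_op_def sum.distrib ..
    have G: "reduced_op N l mu (gen_prod l N m) z = (\<Sum>k=1..N. a k * P ({1..N} - {k}) z) + (\<Sum>k=1..N. \<Sum>i\<in>{1..N} - {k}. gen_prod_gamma l N k i m z)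
        + (\<Sum>k=1..N. b k * P ({1..N} - {k}) z) + 2 * l * (\<Sum>k=1..N. c k * P ({1..N} - {k}) z)"
      by (simp only: split a1 a2 a3 a_def b_def c_def)
    have g: "reduced_op N l mu (g k) z * P ({1..N} - {k}) z =
        a k * P ({1..N} - {k}) z + b k * P ({1..N} - {k}) z + 2 * l * (c k * P ({1..N} - {k}) z)" for k
      unfolding split a_def[symmetric] b_def[symmetric] c_def[symmetric] by (simp add: distrib_right)
    show ?thesis
      by (simp only: G g sum.distrib sum_distrib_left add_ac)
  qed
  also have "(\<Sum>k=1..N. \<Sum>i\<in>{1..N} - {k}. gen_prod_gamma l N k i m z) = 2 * (\<Sum>k=1..N. \<Sum>i\<in>{k<..N}. gen_prod_gamma l N k i m z)"
    unfolding sum_offdiag_pairs sum_distrib_left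
    by (intro sum.cong refl) (metis gen_prod_gamma_commute mult_2)
  also have "(\<Sum>k=1..N. reduced_op N l mu (g k) z * P ({1..N} - {k}) z) =
     (\<Sum>k=1..N. (of_int (m k) - 1 + l * N) * (of_int (m k) - 1 + l * N + 1 / 2 + mu - l) * gen_prod l N (m(k := m k - 1)) z)"
  proof (intro sum.cong refl)
    fix k assume k: "k \<in> {1..N}"
    have "gen_prod l N (m(k := m k - 1)) z = gen_coeff l N (m k - 1) z * P ({1..N} - {k}) z"
      unfolding gen_prod_def P_def g_def using k by (subst prod.remove[of _ k]) (auto intro!: prod.cong)
    then show "reduced_op N l mu (g k) z * P ({1..N} - {k}) z =
       (of_int (m k) - 1 + l * N) * (of_int (m k) - 1 + l * N + 1 / 2 + mu - l) * gen_prod l N (m(k := m k - 1)) z"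
      unfolding g_def reduced_op_gen_coeff[OF z] by simp
  qed
  finally show ?thesis .
qed

subsection \<open>The functions \<open>f\<^sub>n\<close> as polynomials\<close>

definition ipairs :: "nat \<Rightarrow> (nat \<times> nat) set" where
  "ipairs N = (SIGMA j:{1..N}. {j<..N})"

text \<open>The exponent vector of the monomial prod (w_j / w_k)^(a (j,k)), taken over the pairs j <
  k.\<close>

definition exp_shift :: "nat \<Rightarrow> (nat \<times> nat \<Rightarrow> nat) \<Rightarrow> nat \<Rightarrow> int" where
  "exp_shift N a i = (\<Sum>p\<in>ipairs N. int (a p) * (of_bool (i = fst p) - of_bool (i = snd p)))"

definition admissible :: "nat \<Rightarrow> (nat \<Rightarrow> int) \<Rightarrow> (nat \<times> nat \<Rightarrow> nat) set" where
  "admissible N n = {a \<in> ipairs N \<rightarrow>\<^sub>E UNIV. \<forall>k\<in>{1..N}. 0 \<le> n k + exp_shift N a k}"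

text \<open>The constant term of the integrand: \<open>a\<close> collects the exponents chosen in the binomial series of the
  factors \<open>(1 - y\<^sub>j\<^sup>2 / y\<^sub>k\<^sup>2)\<^sup>l\<close>, and \<open>gen_prod\<close> is the matching coefficient of the denominator.\<close>

definition f_poly :: "real \<Rightarrow> nat \<Rightarrow> (nat \<Rightarrow> int) \<Rightarrow> (nat \<Rightarrow> real) \<Rightarrow> real" where
  "f_poly l N n z = (\<Sum>a\<in>admissible N n. (\<Prod>p\<in>ipairs N. bcoeff l (a p)) * gen_prod l N (\<lambda>k. n k + exp_shift N a k) z)"

section \<open>Finiteness and vanishing from weighted sums and tail sums\<close>

lemma finite_ipairs [simp]: "finite (ipairs N)"
  by (simp add: ipairs_def)

lemma sum_exp_shift:
  assumes "A \<subseteq> {1..N}"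
  shows "(\<Sum>k\<in>A. u k * exp_shift N a k) = (\<Sum>p\<in>ipairs N. int (a p) * (of_bool (fst p \<in> A) * u (fst p) - of_bool (snd p \<in> A) * u (snd p)))"
proof -
  have fin: "finite A" using assms finite_subset by blast
  have "(\<Sum>k\<in>A. u k * exp_shift N a k) = (\<Sum>k\<in>A. \<Sum>p\<in>ipairs N. int (a p) * (of_bool (k = fst p) * u k - of_bool (k = snd p) * u k))"
    unfolding exp_shift_def sum_distrib_left by (intro sum.cong refl) (simp add: algebra_simps)
  also have "\<dots> = (\<Sum>p\<in>ipairs N. \<Sum>k\<in>A. int (a p) * (of_bool (k = fst p) * u k - of_bool (k = snd p) * u k))"
    by (rule sum.swap)
  also have "\<dots> = (\<Sum>p\<in>ipairs N. int (a p) * (of_bool (fst p \<in> A) * u (fst p) - of_bool (snd p \<in> A) * u (snd p)))"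
  proof (intro sum.cong refl)
    fix p :: "nat \<times> nat"
    have "(\<Sum>k\<in>A. of_bool (k = i) * u k) = of_bool (i \<in> A) * u i" for i
      using fin by (simp add: of_bool_def if_distrib[of "\<lambda>x. x * _"] cong: if_cong)
    then show "(\<Sum>k\<in>A. int (a p) * (of_bool (k = fst p) * u k - of_bool (k = snd p) * u k)) =
        int (a p) * (of_bool (fst p \<in> A) * u (fst p) - of_bool (snd p \<in> A) * u (snd p))"
      by (simp only: sum_distrib_left[symmetric] sum_subtractf)
  qed
  finally show ?thesis .
qed

text \<open>Give coordinate k the weight k. Each pair j < k lowers the weighted sum by (k - j) times
  its exponent, hence by at least the exponent, while admissibility keeps the total
  non-negative.\<close>

lemma admissible_bound:
  assumes "a \<in> admissible N n" "p \<in> ipairs N"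
  shows "int (a p) \<le> (\<Sum>k=1..N. int k * n k)"
proof -
  have "0 \<le> (\<Sum>k=1..N. int k * (n k + exp_shift N a k))"
    using assms(1) by (intro sum_nonneg) (auto simp: admissible_def)
  also have "\<dots> = (\<Sum>k=1..N. int k * n k) + (\<Sum>k=1..N. int k * exp_shift N a k)"
    by (simp add: distrib_left sum.distrib)
  also have "(\<Sum>k=1..N. int k * exp_shift N a k) \<le> (\<Sum>q\<in>ipairs N. - int (a q))"
    unfolding sum_exp_shift[OF order_refl]
  proof (rule sum_mono)
    fix q assume "q \<in> ipairs N"
    then have "int (fst q) - int (snd q) \<le> -1" "fst q \<in> {1..N}" "snd q \<in> {1..N}"
      by (auto simp: ipairs_def)
    then have "int (a q) * (int (fst q) - int (snd q)) \<le> int (a q) * (-1)"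
      by (intro mult_left_mono) auto
    then show "int (a q) * (of_bool (fst q \<in> {1..N}) * int (fst q) - of_bool (snd q \<in> {1..N}) * int (snd q)) \<le> - int (a q)"
      using \<open>fst q \<in> {1..N}\<close> \<open>snd q \<in> {1..N}\<close> by simp
  qed
  also have "(\<Sum>q\<in>ipairs N. - int (a q)) \<le> - int (a p)"
    unfolding sum_negf using member_le_sum[of p "ipairs N" "\<lambda>q. int (a q)"] assms(2) by simp
  finally show ?thesis by simp
qed

lemma finite_admissible [simp]: "finite (admissible N n)"
proof (rule finite_subset)
  show "admissible N n \<subseteq> ipairs N \<rightarrow>\<^sub>E {..nat (\<Sum>k=1..N. int k * n k)}"
  proof
    fix a assume a: "a \<in> admissible N n"
    then have "a p \<le> nat (\<Sum>k=1..N. int k * n k)" if "p \<in> ipairs N" for p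
      using admissible_bound[OF a that] by linarith
    with a show "a \<in> ipairs N \<rightarrow>\<^sub>E {..nat (\<Sum>k=1..N. int k * n k)}"
      by (auto simp: admissible_def PiE_def Pi_def)
  qed
qed (intro finite_PiE, simp_all)

text \<open>The exponents move mass from k to a smaller j, so they cannot increase a tail sum,
  whereas every tail sum of an admissible exponent vector is non-negative.\<close>

lemma admissible_empty:
  assumes "k \<in> {1..N}" "(\<Sum>i=k..N. n i) < 0"
  shows "admissible N n = {}"
proof (rule ccontr)
  assume "admissible N n \<noteq> {}"
  then obtain a where a: "a \<in> admissible N n" by blast
  have sub: "{k..N} \<subseteq> {1..N}" using assms(1) by auto
  have "0 \<le> (\<Sum>i=k..N. n i + exp_shift N a i)"
    using a sub by (intro sum_nonneg) (auto simp: admissible_def)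
  moreover have "(\<Sum>i=k..N. exp_shift N a i) \<le> 0"
    using sum_exp_shift[OF sub, of "\<lambda>_. 1" a]
    by (simp, intro sum_nonpos mult_nonneg_nonpos) (auto simp: ipairs_def)
  ultimately show False using assms(2) by (simp add: sum.distrib)
qed

lemma f_poly_eq_0:
  assumes "k \<in> {1..N}" "(\<Sum>i=k..N. n i) < 0"
  shows "f_poly l N n z = 0"
  by (simp add: f_poly_def admissible_empty[OF assms])

lemma gen_prod_cong: "(\<And>k. k \<in> {1..N} \<Longrightarrow> m k = m' k) \<Longrightarrow> gen_prod l N m = gen_prod l N m'"
  unfolding gen_prod_def by (intro ext prod.cong) auto

lemma gen_prod_neg: "k \<in> {1..N} \<Longrightarrow> m k < 0 \<Longrightarrow> gen_prod l N m = (\<lambda>_. 0)"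
  unfolding gen_prod_def by (intro ext prod_zero bexI[of _ k]) (simp_all add: gen_coeff_neg)

lemma sum_admissible_superset:
  fixes f :: "_ \<Rightarrow> 'a::semiring_0"
  assumes "finite B" "B \<subseteq> ipairs N \<rightarrow>\<^sub>E UNIV"
    and B: "\<And>a. a \<in> ipairs N \<rightarrow>\<^sub>E UNIV \<Longrightarrow> a \<notin> B \<Longrightarrow> f a = 0"
    and Q: "\<And>a. a \<in> B \<Longrightarrow> a \<notin> admissible N n \<Longrightarrow> f a = 0"
  shows "(\<Sum>a\<in>admissible N n. f a) = (\<Sum>a\<in>B. f a)"
proof -
  have "(\<Sum>a\<in>admissible N n. f a) = (\<Sum>a\<in>admissible N n \<union> B. f a)"
    using assms by (intro sum.mono_neutral_left) auto
  also have "\<dots> = (\<Sum>a\<in>B. f a)"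
  proof (rule sum.mono_neutral_right)
    show "\<forall>a\<in>admissible N n \<union> B - B. f a = 0" using B by (auto simp: admissible_def)
  qed (use assms in auto)
  finally show ?thesis .
qed

subsection \<open>Positive integer coupling\<close>

definition vec_mapping :: "nat \<Rightarrow> (nat \<Rightarrow> int) \<Rightarrow> nat \<Rightarrow>\<^sub>0 int" where
  "vec_mapping N n = (\<Sum>k=1..N. Poly_Mapping.single k (n k))"

lemma lookup_vec_mapping: "Poly_Mapping.lookup (vec_mapping N n) k = (if k \<in> {1..N} then n k else 0)"
  by (simp add: vec_mapping_def lookup_sum lookup_single when_def)

text \<open>For integral coupling \<open>M\<close> this is the numerator of the integrand in the
  variables w_k = y_k^2, now a genuine Laurent polynomial.\<close>

definition ground :: "nat \<Rightarrow> nat \<Rightarrow> (nat \<Rightarrow> int) \<Rightarrow> laurent" where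
  "ground N M n = lmonom (vec_mapping N n) * (\<Prod>p\<in>ipairs N. (1 - lvar (fst p) * lvar_inv (snd p)) ^ M)"

lemma bcoeff_of_nat: "bcoeff (of_nat M) a = (-1) ^ a * of_nat (M choose a)"
  by (simp add: bcoeff_def binomial_gbinomial)

lemma lmonom_power: "lmonom m ^ a = lmonom (\<Sum>i<a. m)"
  by (induction a) (simp_all add: lmonom_0 lmonom_add add.commute del: sum_constant)

lemma lmonom_sum: "lmonom (\<Sum>i\<in>A. m i) = (\<Prod>i\<in>A. lmonom (m i))"
  by (induction A rule: infinite_finite_induct) (simp_all add: lmonom_0 lmonom_add)

lemma lconst_prod: "lconst (\<Prod>i\<in>A. c i) = (\<Prod>i\<in>A. lconst (c i))"
  by (induction A rule: infinite_finite_induct) (simp_all add: lconst_hom)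

definition ratio_monom :: "nat \<times> nat \<Rightarrow> nat \<Rightarrow> nat \<Rightarrow>\<^sub>0 int" where
  "ratio_monom p a = Poly_Mapping.single (fst p) (int a) + Poly_Mapping.single (snd p) (- int a)"

lemma lookup_ratio_monom: "Poly_Mapping.lookup (ratio_monom p a) i = int a * (of_bool (i = fst p) - of_bool (i = snd p))"
  by (auto simp: ratio_monom_def lookup_add lookup_single when_def)

lemma ratio_monom_power: "(lvar (fst p) * lvar_inv (snd p)) ^ a = lmonom (ratio_monom p a)"
  unfolding lvar_def lvar_inv_def lmonom_add[symmetric] lmonom_power
  by (rule arg_cong[of _ _ lmonom], rule poly_mapping_eqI, simp only: lookup_sum)
    (simp add: lookup_ratio_monom lookup_add lookup_single when_def)

lemma one_minus_ratio_monom_power: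
  "(1 - lvar (fst p) * lvar_inv (snd p)) ^ M = (\<Sum>a\<le>M. lconst (bcoeff (of_nat M) a) * lmonom (ratio_monom p a))"
proof -
  have "(1 - lvar (fst p) * lvar_inv (snd p)) ^ M = (- (lvar (fst p) * lvar_inv (snd p)) + 1) ^ M"
    by simp
  also have "\<dots> = (\<Sum>a\<le>M. of_nat (M choose a) * (- (lvar (fst p) * lvar_inv (snd p))) ^ a * 1 ^ (M - a))"
    by (rule binomial_ring)
  also have "\<dots> = (\<Sum>a\<le>M. lconst (bcoeff (of_nat M) a) * lmonom (ratio_monom p a))"
  proof (intro sum.cong refl)
    fix a
    have "(- (lvar (fst p) * lvar_inv (snd p))) ^ a = (-1) ^ a * lmonom (ratio_monom p a)"
      unfolding ratio_monom_power[symmetric] by (rule power_minus)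
    moreover have "lconst ((-1) ^ a) = (-1) ^ a"
      by (induction a) (simp_all add: lconst_hom)
    ultimately show "of_nat (M choose a) * (- (lvar (fst p) * lvar_inv (snd p))) ^ a * 1 ^ (M - a) =
        lconst (bcoeff (of_nat M) a) * lmonom (ratio_monom p a)"
      by (simp add: bcoeff_of_nat lconst_hom)
  qed
  finally show ?thesis .
qed

lemma ground_expansion:
  "ground N M n = (\<Sum>a\<in>ipairs N \<rightarrow>\<^sub>E {..M}. lconst (\<Prod>p\<in>ipairs N. bcoeff (of_nat M) (a p)) * lmonom (vec_mapping N n + (\<Sum>p\<in>ipairs N. ratio_monom p (a p))))"
proof -
  have "(\<Prod>p\<in>ipairs N. (1 - lvar (fst p) * lvar_inv (snd p)) ^ M) =
     (\<Sum>a\<in>ipairs N \<rightarrow>\<^sub>E {..M}. \<Prod>p\<in>ipairs N. lconst (bcoeff (of_nat M) (a p)) * lmonom (ratio_monom p (a p)))"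
    unfolding one_minus_ratio_monom_power by (rule prod_sum_PiE) simp_all
  then show ?thesis
    by (simp add: ground_def sum_distrib_left lmonom_add lmonom_sum lconst_prod prod.distrib mult_ac)
qed

text \<open>Expanding the binomials gives a sum over exponents up to \<open>M\<close>, while
  \<open>f_poly\<close> sums over admissible exponents. The two agree because the binomial
  coefficient vanishes beyond \<open>M\<close> and \<open>Q\<close> vanishes at vectors with a
  negative coordinate.\<close>

lemma lin_ext_ground:
  assumes cong: "\<And>m m'. (\<And>k. k \<in> {1..N} \<Longrightarrow> m k = m' k) \<Longrightarrow> Q m = Q m'"
    and neg: "\<And>m k. k \<in> {1..N} \<Longrightarrow> m k < 0 \<Longrightarrow> Q m = 0"
  shows "lin_ext (\<lambda>m. Q (Poly_Mapping.lookup m)) (ground N M n) =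
     (\<Sum>a\<in>admissible N n. (\<Prod>p\<in>ipairs N. bcoeff (of_nat M) (a p)) * Q (\<lambda>k. n k + exp_shift N a k))"
proof -
  have eq: "Q (Poly_Mapping.lookup (vec_mapping N n + (\<Sum>p\<in>ipairs N. ratio_monom p (a p)))) = Q (\<lambda>k. n k + exp_shift N a k)" for a
    by (rule cong) (simp add: lookup_add lookup_vec_mapping lookup_sum lookup_ratio_monom exp_shift_def)
  have "lin_ext (\<lambda>m. Q (Poly_Mapping.lookup m)) (ground N M n) =
     (\<Sum>a\<in>ipairs N \<rightarrow>\<^sub>E {..M}. (\<Prod>p\<in>ipairs N. bcoeff (of_nat M) (a p)) * Q (\<lambda>k. n k + exp_shift N a k))"
    unfolding ground_expansion lin_ext_sum lin_ext_lconst lmonom_def lin_ext_single eq by simp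
  also have "\<dots> = (\<Sum>a\<in>admissible N n. (\<Prod>p\<in>ipairs N. bcoeff (of_nat M) (a p)) * Q (\<lambda>k. n k + exp_shift N a k))"
  proof (rule sum_admissible_superset[symmetric])
    show "finite (ipairs N \<rightarrow>\<^sub>E {..M})" by (intro finite_PiE) simp_all
    show "ipairs N \<rightarrow>\<^sub>E {..M} \<subseteq> ipairs N \<rightarrow>\<^sub>E UNIV" by (auto simp: PiE_def)
  next
    fix a assume "a \<in> ipairs N \<rightarrow>\<^sub>E UNIV" "a \<notin> ipairs N \<rightarrow>\<^sub>E {..M}"
    then obtain p where p: "p \<in> ipairs N" "a p > M"
      by (auto simp: PiE_def Pi_def not_le)
    then have "bcoeff (of_nat M) (a p) = 0" by (simp add: bcoeff_of_nat)
    then have "(\<Prod>p\<in>ipairs N. bcoeff (of_nat M) (a p)) = 0" using p by (intro prod_zero) auto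
    then show "(\<Prod>p\<in>ipairs N. bcoeff (of_nat M) (a p)) * Q (\<lambda>k. n k + exp_shift N a k) = 0" by simp
  next
    fix a assume "a \<in> ipairs N \<rightarrow>\<^sub>E {..M}" "a \<notin> admissible N n"
    then obtain k where "k \<in> {1..N}" "n k + exp_shift N a k < 0"
      by (auto simp: admissible_def PiE_def not_le)
    then have "Q (\<lambda>k. n k + exp_shift N a k) = 0" by (intro neg)
    then show "(\<Prod>p\<in>ipairs N. bcoeff (of_nat M) (a p)) * Q (\<lambda>k. n k + exp_shift N a k) = 0" by simp
  qed
  finally show ?thesis .
qed

definition gen_prod_at :: "real \<Rightarrow> nat \<Rightarrow> (nat \<Rightarrow> real) \<Rightarrow> (nat \<Rightarrow>\<^sub>0 int) \<Rightarrow> real" where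
  "gen_prod_at l N z m = gen_prod l N (Poly_Mapping.lookup m) z"

lemma lin_ext_gen_prod_at_ground: "lin_ext (gen_prod_at (of_nat M) N z) (ground N M n) = f_poly (of_nat M) N n z"
  unfolding gen_prod_at_def[abs_def] f_poly_def
proof (rule lin_ext_ground[where Q = "\<lambda>m. gen_prod (of_nat M) N m z"])
  fix m m' :: "nat \<Rightarrow> int" assume "\<And>k. k \<in> {1..N} \<Longrightarrow> m k = m' k"
  then have "gen_prod (of_nat M) N m = gen_prod (of_nat M) N m'" by (rule gen_prod_cong)
  then show "gen_prod (of_nat M) N m z = gen_prod (of_nat M) N m' z" by simp
qed (simp add: gen_prod_neg)

lemma polyfun_f_poly: "polyfun {1..N} (f_poly l N n)"
  unfolding f_poly_def[abs_def] by (intro polyfun_sum polyfun_mult polyfun_const polyfun_gen_prod)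

lemma reduced_op_linear:
  assumes "\<And>a. a \<in> A \<Longrightarrow> polyfun {1..N} (f a)"
  shows "reduced_op N l mu (\<lambda>z. \<Sum>a\<in>A. c a * f a z) z = (\<Sum>a\<in>A. c a * reduced_op N l mu (f a) z)"
proof -
  have p: "polyfun {1..N} (\<lambda>z. c a * f a z)" if "a \<in> A" for a
    using assms[OF that] by (intro polyfun_mult polyfun_const)
  have 1: "pd j (\<lambda>z. \<Sum>a\<in>A. c a * f a z) = (\<lambda>z. \<Sum>a\<in>A. c a * pd j (f a) z)" for j
    by (rule ext, rule trans[OF pd_sum[of A "{1..N}" "\<lambda>a z. c a * f a z", OF p]]) (auto intro!: sum.cong pd_cmult[OF assms])
  have p': "polyfun {1..N} (\<lambda>z. c a * pd j (f a) z)" if "a \<in> A" for a j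
    using assms[OF that] by (intro polyfun_mult polyfun_const polyfun_pd)
  have 2: "pd j (\<lambda>z. \<Sum>a\<in>A. c a * pd j (f a) z) z = (\<Sum>a\<in>A. c a * pd j (pd j (f a)) z)" for j
    by (rule trans[OF pd_sum[of A "{1..N}" "\<lambda>a z. c a * pd j (f a) z", OF p']]) (auto intro!: sum.cong pd_cmult[OF polyfun_pd[OF assms]])
  have L: "reduced_op N l mu g z = (\<Sum>j=1..N. z j * pd j (pd j g) z + (mu + 1 / 2) * pd j g z
     + 2 * l * (\<Sum>i\<in>{1..N} - {j}. z j / (z j - z i)) * pd j g z)" for g
    unfolding reduced_op_def sum_distrib_right sum_distrib_left sum.distrib by (simp only: mult.assoc)
  show ?thesis
    unfolding L 1 2 sum_distrib_left
    by (subst sum.swap) (intro sum.cong refl, simp add: sum_distrib_left sum.distrib algebra_simps)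
qed

lemma reduced_op_f_poly:
  "reduced_op N l mu (f_poly l N n) z = (\<Sum>a\<in>admissible N n. (\<Prod>p\<in>ipairs N. bcoeff l (a p)) * reduced_op N l mu (gen_prod l N (\<lambda>k. n k + exp_shift N a k)) z)"
  unfolding f_poly_def[abs_def] by (rule reduced_op_linear) (rule polyfun_gen_prod)

lemma lin_ext_reduced_op_ground:
  "lin_ext (\<lambda>m. reduced_op N (of_nat M) mu (gen_prod (of_nat M) N (Poly_Mapping.lookup m)) z) (ground N M n) = reduced_op N (of_nat M) mu (f_poly (of_nat M) N n) z"
  unfolding reduced_op_f_poly
proof (rule lin_ext_ground[where Q = "\<lambda>m. reduced_op N (of_nat M) mu (gen_prod (of_nat M) N m) z"])
  fix m m' :: "nat \<Rightarrow> int" assume "\<And>k. k \<in> {1..N} \<Longrightarrow> m k = m' k"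
  then have "gen_prod (of_nat M) N m = gen_prod (of_nat M) N m'" by (rule gen_prod_cong)
  then show "reduced_op N (of_nat M) mu (gen_prod (of_nat M) N m) z = reduced_op N (of_nat M) mu (gen_prod (of_nat M) N m') z" by simp
next
  fix m :: "nat \<Rightarrow> int" and k assume "k \<in> {1..N}" "m k < 0"
  then have "gen_prod (of_nat M) N m = (\<lambda>_. 0)" by (rule gen_prod_neg)
  moreover have "pd j (\<lambda>_. 0) = (\<lambda>_. 0)" for j by (simp add: fun_eq_iff)
  ultimately show "reduced_op N (of_nat M) mu (gen_prod (of_nat M) N m) z = 0" by (simp add: reduced_op_def)
qed

lemma prod_ipairs: "(\<Prod>p\<in>ipairs N. f (fst p) (snd p)) = (\<Prod>k=1..N. \<Prod>l\<in>{k<..N}. f k l)"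
  unfolding ipairs_def by (subst prod.Sigma) (auto simp: case_prod_unfold)

text \<open>Each factor is rewritten by w_l - w_k = w_l (1 - w_k / w_l); the extracted powers of the
  larger variable account for the correction of the monomial.\<close>

lemma ground_eq_lambda_ground:
  "ground N M n = lambda_ground N (vec_mapping N (\<lambda>k. n k - int M * (int k - 1))) M"
proof -
  have "(\<Prod>k=1..N. \<Prod>l\<in>{k<..N}. (lvar l - lvar k) ^ M) =
     (\<Prod>p\<in>ipairs N. lvar (snd p) ^ M * (1 - lvar (fst p) * lvar_inv (snd p)) ^ M)"
    unfolding prod_ipairs[symmetric, of "\<lambda>k l. (lvar l - lvar k) ^ M"] power_mult_distrib[symmetric]
  proof (intro prod.cong refl arg_cong[of _ _ "\<lambda>x. x ^ M"])
    fix p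
    show "lvar (snd p) - lvar (fst p) = lvar (snd p) * (1 - lvar (fst p) * lvar_inv (snd p))"
      using lvar_inverse(2)[of "snd p"] by algebra
  qed
  also have "\<dots> = (\<Prod>p\<in>ipairs N. lvar (snd p) ^ M) * (\<Prod>p\<in>ipairs N. (1 - lvar (fst p) * lvar_inv (snd p)) ^ M)"
    by (rule prod.distrib)
  also have "(\<Prod>p\<in>ipairs N. lvar (snd p) ^ M) = lmonom (vec_mapping N (\<lambda>k. int M * (int k - 1)))"
  proof -
    have "(\<Prod>p\<in>ipairs N. lvar (snd p) ^ M) = lmonom (\<Sum>p\<in>ipairs N. \<Sum>i<M. Poly_Mapping.single (snd p) 1)"
      unfolding lmonom_sum lvar_def lmonom_power ..
    also have "(\<Sum>p\<in>ipairs N. \<Sum>i<M. Poly_Mapping.single (snd p) (1::int)) = vec_mapping N (\<lambda>k. int M * (int k - 1))"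
    proof (rule poly_mapping_eqI)
      fix k
      have "Poly_Mapping.lookup (\<Sum>p\<in>ipairs N. \<Sum>i<M. Poly_Mapping.single (snd p) (1::int)) k =
         (\<Sum>p\<in>ipairs N. int M * of_bool (snd p = k))"
        by (simp only: lookup_sum) (auto simp: lookup_single when_def of_bool_def intro!: sum.cong)
      also have "\<dots> = int M * int (card {p\<in>ipairs N. snd p = k})"
        by (simp flip: sum_distrib_left add: Int_def)
      \<comment> \<open>An index \<open>k\<close> is the larger one in exactly \<open>k - 1\<close>
        pairs.\<close>
      also have "{p\<in>ipairs N. snd p = k} = (if k \<in> {1..N} then (\<lambda>j. (j, k)) ` {1..<k} else {})"
        by (auto simp: ipairs_def)
      also have "int M * int (card \<dots>) = Poly_Mapping.lookup (vec_mapping N (\<lambda>k. int M * (int k - 1))) k"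
        by (simp add: lookup_vec_mapping card_image inj_on_def)
      finally show "Poly_Mapping.lookup (\<Sum>p\<in>ipairs N. \<Sum>i<M. Poly_Mapping.single (snd p) (1::int)) k =
          Poly_Mapping.lookup (vec_mapping N (\<lambda>k. int M * (int k - 1))) k" .
    qed
    finally show ?thesis .
  qed
  finally have "lambda_ground N (vec_mapping N (\<lambda>k. n k - int M * (int k - 1))) M =
     lmonom (vec_mapping N (\<lambda>k. n k - int M * (int k - 1)) + vec_mapping N (\<lambda>k. int M * (int k - 1))) * (\<Prod>p\<in>ipairs N. (1 - lvar (fst p) * lvar_inv (snd p)) ^ M)"
    by (simp only: lambda_ground_def lmonom_add mult.assoc)
  also have "vec_mapping N (\<lambda>k. n k - int M * (int k - 1)) + vec_mapping N (\<lambda>k. int M * (int k - 1)) = vec_mapping N n"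
    by (rule poly_mapping_eqI) (simp add: lookup_add lookup_vec_mapping)
  finally show ?thesis by (simp add: ground_def)
qed

section \<open>Divisibility, index shifts and vanishing remainders\<close>

lemma lvar_diff_power_dvd_ground:
  assumes "k \<in> {1..N}" "l \<in> {1..N}" "k \<noteq> l"
  shows "(lvar k - lvar l) ^ M dvd ground N M n"
proof -
  have *: "(lvar l - lvar k) ^ M dvd ground N M n" if "k \<in> {1..N}" "l \<in> {k<..N}" for k l
  proof -
    have "(lvar l - lvar k) ^ M dvd (\<Prod>l\<in>{k<..N}. (lvar l - lvar k) ^ M)"
      by (rule dvd_prodI) (use that in auto)
    also have "\<dots> dvd (\<Prod>k=1..N. \<Prod>l\<in>{k<..N}. (lvar l - lvar k) ^ M)"
      by (rule dvd_prodI) (use that in auto)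
    finally show ?thesis
      unfolding ground_eq_lambda_ground lambda_ground_def by (rule dvd_mult)
  qed
  show ?thesis
  proof (cases "k < l")
    case True
    have "(lvar k - lvar l) ^ M dvd (lvar l - lvar k) ^ M"
      by (rule dvd_power_same) (metis dvd_minus_iff dvd_refl minus_diff_eq)
    with *[of k l] True assms show ?thesis by (auto intro: dvd_trans)
  next
    case False
    with *[of l k] assms show ?thesis by auto
  qed
qed

lemma lmonom_mult_ground: "lmonom (vec_mapping N m) * ground N M n = ground N M (\<lambda>k. m k + n k)"
proof -
  have "vec_mapping N m + vec_mapping N n = vec_mapping N (\<lambda>k. m k + n k)"
    by (rule poly_mapping_eqI) (simp add: lookup_add lookup_vec_mapping)
  then show ?thesis unfolding ground_def by (simp flip: mult.assoc lmonom_add)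
qed

lemma lvar_inv_ground: "k \<in> {1..N} \<Longrightarrow> lvar_inv k * ground N M n = ground N M (n(k := n k - 1))"
proof -
  assume "k \<in> {1..N}"
  then have "Poly_Mapping.single k (- 1) = vec_mapping N (\<lambda>i. - of_bool (i = k))"
    by (intro poly_mapping_eqI) (auto simp: lookup_vec_mapping lookup_single when_def)
  then show ?thesis
    unfolding lvar_inv_def by (simp add: lmonom_mult_ground) (auto intro!: arg_cong[of _ _ "ground N M"])
qed

text \<open>The factor (w_k / w_l)^V lowers the exponent of w_l by V. For large V it is negative in
  each of the finitely many monomials of \<open>p\<close>, and there the product of coefficients is
  0. This disposes of the remainder of a truncated geometric expansion.\<close>

lemma lin_ext_gen_prod_at_eventually_0:
  assumes "l \<in> {1..N}" "k \<noteq> l"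
  shows "\<exists>V0. \<forall>V\<ge>V0. lin_ext (gen_prod_at r N z) (lmonom (ratio_monom (k, l) V) * p) = 0"
proof -
  define V0 where "V0 = nat (Max (insert 0 ((\<lambda>m. Poly_Mapping.lookup m l) ` Poly_Mapping.keys p))) + 1"
  have "lin_ext (gen_prod_at r N z) (lmonom (ratio_monom (k, l) V) * p) = 0" if "V \<ge> V0" for V
  proof -
    have "gen_prod_at r N z (ratio_monom (k, l) V + m) = 0" if m: "m \<in> Poly_Mapping.keys p" for m
    proof -
      have "Poly_Mapping.lookup m l \<le> Max (insert 0 ((\<lambda>m. Poly_Mapping.lookup m l) ` Poly_Mapping.keys p))"
        using m by (intro Max_ge) auto
      then have "Poly_Mapping.lookup m l < int V"
        using \<open>V \<ge> V0\<close> unfolding V0_def by linarith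
      then have "Poly_Mapping.lookup (ratio_monom (k, l) V + m) l < 0"
        using assms by (simp add: lookup_add lookup_ratio_monom)
      then show ?thesis unfolding gen_prod_at_def using gen_prod_neg[OF assms(1)] by simp
    qed
    then show ?thesis by (simp only: lin_ext_lmonom_mult) (simp add: lin_ext_def)
  qed
  then show ?thesis by blast
qed

subsection \<open>Action of the reduced operator\<close>

text \<open>The truncated form of (1 + q) / (1 - q)^2 = 1 + 3 q + 5 q^2 + ..., with its remainder.
  This is the origin of the factor \<open>2 * real \<nu> - 1\<close> in
  \<open>g_coeff\<close>.\<close>

lemma sum_odd_geometric:
  fixes q :: "'a::comm_ring_1"
  shows "(1 - q)\<^sup>2 * (\<Sum>\<nu>=1..V. (2 * of_nat \<nu> - 1) * q ^ (\<nu> - 1)) = 1 + q - q ^ V * ((2 * of_nat V + 1) - (2 * of_nat V - 1) * q)"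
proof (induction V)
  case (Suc V)
  have "(\<Sum>\<nu>=1..Suc V. (2 * of_nat \<nu> - 1) * q ^ (\<nu> - 1)) =
     (\<Sum>\<nu>=1..V. (2 * of_nat \<nu> - 1) * q ^ (\<nu> - 1)) + (2 * of_nat V + 1) * q ^ V"
    by (simp add: sum.atLeast_Suc_atMost_Suc_shift[symmetric] algebra_simps)
  then show ?case
    unfolding distrib_left by (simp only: Suc.IH distrib_left) (simp add: power2_eq_square algebra_simps)
qed simp

lemma sum_shift_vec:
  assumes "k < l" "l \<in> {1..N}"
  shows "(\<Sum>i=l..N. n i - shift_vec k l \<nu> i) = (\<Sum>i=l..N. n i) - int \<nu>"
proof -
  have "(\<Sum>i=l..N. shift_vec k l \<nu> i) = int \<nu>"
    using assms by (simp add: shift_vec_def sum.distrib of_bool_def if_distrib[of "\<lambda>x. _ * x"] cong: if_cong)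
  then show ?thesis by (simp add: sum_subtractf)
qed

text \<open>With q = w_k / w_l the hypothesis on \<open>X\<close> says that the ground polynomial
  divided by w_l is (1 - q)^2 (w_l X), while the left argument is (1 + q) (w_l X). So the potential
  is the ground polynomial over w_l times (1 + q) / (1 - q)^2, expanded in q.\<close>

lemma lin_ext_potential:
  fixes M N V :: nat
  assumes kl: "k \<in> {1..N}" "l \<in> {k<..N}" and X: "ground N M n = (lvar k - lvar l)\<^sup>2 * X"
    and V: "(\<Sum>i=l..N. n i) \<le> int V"
  shows "lin_ext (gen_prod_at (of_nat M) N z) ((lvar k + lvar l) * X) =
     (\<Sum>\<nu>=1..V. (2 * real \<nu> - 1) * f_poly (of_nat M) N (\<lambda>i. n i - shift_vec k l \<nu> i) z)"
proof -
  define q where "q = lvar k * lvar_inv l"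
  define G where "G = gen_prod_at (of_nat M) N z"
  have l: "l \<in> {1..N}" "k < l" using kl by auto
  have q: "q ^ a = lmonom (ratio_monom (k, l) a)" for a
    using ratio_monom_power[of "(k, l)" a] by (simp add: q_def)
  have wk: "lvar k = lvar l * q"
    using lvar_inverse(2)[of l] unfolding q_def by algebra
  have F1: "lvar_inv l * ground N M n = (1 - q)\<^sup>2 * (lvar l * X)"
    unfolding X wk using lvar_inverse(2)[of l] by algebra
  \<comment> \<open>The monomial q^(\<nu> - 1) / w_l has exponent \<nu> - 1 at \<open>k\<close> and
    - \<nu> at \<open>l\<close>; this is why the index moves by
    \<open>shift_vec k l \<nu>\<close>.\<close>
  have qterm: "q ^ (\<nu> - 1) * (lvar_inv l * ground N M n) = ground N M (\<lambda>i. n i - shift_vec k l \<nu> i)" if "\<nu> \<ge> 1" for \<nu>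
  proof -
    have "lmonom (ratio_monom (k, l) (\<nu> - 1)) * lvar_inv l = lmonom (vec_mapping N (\<lambda>i. - shift_vec k l \<nu> i))"
      unfolding lvar_inv_def lmonom_add[symmetric]
      using that kl by (intro arg_cong[of _ _ lmonom] poly_mapping_eqI)
        (auto simp: lookup_add lookup_ratio_monom lookup_vec_mapping lookup_single when_def shift_vec_def of_nat_diff)
    then have "q ^ (\<nu> - 1) * (lvar_inv l * ground N M n) = lmonom (vec_mapping N (\<lambda>i. - shift_vec k l \<nu> i)) * ground N M n"
      unfolding q mult.assoc[symmetric] by simp
    then show ?thesis by (simp add: lmonom_mult_ground)
  qed
  have expand: "(lvar k + lvar l) * X = (\<Sum>\<nu>=1..V. lconst (2 * real \<nu> - 1) * ground N M (\<lambda>i. n i - shift_vec k l \<nu> i))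
      + (lconst (2 * real V + 1) * (q ^ V * (lvar l * X)) - lconst (2 * real V - 1) * (q ^ V * (q * (lvar l * X))))" for V
  proof -
    have "(\<Sum>\<nu>=1..V. lconst (2 * real \<nu> - 1) * ground N M (\<lambda>i. n i - shift_vec k l \<nu> i)) =
       (\<Sum>\<nu>=1..V. (2 * of_nat \<nu> - 1) * q ^ (\<nu> - 1)) * ((1 - q)\<^sup>2 * (lvar l * X))"
      unfolding sum_distrib_right F1[symmetric]
      by (intro sum.cong refl) (simp add: qterm[symmetric] lconst_hom mult.assoc)
    also have "\<dots> = ((1 - q)\<^sup>2 * (\<Sum>\<nu>=1..V. (2 * of_nat \<nu> - 1) * q ^ (\<nu> - 1))) * (lvar l * X)"
      by (simp only: mult_ac)
    also have "\<dots> = (1 + q - q ^ V * ((2 * of_nat V + 1) - (2 * of_nat V - 1) * q)) * (lvar l * X)"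
      unfolding sum_odd_geometric ..
    finally show ?thesis
      unfolding wk by (simp add: lconst_hom algebra_simps)
  qed
  have lin_ext_expand: "lin_ext G ((lvar k + lvar l) * X) = (\<Sum>\<nu>=1..V. (2 * real \<nu> - 1) * f_poly (of_nat M) N (\<lambda>i. n i - shift_vec k l \<nu> i) z)
     + ((2 * real V + 1) * lin_ext G (q ^ V * (lvar l * X)) - (2 * real V - 1) * lin_ext G (q ^ V * (q * (lvar l * X))))" for V
    unfolding expand[of V] lin_ext_add lin_ext_diff lin_ext_sum lin_ext_lconst by (simp add: G_def lin_ext_gen_prod_at_ground)
  obtain V1 where V1: "\<And>V. V \<ge> V1 \<Longrightarrow> lin_ext G (q ^ V * (lvar l * X)) = 0"
    using lin_ext_gen_prod_at_eventually_0[OF l(1), of k] l(2) unfolding q G_def by (metis less_irrefl)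
  obtain V2 where V2: "\<And>V. V \<ge> V2 \<Longrightarrow> lin_ext G (q ^ V * (q * (lvar l * X))) = 0"
    using lin_ext_gen_prod_at_eventually_0[OF l(1), of k] l(2) unfolding q G_def by (metis less_irrefl)
  \<comment> \<open>First a cutoff beyond which both parts of the remainder vanish. The terms
    between \<open>V\<close> and \<open>V'\<close> are then dropped again: \<nu> lowers the tail sum
    from \<open>l\<close> by \<nu>, which makes it negative once \<nu> exceeds
    \<open>V\<close>.\<close>
  define V' where "V' = max V (max V1 V2)"
  have "lin_ext G ((lvar k + lvar l) * X) = (\<Sum>\<nu>=1..V'. (2 * real \<nu> - 1) * f_poly (of_nat M) N (\<lambda>i. n i - shift_vec k l \<nu> i) z)"
    unfolding lin_ext_expand[of V'] by (simp add: V1 V2 V'_def)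
  also have "\<dots> = (\<Sum>\<nu>=1..V. (2 * real \<nu> - 1) * f_poly (of_nat M) N (\<lambda>i. n i - shift_vec k l \<nu> i) z)"
  proof (rule sum.mono_neutral_right)
    show "\<forall>\<nu>\<in>{1..V'} - {1..V}. (2 * real \<nu> - 1) * f_poly (of_nat M) N (\<lambda>i. n i - shift_vec k l \<nu> i) z = 0"
      using V l by (auto intro!: f_poly_eq_0[of l] simp: sum_shift_vec)
  qed (auto simp: V'_def)
  finally show ?thesis by (simp add: G_def)
qed

text \<open>The operator acts on the index of \<open>gen_prod\<close>, and \<open>lin_ext\<close>
  moves this action to the Laurent polynomial F. The one-factor terms become quadratic polynomials
  in \<open>theta k\<close> followed by \<open>lvar_inv k\<close>, the cross terms become
  differences of derivatives of the quotients \<open>H k i\<close>, and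
  \<open>laurent_identity\<close> evaluates their sum. The condition \<open>M \<ge> 2\<close>
  provides the division by (w_k - w_i)^2.\<close>

lemma reduced_op_f_poly_of_nat:
  fixes M N V :: nat
  assumes M: "M \<ge> 2" and z: "inj_on z {1..N}"
    and V: "\<And>l. l \<in> {1..N} \<Longrightarrow> (\<Sum>i=l..N. n i) \<le> int V"
  defines "l \<equiv> real M"
  shows "reduced_op N l mu (f_poly l N n) z =
     (\<Sum>k=1..N. (m_tilde N l n k - 1) * (m_tilde N l n k - 1 + 1 / 2 + mu - l) * f_poly l N (n(k := n k - 1)) z)
     - l * (l - 1) * (\<Sum>j=1..N. \<Sum>k\<in>{j<..N}. \<Sum>\<nu>=1..V. (2 * real \<nu> - 1) * f_poly l N (\<lambda>i. n i - shift_vec j k \<nu> i) z)"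
proof -
  define F where "F = ground N M n"
  define G where "G = gen_prod_at l N z"
  \<comment> \<open>These are the exponents of the monomial once F is written with differences of
    variables. Then \<open>n' k + c1\<close> is n_k + M (N + 1 - k) - 1, that is
    \<open>m_tilde N l n k - 1\<close>: here the shift in \<open>m_tilde\<close> arises.\<close>
  define n' where "n' k = n k - int M * (int k - 1)" for k
  define c1 where "c1 = l * N - 1"
  define c2 where "c2 = l * N - 1 + 1 / 2 + mu - l"
  let ?D = "\<lambda>k. theta k (theta k F) + lconst (c1 + c2) * theta k F + lconst (c1 * c2) * F"
  have F: "F = lambda_ground N (vec_mapping N n') M"
    unfolding F_def n'_def by (rule ground_eq_lambda_ground)
  have "\<exists>h. k \<in> {1..N} \<longrightarrow> i \<in> {1..N} \<longrightarrow> k \<noteq> i \<longrightarrow> F = (lvar k - lvar i) * h" for k i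
  proof (cases "k \<in> {1..N} \<and> i \<in> {1..N} \<and> k \<noteq> i")
    case True
    have "lvar k - lvar i dvd (lvar k - lvar i) ^ M" using M by (intro dvd_power) simp
    also have "\<dots> dvd F" unfolding F_def by (rule lvar_diff_power_dvd_ground) (use True in auto)
    finally show ?thesis by (auto elim!: dvdE)
  qed auto
  then obtain H where H: "\<And>k i. k \<in> {1..N} \<Longrightarrow> i \<in> {1..N} \<Longrightarrow> k \<noteq> i \<Longrightarrow> F = (lvar k - lvar i) * H k i"
    by metis
  have "\<exists>h. k \<in> {1..N} \<longrightarrow> i \<in> {k<..N} \<longrightarrow> F = (lvar k - lvar i)\<^sup>2 * h" for k i
  proof (cases "k \<in> {1..N} \<and> i \<in> {k<..N}")
    case True
    have "(lvar k - lvar i)\<^sup>2 dvd (lvar k - lvar i) ^ M" using M by (intro le_imp_power_dvd)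
    also have "\<dots> dvd F" unfolding F_def by (rule lvar_diff_power_dvd_ground) (use True in auto)
    finally show ?thesis by (auto elim!: dvdE)
  qed auto
  then obtain X where X: "\<And>k i. k \<in> {1..N} \<Longrightarrow> i \<in> {k<..N} \<Longrightarrow> F = (lvar k - lvar i)\<^sup>2 * X k i"
    by metis
  have "reduced_op N l mu (f_poly l N n) z = lin_ext (\<lambda>m. reduced_op N l mu (gen_prod l N (Poly_Mapping.lookup m)) z) F"
    unfolding F_def l_def by (rule lin_ext_reduced_op_ground[symmetric])
  also have "\<dots> = lin_ext (\<lambda>m. (\<Sum>k=1..N. (of_int (Poly_Mapping.lookup m k) + c1) * (of_int (Poly_Mapping.lookup m k) + c2) *
        G (Poly_Mapping.single k (-1) + m)) + 2 * (\<Sum>k=1..N. \<Sum>i\<in>{k<..N}. gen_prod_gamma l N k i (Poly_Mapping.lookup m) z)) F"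
  proof -
    have "gen_prod l N ((Poly_Mapping.lookup m)(k := Poly_Mapping.lookup m k - 1)) z = G (Poly_Mapping.single k (-1) + m)" for k m
    proof -
      have "(Poly_Mapping.lookup m)(k := Poly_Mapping.lookup m k - 1) = Poly_Mapping.lookup (Poly_Mapping.single k (-1) + m)"
        by (auto simp: fun_eq_iff lookup_add lookup_single when_def)
      then show ?thesis by (simp only: G_def gen_prod_at_def)
    qed
    then show ?thesis
      unfolding reduced_op_gen_prod[OF z] by (simp add: c1_def c2_def algebra_simps)
  qed
  also have "\<dots> = (\<Sum>k=1..N. lin_ext (\<lambda>m. (of_int (Poly_Mapping.lookup m k) + c1) * (of_int (Poly_Mapping.lookup m k) + c2) *
        G (Poly_Mapping.single k (-1) + m)) F) + 2 * (\<Sum>k=1..N. \<Sum>i\<in>{k<..N}. lin_ext (\<lambda>m. gen_prod_gamma l N k i (Poly_Mapping.lookup m) z) F)"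
    by (simp only: lin_ext_plus_fun lin_ext_sum_fun lin_ext_scale_fun)
  also have "(\<Sum>k=1..N. lin_ext (\<lambda>m. (of_int (Poly_Mapping.lookup m k) + c1) * (of_int (Poly_Mapping.lookup m k) + c2) *
        G (Poly_Mapping.single k (-1) + m)) F) =
     (\<Sum>k=1..N. lin_ext G (lvar_inv k * ?D k))"
  proof (intro sum.cong refl)
    fix k
    have "lin_ext G (lvar_inv k * ?D k) =
      lin_ext (\<lambda>m. of_int (Poly_Mapping.lookup m k) * (of_int (Poly_Mapping.lookup m k) * G (Poly_Mapping.single k (-1) + m))
        + (c1 + c2) * (of_int (Poly_Mapping.lookup m k) * G (Poly_Mapping.single k (-1) + m)) + (c1 * c2) * G (Poly_Mapping.single k (-1) + m)) F"
      unfolding lvar_inv_def lin_ext_lmonom_mult lin_ext_add lin_ext_lconst lin_ext_theta lin_ext_plus_fun lin_ext_scale_fun ..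
    then show "lin_ext (\<lambda>m. (of_int (Poly_Mapping.lookup m k) + c1) * (of_int (Poly_Mapping.lookup m k) + c2) *
        G (Poly_Mapping.single k (-1) + m)) F = lin_ext G (lvar_inv k * ?D k)"
      by (simp add: algebra_simps)
  qed
  also have "(\<Sum>k=1..N. \<Sum>i\<in>{k<..N}. lin_ext (\<lambda>m. gen_prod_gamma l N k i (Poly_Mapping.lookup m) z) F) =
     (\<Sum>k=1..N. \<Sum>i\<in>{k<..N}. l * lin_ext G (theta i (H k i) - theta k (H k i)))"
  proof (intro sum.cong refl)
    fix k i assume "k \<in> {1..N}" "i \<in> {k<..N}"
    then have ki: "k \<in> {1..N}" "i \<in> {1..N}" "k \<noteq> i" by auto
    have upd: "Poly_Mapping.lookup (Poly_Mapping.single k 1 + m) = (Poly_Mapping.lookup m)(k := Poly_Mapping.lookup m k + 1)" for k and m :: "nat \<Rightarrow>\<^sub>0 int"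
      by (auto simp: fun_eq_iff lookup_add lookup_single when_def)
    \<comment> \<open>Substituting F = (w_k - w_i) H turns the cross term into the difference of its
      values with index \<open>k\<close> raised and with index \<open>i\<close> raised, the one
      combination that \<open>gen_prod_gamma_rec\<close> evaluates. Its factor m_i - m_k becomes
      \<open>theta i - theta k\<close> on the quotient.\<close>
    have "lin_ext (\<lambda>m. gen_prod_gamma l N k i (Poly_Mapping.lookup m) z) F =
       lin_ext (\<lambda>m. gen_prod_gamma l N k i ((Poly_Mapping.lookup m)(k := Poly_Mapping.lookup m k + 1)) z) (H k i)
       - lin_ext (\<lambda>m. gen_prod_gamma l N k i ((Poly_Mapping.lookup m)(i := Poly_Mapping.lookup m i + 1)) z) (H k i)"
      unfolding H[OF ki] left_diff_distrib lin_ext_diff lvar_def lin_ext_lmonom_mult upd ..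
    also have "\<dots> = lin_ext (\<lambda>m. gen_prod_gamma l N k i ((Poly_Mapping.lookup m)(k := Poly_Mapping.lookup m k + 1)) z
        + (-1) * gen_prod_gamma l N k i ((Poly_Mapping.lookup m)(i := Poly_Mapping.lookup m i + 1)) z) (H k i)"
      unfolding lin_ext_plus_fun lin_ext_scale_fun by simp
    also have "\<dots> = lin_ext (\<lambda>m. l * (of_int (Poly_Mapping.lookup m i) * G m) + (- l) * (of_int (Poly_Mapping.lookup m k) * G m)) (H k i)"
    proof (rule arg_cong[of _ _ "\<lambda>g. lin_ext g (H k i)"], rule ext)
      fix m
      show "gen_prod_gamma l N k i ((Poly_Mapping.lookup m)(k := Poly_Mapping.lookup m k + 1)) z
        + (-1) * gen_prod_gamma l N k i ((Poly_Mapping.lookup m)(i := Poly_Mapping.lookup m i + 1)) z =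
        l * (of_int (Poly_Mapping.lookup m i) * G m) + (- l) * (of_int (Poly_Mapping.lookup m k) * G m)"
        using gen_prod_gamma_rec[OF ki, of l "Poly_Mapping.lookup m" z] by (simp add: G_def gen_prod_at_def algebra_simps)
    qed
    also have "\<dots> = l * lin_ext G (theta i (H k i) - theta k (H k i))"
      unfolding lin_ext_diff lin_ext_theta lin_ext_plus_fun lin_ext_scale_fun by (simp add: algebra_simps)
    finally show "lin_ext (\<lambda>m. gen_prod_gamma l N k i (Poly_Mapping.lookup m) z) F = l * lin_ext G (theta i (H k i) - theta k (H k i))" .
  qed
  also have "(\<Sum>k=1..N. lin_ext G (lvar_inv k * ?D k))
      + 2 * (\<Sum>k=1..N. \<Sum>i\<in>{k<..N}. l * lin_ext G (theta i (H k i) - theta k (H k i)))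
    = lin_ext G ((\<Sum>k=1..N. lvar_inv k * ?D k)
      + lconst (2 * real M) * (\<Sum>k=1..N. \<Sum>i\<in>{k<..N}. theta i (H k i) - theta k (H k i)))"
    unfolding lin_ext_add lin_ext_sum lin_ext_lconst by (simp add: l_def sum_distrib_left mult.assoc)
  also have "\<dots> = lin_ext G ((\<Sum>k=1..N. lconst ((of_int (Poly_Mapping.lookup (vec_mapping N n') k) + c1) * (of_int (Poly_Mapping.lookup (vec_mapping N n') k) + c2)) * (lvar_inv k * F))
      - lconst (real M * (real M - 1)) * (\<Sum>k=1..N. \<Sum>i\<in>{k<..N}. (lvar k + lvar i) * X k i))"
    using laurent_identity[of N "vec_mapping N n'" M H X c1 c2] H X unfolding F by simp
  also have "\<dots> = (\<Sum>k=1..N. (of_int (Poly_Mapping.lookup (vec_mapping N n') k) + c1) * (of_int (Poly_Mapping.lookup (vec_mapping N n') k) + c2) * lin_ext G (lvar_inv k * F))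
      - l * (l - 1) * (\<Sum>k=1..N. \<Sum>i\<in>{k<..N}. lin_ext G ((lvar k + lvar i) * X k i))"
    unfolding lin_ext_diff lin_ext_sum lin_ext_lconst by (simp add: l_def)
  also have "(\<Sum>k=1..N. \<Sum>i\<in>{k<..N}. lin_ext G ((lvar k + lvar i) * X k i)) =
     (\<Sum>j=1..N. \<Sum>k\<in>{j<..N}. \<Sum>\<nu>=1..V. (2 * real \<nu> - 1) * f_poly l N (\<lambda>i. n i - shift_vec j k \<nu> i) z)"
    unfolding G_def l_def by (intro sum.cong refl lin_ext_potential) (use X F_def V in auto)
  also have "(\<Sum>k=1..N. (of_int (Poly_Mapping.lookup (vec_mapping N n') k) + c1) * (of_int (Poly_Mapping.lookup (vec_mapping N n') k) + c2) * lin_ext G (lvar_inv k * F))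
    = (\<Sum>k=1..N. (m_tilde N l n k - 1) * (m_tilde N l n k - 1 + 1 / 2 + mu - l) * f_poly l N (n(k := n k - 1)) z)"
  proof (intro sum.cong refl)
    fix k assume k: "k \<in> {1..N}"
    have "lin_ext G (lvar_inv k * F) = f_poly l N (n(k := n k - 1)) z"
      unfolding G_def F_def lvar_inv_ground[OF k] l_def by (rule lin_ext_gen_prod_at_ground)
    moreover have "of_int (Poly_Mapping.lookup (vec_mapping N n') k) + c1 = m_tilde N l n k - 1"
      "of_int (Poly_Mapping.lookup (vec_mapping N n') k) + c2 = m_tilde N l n k - 1 + 1 / 2 + mu - l"
      using k by (simp_all add: lookup_vec_mapping n'_def c1_def c2_def m_tilde_def l_def algebra_simps)
    ultimately show "(of_int (Poly_Mapping.lookup (vec_mapping N n') k) + c1) * (of_int (Poly_Mapping.lookup (vec_mapping N n') k) + c2) * lin_ext G (lvar_inv k * F)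
       = (m_tilde N l n k - 1) * (m_tilde N l n k - 1 + 1 / 2 + mu - l) * f_poly l N (n(k := n k - 1)) z"
      by simp
  qed
  finally show ?thesis .
qed

subsection \<open>Extension to real coupling\<close>

lemma gen_coeff_cong: "(\<And>k. k \<in> {1..N} \<Longrightarrow> z k = z' k) \<Longrightarrow> gen_coeff l N m z = gen_coeff l N m z'"
  unfolding gen_coeff_def gen_series_def by (metis (no_types, lifting) prod.cong)

lemma f_poly_cong_point: "(\<And>k. k \<in> {1..N} \<Longrightarrow> z k = z' k) \<Longrightarrow> f_poly l N n z = f_poly l N n z'"
  unfolding f_poly_def gen_prod_def using gen_coeff_cong[of N z z'] by (simp cong: prod.cong)

text \<open>Only the coordinates \<open>1, \<dots>, N\<close> of the point are read, so coordinate \<open>0\<close> can carry the coupling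
  constant; polynomial dependence on it then comes with closure under \<open>pd\<close>.\<close>

lemma polyfun_f_poly_coupling: "polyfun {0..N} (\<lambda>z. f_poly (z 0) N n z)"
proof -
  have gen_series: "fps_polyfun {0..N} (\<lambda>z. gen_series (z 0) {1..N} z)"
    unfolding gen_series_def
  proof (rule fps_polyfun_prod)
    fix j assume "j \<in> {1..N}"
    then show "fps_polyfun {0..N} (\<lambda>z. gen_factor (z 0) (z j))"
      using polyfun_diff[OF polyfun_const[of _ 0] polyfun_var[of 0 "{0..N}"]]
      by (auto simp: fps_polyfun_def gen_factor_def intro!: polyfun_mult polyfun_bcoeff polyfun_power polyfun_var)
  qed
  have "polyfun {0..N} (\<lambda>z. gen_coeff (z 0) N m z)" for m
    using gen_series unfolding gen_coeff_def fps_polyfun_def by (cases "m < 0") (simp_all add: polyfun_const)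
  then show ?thesis
    unfolding f_poly_def gen_prod_def
    by (intro polyfun_sum polyfun_mult polyfun_prod polyfun_bcoeff polyfun_var) auto
qed

text \<open>Fixing coordinate 0 at \<open>l\<close> commutes with \<open>pd j\<close>, because
  \<open>j\<close> is not 0 and \<open>f_poly\<close> reads only the coordinates from 1 to
  N.\<close>

lemma
  assumes "j \<in> {1..N}"
  shows pd_f_poly_coupling: "pd j (\<lambda>z. f_poly (z 0) N n z) (z(0 := l)) = pd j (f_poly l N n) z"
    and pd_pd_f_poly_coupling: "pd j (pd j (\<lambda>z. f_poly (z 0) N n z)) (z(0 := l)) = pd j (pd j (f_poly l N n)) z"
proof -
  have j: "j \<noteq> 0" using assms by auto
  have 1: "pd j (\<lambda>z. f_poly (z 0) N n z) (z(0 := l)) = pd j (f_poly l N n) z" for z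
  proof -
    have "f_poly l N n (z(0 := l, j := s)) = f_poly l N n (z(j := s))" for s
      by (rule f_poly_cong_point) auto
    then show ?thesis using j by (simp add: pd_def)
  qed
  show "pd j (\<lambda>z. f_poly (z 0) N n z) (z(0 := l)) = pd j (f_poly l N n) z" by (rule 1)
  have "pd j (\<lambda>z. f_poly (z 0) N n z) (z(0 := l, j := s)) = pd j (f_poly l N n) (z(j := s))" for s
    using 1[of "z(j := s)"] j by (simp add: fun_upd_twist)
  then show "pd j (pd j (\<lambda>z. f_poly (z 0) N n z)) (z(0 := l)) = pd j (pd j (f_poly l N n)) z"
    using j by (simp add: pd_def[of j "pd j _"])
qed

section \<open>Polynomial dependence on the coupling constant\<close>

definition univ_polynomial :: "(real \<Rightarrow> real) \<Rightarrow> bool" where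
  "univ_polynomial f \<longleftrightarrow> (\<exists>p. \<forall>s. f s = poly p s)"

lemma univ_polynomial_const: "univ_polynomial (\<lambda>_. c)"
  unfolding univ_polynomial_def by (rule exI[of _ "[:c:]"]) simp

lemma univ_polynomial_id: "univ_polynomial (\<lambda>s. s)"
  unfolding univ_polynomial_def by (rule exI[of _ "[:0, 1:]"]) simp

lemma univ_polynomial_add: "univ_polynomial f \<Longrightarrow> univ_polynomial g \<Longrightarrow> univ_polynomial (\<lambda>s. f s + g s)"
  unfolding univ_polynomial_def by (metis poly_add)

lemma univ_polynomial_diff: "univ_polynomial f \<Longrightarrow> univ_polynomial g \<Longrightarrow> univ_polynomial (\<lambda>s. f s - g s)"
  unfolding univ_polynomial_def by (metis poly_diff)

lemma univ_polynomial_mult: "univ_polynomial f \<Longrightarrow> univ_polynomial g \<Longrightarrow> univ_polynomial (\<lambda>s. f s * g s)"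
  unfolding univ_polynomial_def by (metis poly_mult)

lemma univ_polynomial_sum: "(\<And>i. i \<in> A \<Longrightarrow> univ_polynomial (f i)) \<Longrightarrow> univ_polynomial (\<lambda>s. \<Sum>i\<in>A. f i s)"
  by (induction A rule: infinite_finite_induct) (auto intro: univ_polynomial_const univ_polynomial_add)

lemma univ_polynomial_f_poly: "univ_polynomial (\<lambda>l. f_poly l N n z)"
proof -
  obtain p where p: "\<And>s. f_poly ((z(0 := s)) 0) N n (z(0 := s)) = poly p s"
    using polyfun_line_poly[OF polyfun_f_poly_coupling[of N n], of z 0] by blast
  have "f_poly s N n (z(0 := s)) = f_poly s N n z" for s by (rule f_poly_cong_point) auto
  then show ?thesis unfolding univ_polynomial_def using p by auto
qed

lemma univ_polynomial_pd_f_poly: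
  assumes "j \<in> {1..N}"
  shows "univ_polynomial (\<lambda>l. pd j (f_poly l N n) z)" "univ_polynomial (\<lambda>l. pd j (pd j (f_poly l N n)) z)"
  using polyfun_line_poly[OF polyfun_pd[OF polyfun_f_poly_coupling[of N n], of j], of z 0]
    polyfun_line_poly[OF polyfun_pd[OF polyfun_pd[OF polyfun_f_poly_coupling[of N n], of j], of j], of z 0]
  unfolding univ_polynomial_def pd_f_poly_coupling[OF assms] pd_pd_f_poly_coupling[OF assms] by simp_all

lemma univ_polynomial_eqI:
  assumes "univ_polynomial f" "univ_polynomial g" and eq: "\<And>M::nat. M \<ge> 2 \<Longrightarrow> f (real M) = g (real M)"
  shows "f = g"
proof -
  obtain p q where p: "\<And>s. f s = poly p s" and q: "\<And>s. g s = poly q s"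
    using assms(1,2) unfolding univ_polynomial_def by blast
  have "real ` {2..} \<subseteq> {s. poly (p - q) s = 0}"
    using eq p q by auto
  moreover have "infinite (real ` {2..})"
    by (simp add: finite_image_iff infinite_Ici)
  ultimately have "p - q = 0"
    using poly_roots_finite[of "p - q"] finite_subset by blast
  then show ?thesis using p q by (simp add: fun_eq_iff)
qed

text \<open>Both sides are polynomials in \<open>l\<close> that agree at \<open>l = 2, 3, \<dots>\<close>.\<close>

lemma reduced_op_f_poly_real:
  fixes l mu :: real and N V :: nat
  assumes z: "inj_on z {1..N}"
    and V: "\<And>l. l \<in> {1..N} \<Longrightarrow> (\<Sum>i=l..N. n i) \<le> int V"
  shows "reduced_op N l mu (f_poly l N n) z =
     (\<Sum>k=1..N. (m_tilde N l n k - 1) * (m_tilde N l n k - 1 + 1 / 2 + mu - l) * f_poly l N (n(k := n k - 1)) z)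
     - l * (l - 1) * (\<Sum>j=1..N. \<Sum>k\<in>{j<..N}. \<Sum>\<nu>=1..V. (2 * real \<nu> - 1) * f_poly l N (\<lambda>i. n i - shift_vec j k \<nu> i) z)"
proof -
  let ?R = "\<lambda>l. (\<Sum>k=1..N. (m_tilde N l n k - 1) * (m_tilde N l n k - 1 + 1 / 2 + mu - l) * f_poly l N (n(k := n k - 1)) z)
     - l * (l - 1) * (\<Sum>j=1..N. \<Sum>k\<in>{j<..N}. \<Sum>\<nu>=1..V. (2 * real \<nu> - 1) * f_poly l N (\<lambda>i. n i - shift_vec j k \<nu> i) z)"
  have "(\<lambda>l. reduced_op N l mu (f_poly l N n) z) = (\<lambda>l.
     ?R l)"
  proof (rule univ_polynomial_eqI)
    show "univ_polynomial (\<lambda>l. reduced_op N l mu (f_poly l N n) z)"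
      unfolding reduced_op_def
      by (intro univ_polynomial_add univ_polynomial_sum univ_polynomial_mult univ_polynomial_const univ_polynomial_id univ_polynomial_pd_f_poly)
    show "univ_polynomial (\<lambda>l.
     ?R l)"
      unfolding m_tilde_def
      by (intro univ_polynomial_add univ_polynomial_diff univ_polynomial_sum univ_polynomial_mult univ_polynomial_const univ_polynomial_id univ_polynomial_f_poly)
  qed (rule reduced_op_f_poly_of_nat[OF _ z V])
  then show ?thesis by (rule fun_cong)
qed

subsection \<open>Evaluation of the contour integrals\<close>

lemma circlepath_power_int_integral:
  assumes "r > 0"
  shows "((\<lambda>w. w powi k / (2 * of_real pi * \<i> * w)) has_contour_integral of_bool (k = 0)) (circlepath 0 r)"
proof (cases "k = 0")
  case True
  have ne: "w \<noteq> 0" if "w \<in> path_image (circlepath 0 r)" for w :: complex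
    using that assms by auto
  have "((\<lambda>w. 1 / (w - 0)) has_contour_integral 2 * of_real pi * \<i>) (circlepath 0 r)"
  proof -
    have "contour_integral (circlepath 0 r) (\<lambda>w. 1 / (w - 0)) = 2 * of_real pi * \<i>"
      by (rule contour_integral_circlepath[OF assms])
    moreover have "(\<lambda>w. 1 / (w - 0)) contour_integrable_on circlepath 0 r"
      using assms by (intro contour_integrable_continuous_circlepath continuous_intros) auto
    ultimately show ?thesis
      by (metis has_contour_integral_integral)
  qed
  then have "((\<lambda>w. 1 / (2 * of_real pi * \<i>) * (1 / (w - 0))) has_contour_integral 1 / (2 * of_real pi * \<i>) * (2 * of_real pi * \<i>)) (circlepath 0 r)"
    by (rule has_contour_integral_lmul)
  then show ?thesis using True by (simp add: field_simps)
next
  case False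
  let ?F = "\<lambda>w. 1 / (2 * of_real pi * \<i> * of_int k) * w powi k"
  have "((\<lambda>w. w powi k / (2 * of_real pi * \<i> * w)) has_contour_integral 
      (\<lambda>w. ?F w) (pathfinish (circlepath 0 r)) -
      (\<lambda>w. ?F w) (pathstart (circlepath 0 r))) (circlepath 0 r)"
  proof (rule contour_integral_primitive[where S = "- {0}"])
    fix w :: complex assume "w \<in> - {0}"
    then have w: "w \<noteq> 0" by simp
    have "((\<lambda>w. ?F w) has_field_derivative
        1 / (2 * of_real pi * \<i> * of_int k) * (of_int k * w powi (k - 1))) (at w within - {0})"
      using w by (auto intro!: derivative_eq_intros)
    also have "1 / (2 * of_real pi * \<i> * of_int k) * (of_int k * w powi (k - 1)) = w powi k / (2 * of_real pi * \<i> * w)"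
      using False w by (simp add: power_int_diff field_simps)
    finally show "((\<lambda>w. ?F w) has_field_derivative
        w powi k / (2 * of_real pi * \<i> * w)) (at w within - {0})" .
  qed (use assms in auto)
  then show ?thesis using False by simp
qed

text \<open>On the circle each term has constant modulus, so summability at radius \<open>r\<close>
  is a Weierstrass majorant and the sum may be integrated term by term. The index set is arbitrary
  and \<open>e\<close> need not be injective, which lets a multiple series be used without first
  collecting equal powers.\<close>

lemma circlepath_laurent_integral:
  fixes c :: "'i \<Rightarrow> complex" and e :: "'i \<Rightarrow> int"
  assumes r: "r > 0" and summ: "(\<lambda>i. norm (c i) * r powi e i) summable_on I"
  shows "contour_integral (circlepath 0 r) (\<lambda>w. \<Sum>\<^sub>\<infinity>i\<in>I. c i * (w powi e i / (2 * of_real pi * \<i> * w))) =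
    (\<Sum>\<^sub>\<infinity>i\<in>{i\<in>I. e i = 0}. c i)"
proof -
  let ?f = "\<lambda>i w. c i * (w powi e i / (2 * of_real pi * \<i> * w))"
  have sum_int: "((\<lambda>w. \<Sum>i\<in>X. ?f i w) has_contour_integral (\<Sum>i\<in>X. c i * of_bool (e i = 0))) (circlepath 0 r)"
    if "finite X" for X
    by (intro has_contour_integral_sum that has_contour_integral_lmul circlepath_power_int_integral r)
  have ul: "uniform_limit (sphere 0 r) (\<lambda>X w. \<Sum>i\<in>X. ?f i w)
     (\<lambda>w. \<Sum>\<^sub>\<infinity>i\<in>I. ?f i w) (finite_subsets_at_top I)"
  proof (rule Weierstrass_m_test_general)
    show "(\<lambda>i. 1 / (2 * pi * r) * (norm (c i) * r powi e i)) summable_on I"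
      by (intro summable_on_cmult_right summ)
    show "norm (?f i w) \<le> 1 / (2 * pi * r) * (norm (c i) * r powi e i)"
      if "w \<in> sphere 0 r" for i w
      using that r by (simp add: norm_mult norm_divide norm_power_int)
  qed
  have "((\<lambda>X. contour_integral (circlepath 0 r) (\<lambda>w. \<Sum>i\<in>X. ?f i w)) \<longlongrightarrow>
      contour_integral (circlepath 0 r) (\<lambda>w. \<Sum>\<^sub>\<infinity>i\<in>I. ?f i w)) (finite_subsets_at_top I)"
    by (rule contour_integral_uniform_limit_circlepath(2)[OF _ ul _ r])
      (use sum_int in \<open>auto simp: contour_integrable_on_def intro!: eventually_finite_subsets_at_top_weakI\<close>)
  moreover have "\<forall>\<^sub>F X in finite_subsets_at_top I. contour_integral (circlepath 0 r) (\<lambda>w. \<Sum>i\<in>X. ?f i w)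
      = (\<Sum>i\<in>X. c i * of_bool (e i = 0))"
    using sum_int by (intro eventually_finite_subsets_at_top_weakI contour_integral_unique) auto
  ultimately have "((\<lambda>i. c i * of_bool (e i = 0)) has_sum
      contour_integral (circlepath 0 r) (\<lambda>w. \<Sum>\<^sub>\<infinity>i\<in>I. ?f i w)) I"
    unfolding has_sum_def by (simp add: tendsto_cong)
  then have "contour_integral (circlepath 0 r) (\<lambda>w. \<Sum>\<^sub>\<infinity>i\<in>I. ?f i w) = (\<Sum>\<^sub>\<infinity>i\<in>I. c i * of_bool (e i = 0))"
    by (simp add: infsumI)
  also have "\<dots> = (\<Sum>\<^sub>\<infinity>i\<in>{i\<in>I. e i = 0}. c i)"
    by (rule infsum_cong_neutral) auto
  finally show ?thesis .
qed

text \<open>Fixing the outermost variable absorbs its power into the coefficients \<open>c\<close>,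
  so the induction hypothesis applies with the same index set. The expansion of \<open>F\<close> is
  asked for only on the torus of the given radii, the only place where the integral reads it and
  where the series converge.\<close>

lemma iterated_contour_integral_laurent:
  fixes c :: "'i \<Rightarrow> complex" and e :: "'i \<Rightarrow> nat \<Rightarrow> int" and r :: "nat \<Rightarrow> real"
  assumes r: "\<And>j. j \<in> {1..N} \<Longrightarrow> r j > 0"
    and \<gamma>: "\<And>j. j \<in> {1..N} \<Longrightarrow> \<gamma> j = circlepath 0 (r j)"
    and summ: "(\<lambda>i. norm (c i) * (\<Prod>j=1..N. r j powi e i j)) summable_on I"
    and F: "\<And>y. (\<And>j. j \<in> {1..N} \<Longrightarrow> norm (y j) = r j) \<Longrightarrow>
      F y = (\<Prod>j=1..N. 1 / (2 * of_real pi * \<i> * y j)) * (\<Sum>\<^sub>\<infinity>i\<in>I. c i * (\<Prod>j=1..N. y j powi e i j))"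
  shows "iterated_contour_integral \<gamma> N F = (\<Sum>\<^sub>\<infinity>i\<in>{i\<in>I. \<forall>j\<in>{1..N}. e i j = 0}. c i)"
  using assms
proof (induction N arbitrary: F c)
  case 0
  then show ?case by simp
next
  case (Suc N)
  define s where "s = r (Suc N)"
  have s: "s > 0" using Suc.prems(1) by (simp add: s_def)
  define J where "J = {i\<in>I. \<forall>j\<in>{1..N}. e i j = 0}"
  have inner: "iterated_contour_integral \<gamma> N (\<lambda>y. F (y(Suc N := w))) = (\<Sum>\<^sub>\<infinity>i\<in>J. c i * (w powi e i (Suc N) / (2 * of_real pi * \<i> * w)))"
    if w: "norm w = s" for w
    unfolding J_def
  proof (rule Suc.IH)
    show "(\<lambda>i. norm (c i * (w powi e i (Suc N) / (2 * of_real pi * \<i> * w))) * (\<Prod>j=1..N. r j powi e i j)) summable_on I"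
    proof -
      have "(\<lambda>i. 1 / (2 * pi * s) * (norm (c i) * (\<Prod>j=1..Suc N. r j powi e i j))) summable_on I"
        by (intro summable_on_cmult_right Suc.prems)
      then show ?thesis
        using w s by (simp add: norm_mult norm_divide norm_power_int s_def mult_ac)
    qed
  next
    fix y :: "nat \<Rightarrow> complex" assume y: "\<And>j. j \<in> {1..N} \<Longrightarrow> norm (y j) = r j"
    have "F (y(Suc N := w)) = (\<Prod>j=1..Suc N. 1 / (2 * of_real pi * \<i> * (y(Suc N := w)) j)) *
        (\<Sum>\<^sub>\<infinity>i\<in>I. c i * (\<Prod>j=1..Suc N. (y(Suc N := w)) j powi e i j))"
      by (rule Suc.prems(4)) (use y w in \<open>auto simp: s_def\<close>)
    also have "(\<Prod>j=1..Suc N. 1 / (2 * of_real pi * \<i> * (y(Suc N := w)) j)) =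
        (\<Prod>j=1..N. 1 / (2 * of_real pi * \<i> * y j)) * (1 / (2 * of_real pi * \<i> * w))"
      by (simp add: atLeastAtMostSuc_conv)
    also have "(\<Sum>\<^sub>\<infinity>i\<in>I. c i * (\<Prod>j=1..Suc N. (y(Suc N := w)) j powi e i j)) =
        (\<Sum>\<^sub>\<infinity>i\<in>I. c i * w powi e i (Suc N) * (\<Prod>j=1..N. y j powi e i j))"
      by (intro infsum_cong) (simp add: atLeastAtMostSuc_conv mult_ac)
    also have "(\<Prod>j=1..N. 1 / (2 * of_real pi * \<i> * y j)) * (1 / (2 * of_real pi * \<i> * w)) * \<dots> =
       (\<Prod>j=1..N. 1 / (2 * of_real pi * \<i> * y j)) * (\<Sum>\<^sub>\<infinity>i\<in>I. 1 / (2 * of_real pi * \<i> * w) * (c i * w powi e i (Suc N) * (\<Prod>j=1..N. y j powi e i j)))"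
      by (subst infsum_cmult_right') (rule mult.assoc)
    also have "(\<Sum>\<^sub>\<infinity>i\<in>I. 1 / (2 * of_real pi * \<i> * w) * (c i * w powi e i (Suc N) * (\<Prod>j=1..N. y j powi e i j))) =
      (\<Sum>\<^sub>\<infinity>i\<in>I. c i * (w powi e i (Suc N) / (2 * of_real pi * \<i> * w)) * (\<Prod>j=1..N. y j powi e i j))"
      by (intro infsum_cong) simp
    finally show "F (y(Suc N := w)) = (\<Prod>j=1..N. 1 / (2 * of_real pi * \<i> * y j)) *
        (\<Sum>\<^sub>\<infinity>i\<in>I. c i * (w powi e i (Suc N) / (2 * of_real pi * \<i> * w)) * (\<Prod>j=1..N. y j powi e i j))" .
  qed (use Suc.prems in auto)
  have summJ: "(\<lambda>i. norm (c i) * s powi e i (Suc N)) summable_on J"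
  proof -
    have "(\<lambda>i. norm (c i) * (\<Prod>j=1..Suc N. r j powi e i j)) summable_on J"
      by (rule summable_on_subset[OF Suc.prems(3)]) (simp add: J_def)
    then show ?thesis
      by (rule summable_on_cong[THEN iffD1, rotated]) (simp add: J_def atLeastAtMostSuc_conv s_def)
  qed
  have "iterated_contour_integral \<gamma> (Suc N) F = contour_integral (circlepath 0 s) (\<lambda>w. iterated_contour_integral \<gamma> N (\<lambda>y. F (y(Suc N := w))))"
    by (simp add: Suc.prems(2) s_def)
  also have "\<dots> = contour_integral (circlepath 0 s) (\<lambda>w. \<Sum>\<^sub>\<infinity>i\<in>J. c i * (w powi e i (Suc N) / (2 * of_real pi * \<i> * w)))"
    by (rule contour_integral_eq) (use s inner in auto)
  also have "\<dots> = (\<Sum>\<^sub>\<infinity>i\<in>{i\<in>J. e i (Suc N) = 0}. c i)"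
    by (rule circlepath_laurent_integral[OF s summJ])
  also have "{i\<in>J. e i (Suc N) = 0} = {i\<in>I. \<forall>j\<in>{1..Suc N}. e i j = 0}"
    by (auto simp: J_def atLeastAtMostSuc_conv)
  finally show ?case .
qed

subsection \<open>Expansion of the integrand\<close>

lemma of_real_gbinomial': "of_real (l gchoose n) = (of_real l gchoose n :: complex)"
  by (simp add: gbinomial_prod_rev)

lemma
  fixes q :: complex
  assumes q: "norm q < 1"
  shows bcoeff_sums: "(\<lambda>m. of_real (bcoeff l m) * q ^ m) sums (1 - q) powr of_real l"
    and bcoeff_abs_summable: "summable (\<lambda>m. norm (of_real (bcoeff l m) * q ^ m))"
proof -
  have *: "(\<lambda>m. of_real (bcoeff l m) * q ^ m) sums (1 - q) powr of_real l" if "norm q < 1" for q :: complex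
  proof -
    have "(\<lambda>m. (of_real l gchoose m) * (- q) ^ m) sums (1 + (- q)) powr of_real l"
      by (rule gen_binomial_complex) (use that in simp)
    moreover have "(of_real l gchoose m) * (- q) ^ m = of_real (bcoeff l m) * q ^ m" for m
      by (subst power_minus) (simp add: bcoeff_def of_real_gbinomial')
    ultimately show ?thesis by simp
  qed
  show "(\<lambda>m. of_real (bcoeff l m) * q ^ m) sums (1 - q) powr of_real l" by (rule *[OF q])
  \<comment> \<open>A radius strictly between the modulus of q and 1: convergence at
    \<open>s\<close> forces absolute convergence at q.\<close>
  define s where "s = (1 + norm q) / 2"
  have s: "norm q < s" "s < 1" using q by (simp_all add: s_def)
  have "0 \<le> s" using s norm_ge_zero[of q] by linarith
  then have "summable (\<lambda>m. of_real (bcoeff l m) * (of_real s :: complex) ^ m)"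
    using *[of "of_real s"] s by (simp add: sums_iff)
  then show "summable (\<lambda>m. norm (of_real (bcoeff l m) * q ^ m))"
    by (rule powser_insidea) (use s \<open>0 \<le> s\<close> in simp)
qed

text \<open>The factors are multiplied in one at a time by Cauchy products, so absolute summability
  has to be carried through the induction together with the value of the sum.\<close>

lemma gen_series_sums:
  fixes t :: complex
  assumes "finite J" and "\<And>j. j \<in> J \<Longrightarrow> norm (of_real (z j) * t) < 1"
  shows "summable (\<lambda>m. norm (of_real (fps_nth (gen_series l J z) m) * t ^ m)) \<and>
    (\<lambda>m. of_real (fps_nth (gen_series l J z) m) * t ^ m) sums (\<Prod>j\<in>J. (1 - of_real (z j) * t) powr (- of_real l))"
  using assms
proof (induction J rule: finite_induct)
  case empty
  have eq: "of_real (fps_nth (gen_series l {} z) m) * t ^ m = (if m = 0 then 1 else 0)" for m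
    by (simp add: gen_series_def)
  have "summable (\<lambda>m. norm (of_real (fps_nth (gen_series l {} z) m) * t ^ m))"
    by (rule summable_finite[of "{0}"]) (auto simp: eq)
  then show ?case
    using sums_single[of 0 "\<lambda>_. 1 :: complex"] by (simp only: eq prod.empty)
next
  case (insert j J)
  define a where "a m = of_real (bcoeff (- l) m) * (of_real (z j) * t) ^ m" for m
  define b where "b m = of_real (fps_nth (gen_series l J z) m) * t ^ m" for m
  have a: "summable (\<lambda>m. norm (a m))" "a sums (1 - of_real (z j) * t) powr (- of_real l)"
    using bcoeff_abs_summable[of "of_real (z j) * t" "- l"] bcoeff_sums[of "of_real (z j) * t" "- l"] insert.prems
    by (simp_all add: a_def[abs_def])
  have b: "summable (\<lambda>m. norm (b m))" "b sums (\<Prod>j\<in>J. (1 - of_real (z j) * t) powr (- of_real l))"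
    using insert.IH insert.prems by (simp_all add: b_def[abs_def])
  have eq: "of_real (fps_nth (gen_series l (insert j J) z) m) * t ^ m = (\<Sum>i\<le>m. a i * b (m - i))" for m
  proof -
    have "fps_nth (gen_series l (insert j J) z) m = (\<Sum>i\<le>m. bcoeff (- l) i * z j ^ i * fps_nth (gen_series l J z) (m - i))"
      using insert.hyps by (simp add: gen_series_def gen_factor_def fps_mult_nth atLeast0AtMost)
    also have "of_real \<dots> * t ^ m = (\<Sum>i\<le>m. of_real (bcoeff (- l) i * z j ^ i * fps_nth (gen_series l J z) (m - i)) * t ^ m)"
      unfolding of_real_sum sum_distrib_right ..
    also have "\<dots> = (\<Sum>i\<le>m. a i * b (m - i))"
    proof (rule sum.cong[OF refl])
      fix i assume "i \<in> {..m}"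
      then have "t ^ m = t ^ i * t ^ (m - i)" by (simp flip: power_add)
      then show "of_real (bcoeff (- l) i * z j ^ i * fps_nth (gen_series l J z) (m - i)) * t ^ m = a i * b (m - i)"
        by (simp add: a_def b_def power_mult_distrib)
    qed
    finally show ?thesis .
  qed
  have "summable (\<lambda>m. \<Sum>i\<le>m. norm (a i) * norm (b (m - i)))"
    by (rule summable_Cauchy_product) (use a b in auto)
  then have "summable (\<lambda>m. norm (\<Sum>i\<le>m. a i * b (m - i)))"
  proof (rule summable_comparison_test[rotated], intro exI allI impI)
    fix m show "norm (norm (\<Sum>i\<le>m. a i * b (m - i))) \<le> (\<Sum>i\<le>m. norm (a i) * norm (b (m - i)))"
      by (simp add: norm_mult[symmetric] norm_sum)
  qed
  moreover have "(\<lambda>m. \<Sum>i\<le>m. a i * b (m - i)) sums (suminf a * suminf b)"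
    by (rule Cauchy_product_sums) (use a b in auto)
  ultimately show ?case
    using a(2) b(2) insert.hyps by (simp add: eq sums_iff)
qed

section \<open>The integrand as a single multiple series\<close>

definition series_index :: "nat \<Rightarrow> ((nat \<times> nat) + nat) set" where
  "series_index N = Inl ` ipairs N \<union> Inr ` {1..N}"

text \<open>A factor of the integrand is either one binomial of the numerator, tagged
  \<open>Inl\<close>, or the whole product over j of the denominators belonging to one y_k, tagged
  \<open>Inr\<close> and already expanded as \<open>gen_series\<close>.\<close>

definition series_term :: "real \<Rightarrow> nat \<Rightarrow> (nat \<Rightarrow> real) \<Rightarrow> (nat \<Rightarrow> complex) \<Rightarrow> (nat \<times> nat) + nat \<Rightarrow> nat \<Rightarrow> complex" where
  "series_term l N z y s m = (case s of Inl p \<Rightarrow> of_real (bcoeff l m) * ((y (fst p))\<^sup>2 / (y (snd p))\<^sup>2) ^ m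
      | Inr k \<Rightarrow> of_real (fps_nth (gen_series l {1..N} z) m) * (1 / (y k)\<^sup>2) ^ m)"

definition series_coeff :: "real \<Rightarrow> nat \<Rightarrow> (nat \<Rightarrow> real) \<Rightarrow> ((nat \<times> nat) + nat \<Rightarrow> nat) \<Rightarrow> real" where
  "series_coeff l N z g = (\<Prod>p\<in>ipairs N. bcoeff l (g (Inl p))) * (\<Prod>k=1..N. fps_nth (gen_series l {1..N} z) (g (Inr k)))"

definition series_exp :: "nat \<Rightarrow> (nat \<Rightarrow> int) \<Rightarrow> ((nat \<times> nat) + nat \<Rightarrow> nat) \<Rightarrow> nat \<Rightarrow> int" where
  "series_exp N n g j = 2 * (n j + exp_shift N (\<lambda>p. g (Inl p)) j - int (g (Inr j)))"

lemma finite_series_index [simp]: "finite (series_index N)"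
  by (simp add: series_index_def)

lemma prod_series_index: "(\<Prod>s\<in>series_index N. f s) = (\<Prod>p\<in>ipairs N. f (Inl p)) * (\<Prod>k=1..N. f (Inr k))"
  unfolding series_index_def by (subst prod.union_disjoint) (auto simp: prod.reindex)

lemma power_int_sum: "(x::complex) \<noteq> 0 \<Longrightarrow> x powi (\<Sum>i\<in>A. f i) = (\<Prod>i\<in>A. x powi f i)"
  by (induction A rule: infinite_finite_induct) (simp_all add: power_int_add)

lemma prod_series_term:
  assumes y: "\<And>j. j \<in> {1..N} \<Longrightarrow> y j \<noteq> 0"
  shows "(\<Prod>j=1..N. y j powi (2 * n j)) * (\<Prod>s\<in>series_index N. series_term l N z y s (g s)) = of_real (series_coeff l N z g) * (\<Prod>j=1..N. y j powi series_exp N n g j)"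
proof -
  have P: "(\<Prod>j=1..N. y j powi (2 * exp_shift N a j)) = (\<Prod>p\<in>ipairs N. ((y (fst p))\<^sup>2 / (y (snd p))\<^sup>2) ^ a p)" for a
  proof -
    have "(\<Prod>j=1..N. y j powi (2 * exp_shift N a j)) = (\<Prod>j=1..N. \<Prod>p\<in>ipairs N. y j powi (2 * (int (a p) * (of_bool (j = fst p) - of_bool (j = snd p)))))"
      unfolding exp_shift_def sum_distrib_left using y by (intro prod.cong refl power_int_sum) auto
    also have "\<dots> = (\<Prod>p\<in>ipairs N. \<Prod>j=1..N. y j powi (2 * (int (a p) * (of_bool (j = fst p) - of_bool (j = snd p)))))"
      by (rule prod.swap)
    also have "\<dots> = (\<Prod>p\<in>ipairs N. ((y (fst p))\<^sup>2 / (y (snd p))\<^sup>2) ^ a p)"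
    proof (intro prod.cong refl)
      fix p assume "p \<in> ipairs N"
      then have p: "fst p \<in> {1..N}" "snd p \<in> {1..N}" "fst p \<noteq> snd p" by (auto simp: ipairs_def)
      define h where "h j = y j powi (2 * (int (a p) * (of_bool (j = fst p) - of_bool (j = snd p))))" for j
      have "(\<Prod>j=1..N. h j) = (\<Prod>j\<in>{fst p, snd p}. h j)"
        by (rule prod.mono_neutral_right) (use p in \<open>auto simp: h_def\<close>)
      also have "\<dots> = h (fst p) * h (snd p)" using p by simp
      also have "h (fst p) = ((y (fst p))\<^sup>2) ^ a p"
        using p by (simp add: h_def power_int_mult power_int_numeral)
      also have "h (snd p) = inverse (((y (snd p))\<^sup>2) ^ a p)"
        using p by (simp add: h_def power_int_mult power_int_minus power_int_numeral)
      finally show "(\<Prod>j=1..N. y j powi (2 * (int (a p) * (of_bool (j = fst p) - of_bool (j = snd p))))) = ((y (fst p))\<^sup>2 / (y (snd p))\<^sup>2) ^ a p"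
        by (simp add: h_def divide_inverse power_mult_distrib power_inverse)
    qed
    finally show ?thesis .
  qed
  have e: "y j powi series_exp N n g j = y j powi (2 * n j) * y j powi (2 * exp_shift N (\<lambda>p. g (Inl p)) j) * (1 / (y j)\<^sup>2) ^ g (Inr j)" if "j \<in> {1..N}" for j
  proof -
    have "y j powi (- (2 * int (g (Inr j)))) = (1 / (y j)\<^sup>2) ^ g (Inr j)"
      by (simp add: power_int_mult power_int_minus power_int_numeral divide_inverse power_inverse)
    moreover have "series_exp N n g j = 2 * n j + 2 * exp_shift N (\<lambda>p. g (Inl p)) j + (- (2 * int (g (Inr j))))"
      by (simp add: series_exp_def)
    moreover have "y j powi (A + B + C) = y j powi A * y j powi B * y j powi C" for A B C
      using y[OF that] by (simp add: power_int_add)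
    ultimately show ?thesis by (simp only:)
  qed
  have "(\<Prod>j=1..N. y j powi series_exp N n g j) = (\<Prod>j=1..N. y j powi (2 * n j)) * (\<Prod>p\<in>ipairs N. ((y (fst p))\<^sup>2 / (y (snd p))\<^sup>2) ^ g (Inl p)) * (\<Prod>j=1..N. (1 / (y j)\<^sup>2) ^ g (Inr j))"
    unfolding P[symmetric] prod.distrib[symmetric] by (intro prod.cong refl e)
  then show ?thesis
    by (simp add: prod_series_index series_term_def series_coeff_def prod.distrib of_real_prod mult_ac)
qed

lemma series_term_summable:
  assumes y: "\<And>j. j \<in> {1..N} \<Longrightarrow> y j \<noteq> 0"
    and yy: "\<And>j k. j \<in> {1..N} \<Longrightarrow> k \<in> {j<..N} \<Longrightarrow> norm (y j) < norm (y k)"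
    and xy: "\<And>j k. j \<in> {1..N} \<Longrightarrow> k \<in> {1..N} \<Longrightarrow> \<bar>x j\<bar> < norm (y k)"
    and s: "s \<in> series_index N"
  defines "z \<equiv> \<lambda>i. (x i)\<^sup>2"
  shows "(\<lambda>m. norm (series_term l N z y s m)) summable_on UNIV"
    and "infsum (series_term l N z y s) UNIV = (case s of Inl p \<Rightarrow> (1 - (y (fst p))\<^sup>2 / (y (snd p))\<^sup>2) powr of_real l
      | Inr k \<Rightarrow> (\<Prod>j=1..N. (1 - of_real ((x j)\<^sup>2) / (y k)\<^sup>2) powr (- of_real l)))"
proof -
  have "summable (\<lambda>m. norm (series_term l N z y s m)) \<and> series_term l N z y s sums (case s of Inl p \<Rightarrow> (1 - (y (fst p))\<^sup>2 / (y (snd p))\<^sup>2) powr of_real l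
      | Inr k \<Rightarrow> (\<Prod>j=1..N. (1 - of_real ((x j)\<^sup>2) / (y k)\<^sup>2) powr (- of_real l)))"
  proof (cases s)
    case (Inl p)
    then have "p \<in> ipairs N" using s by (auto simp: series_index_def)
    then have p: "fst p \<in> {1..N}" "snd p \<in> {fst p<..N}" "snd p \<in> {1..N}" by (auto simp: ipairs_def)
    have "norm ((y (fst p))\<^sup>2 / (y (snd p))\<^sup>2) < 1"
      using yy[OF p(1,2)] y[OF p(3)] by (simp add: norm_divide norm_power power_strict_mono)
    then show ?thesis
      using bcoeff_sums bcoeff_abs_summable Inl by (simp add: series_term_def[abs_def])
  next
    case (Inr k)
    then have k: "k \<in> {1..N}" using s by (auto simp: series_index_def)
    have "norm (of_real (z j) * (1 / (y k)\<^sup>2)) < 1" if "j \<in> {1..N}" for j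
    proof -
      have "\<bar>x j\<bar>\<^sup>2 < (norm (y k))\<^sup>2"
        using xy[OF that k] by (intro power_strict_mono) auto
      then show ?thesis
        using y[OF k] by (simp add: z_def norm_divide norm_power norm_mult)
    qed
    then show ?thesis
      using gen_series_sums[of "{1..N}" z "1 / (y k)\<^sup>2" l] Inr by (simp add: series_term_def[abs_def] z_def)
  qed
  then show "(\<lambda>m. norm (series_term l N z y s m)) summable_on UNIV"
    "infsum (series_term l N z y s) UNIV = (case s of Inl p \<Rightarrow> (1 - (y (fst p))\<^sup>2 / (y (snd p))\<^sup>2) powr of_real l
      | Inr k \<Rightarrow> (\<Prod>j=1..N. (1 - of_real ((x j)\<^sup>2) / (y k)\<^sup>2) powr (- of_real l)))"
    by (auto simp: summable_on_UNIV_nonneg_real_iff intro!: infsumI norm_summable_imp_has_sum)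
qed

text \<open>The radii increase with j and exceed every modulus of x_k, so on the torus all factors
  expand into absolutely convergent series, and their product is one absolutely summable Laurent
  series. The iterated integral picks its constant term, where the exponents of the numerator
  determine those of the denominator.\<close>

lemma f_fun_eq_f_poly:
  assumes N: "N \<ge> 1" and \<epsilon>: "\<epsilon> > 0"
  shows "f_fun N l \<epsilon> n x = of_real (f_poly l N n (\<lambda>i. (x i)\<^sup>2))"
proof -
  define z where "z i = (x i)\<^sup>2" for i
  define r where "r j = Max ((\<lambda>k. \<bar>x k\<bar>) ` {1..N}) + \<epsilon> * real j" for j
  define I where "I = series_index N \<rightarrow>\<^sub>E (UNIV :: nat set)"
  define F where "F y = (\<Prod>j=1..N. 1 / (2 * of_real pi * \<i> * y j) * y j powi (2 * n j)) *
            (\<Prod>j=1..N. \<Prod>k\<in>{j<..N}. (1 - (y j)\<^sup>2 / (y k)\<^sup>2) powr of_real l) /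
            (\<Prod>j=1..N. \<Prod>k=1..N. (1 - of_real ((x j)\<^sup>2) / (y k)\<^sup>2) powr of_real l)" for y
  have xr: "\<bar>x k\<bar> < r j" if "k \<in> {1..N}" "j \<in> {1..N}" for j k
  proof -
    have "\<bar>x k\<bar> \<le> Max ((\<lambda>k. \<bar>x k\<bar>) ` {1..N})" using that by (intro Max_ge) auto
    moreover have "\<epsilon> * real j > 0" using \<epsilon> that by simp
    ultimately show ?thesis by (simp add: r_def)
  qed
  have r0: "r j > 0" if "j \<in> {1..N}" for j
    using xr[OF that that] by linarith
  have rr: "r j < r k" if "j < k" for j k
    using \<epsilon> that by (simp add: r_def)
  have ycond: "y j \<noteq> 0" "k \<in> {j<..N} \<Longrightarrow> norm (y j) < norm (y k)" "k \<in> {1..N} \<Longrightarrow> \<bar>x j\<bar> < norm (y k)"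
    if "\<And>j. j \<in> {1..N} \<Longrightarrow> norm (y j) = r j" "j \<in> {1..N}" for y :: "nat \<Rightarrow> complex" and j k
  proof -
    have j: "norm (y j) = r j" and k: "k \<in> {1..N} \<Longrightarrow> norm (y k) = r k"
      using that by auto
    show "y j \<noteq> 0" using j r0[OF that(2)] by auto
    show "norm (y j) < norm (y k)" if "k \<in> {j<..N}"
      using that j k rr[of j k] by auto
    show "\<bar>x j\<bar> < norm (y k)" if "k \<in> {1..N}"
      using k[OF that] xr[OF \<open>j \<in> {1..N}\<close> that] by simp
  qed
  have Fy: "F y = (\<Prod>j=1..N. 1 / (2 * of_real pi * \<i> * y j)) * (\<Sum>\<^sub>\<infinity>g\<in>I. of_real (series_coeff l N z g) * (\<Prod>j=1..N. y j powi series_exp N n g j))"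
    if y: "\<And>j. j \<in> {1..N} \<Longrightarrow> norm (y j) = r j" for y
  proof -
    note s = series_term_summable[of N y x, OF ycond[OF y], folded z_def[abs_def]]
    have "(\<Sum>\<^sub>\<infinity>g\<in>I. of_real (series_coeff l N z g) * (\<Prod>j=1..N. y j powi series_exp N n g j)) =
       (\<Sum>\<^sub>\<infinity>g\<in>I. (\<Prod>j=1..N. y j powi (2 * n j)) * (\<Prod>s\<in>series_index N. series_term l N z y s (g s)))"
      by (intro infsum_cong prod_series_term[symmetric] ycond(1)[OF y])
    also have "\<dots> = (\<Prod>j=1..N. y j powi (2 * n j)) * (\<Sum>\<^sub>\<infinity>g\<in>I. \<Prod>s\<in>series_index N. series_term l N z y s (g s))"
      by (rule infsum_cmult_right')
    also have "(\<Sum>\<^sub>\<infinity>g\<in>I. \<Prod>s\<in>series_index N. series_term l N z y s (g s)) = (\<Prod>s\<in>series_index N. infsum (series_term l N z y s) UNIV)"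
      unfolding I_def by (rule infsum_prod_PiE_abs) (use s(1) in auto)
    also have "\<dots> = (\<Prod>s\<in>series_index N. (case s of Inl p \<Rightarrow> (1 - (y (fst p))\<^sup>2 / (y (snd p))\<^sup>2) powr of_real l
      | Inr k \<Rightarrow> (\<Prod>j=1..N. (1 - of_real ((x j)\<^sup>2) / (y k)\<^sup>2) powr (- of_real l))))"
      by (intro prod.cong refl s(2)) auto
    also have "\<dots> = (\<Prod>p\<in>ipairs N. (1 - (y (fst p))\<^sup>2 / (y (snd p))\<^sup>2) powr of_real l) *
       (\<Prod>k=1..N. \<Prod>j=1..N. (1 - of_real ((x j)\<^sup>2) / (y k)\<^sup>2) powr (- of_real l))"
      by (simp add: prod_series_index)
    also have "(\<Prod>p\<in>ipairs N. (1 - (y (fst p))\<^sup>2 / (y (snd p))\<^sup>2) powr of_real l) =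
       (\<Prod>j=1..N. \<Prod>k\<in>{j<..N}. (1 - (y j)\<^sup>2 / (y k)\<^sup>2) powr of_real l)"
      by (rule prod_ipairs)
    also have "(\<Prod>k=1..N. \<Prod>j=1..N. (1 - of_real ((x j)\<^sup>2) / (y k)\<^sup>2) powr (- of_real l)) =
       1 / (\<Prod>j=1..N. \<Prod>k=1..N. (1 - of_real ((x j)\<^sup>2) / (y k)\<^sup>2) powr of_real l)"
      by (subst prod.swap) (simp add: powr_minus prod_inversef[symmetric] o_def divide_inverse)
    finally have eq: "(\<Sum>\<^sub>\<infinity>g\<in>I. of_real (series_coeff l N z g) * (\<Prod>j=1..N. y j powi series_exp N n g j)) =
       (\<Prod>j=1..N. y j powi (2 * n j)) * ((\<Prod>j=1..N. \<Prod>k\<in>{j<..N}. (1 - (y j)\<^sup>2 / (y k)\<^sup>2) powr of_real l) *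
       (1 / (\<Prod>j=1..N. \<Prod>k=1..N. (1 - of_real ((x j)\<^sup>2) / (y k)\<^sup>2) powr of_real l)))" .
    show ?thesis
      unfolding F_def eq prod.distrib by (simp only: times_divide_eq_right mult_1_right mult.assoc)
  qed
  have summ: "(\<lambda>g. norm (of_real (series_coeff l N z g) :: complex) * (\<Prod>j=1..N. r j powi series_exp N n g j)) summable_on I"
  proof -
    \<comment> \<open>At the positive real point of the torus the norms of the terms are exactly the
      weights required, since each term has constant modulus on the torus.\<close>
    define y :: "nat \<Rightarrow> complex" where "y j = of_real (r j)" for j
    have y: "norm (y j) = r j" if "j \<in> {1..N}" for j using r0[OF that] by (simp add: y_def)
    note s = series_term_summable(1)[of N y x, OF ycond[OF y], folded z_def[abs_def]]
    have "Infinite_Set_Sum.abs_summable_on (\<lambda>g. \<Prod>s\<in>series_index N. series_term l N z y s (g s)) I"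
      unfolding I_def
      by (rule abs_summable_on_prod_PiE) (use s in \<open>auto simp: abs_summable_equivalent[symmetric]\<close>)
    then have "(\<lambda>g. norm (\<Prod>s\<in>series_index N. series_term l N z y s (g s))) summable_on I"
      by (simp add: abs_summable_equivalent[symmetric])
    then have "(\<lambda>g. norm (\<Prod>j=1..N. y j powi (2 * n j)) * norm (\<Prod>s\<in>series_index N. series_term l N z y s (g s))) summable_on I"
      by (rule summable_on_cmult_right)
    moreover have "norm (\<Prod>j=1..N. y j powi (2 * n j)) * norm (\<Prod>s\<in>series_index N. series_term l N z y s (g s)) =
       norm (of_real (series_coeff l N z g) :: complex) * (\<Prod>j=1..N. r j powi series_exp N n g j)" for g
    proof -
      have y0: "y j \<noteq> 0" if "j \<in> {1..N}" for j using r0[OF that] by (simp add: y_def)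
      have "norm (\<Prod>j=1..N. y j powi (2 * n j)) * norm (\<Prod>s\<in>series_index N. series_term l N z y s (g s)) =
          norm ((\<Prod>j=1..N. y j powi (2 * n j)) * (\<Prod>s\<in>series_index N. series_term l N z y s (g s)))"
        by (rule norm_mult[symmetric])
      also have "(\<Prod>j=1..N. y j powi (2 * n j)) * (\<Prod>s\<in>series_index N. series_term l N z y s (g s)) =
          of_real (series_coeff l N z g) * (\<Prod>j=1..N. y j powi series_exp N n g j)"
        by (rule prod_series_term) (rule y0)
      also have "norm \<dots> = norm (of_real (series_coeff l N z g) :: complex) * (\<Prod>j=1..N. norm (y j powi series_exp N n g j))"
        by (simp only: norm_mult prod_norm)
      also have "(\<Prod>j=1..N. norm (y j powi series_exp N n g j)) = (\<Prod>j=1..N. r j powi series_exp N n g j)"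
        by (intro prod.cong refl) (simp add: norm_power_int y)
      finally show ?thesis .
    qed
    ultimately show ?thesis by simp
  qed
  have "f_fun N l \<epsilon> n x = iterated_contour_integral (f_contour N \<epsilon> x) N F"
    by (simp add: f_fun_def F_def[abs_def])
  also have "\<dots> = (\<Sum>\<^sub>\<infinity>g\<in>{g\<in>I. \<forall>j\<in>{1..N}. series_exp N n g j = 0}. of_real (series_coeff l N z g))"
    by (rule iterated_contour_integral_laurent[where r = r])
      (use r0 summ Fy in \<open>simp_all add: f_contour_def r_def\<close>)
  \<comment> \<open>In the constant term the values at \<open>Inr k\<close> are forced to be
    \<open>n k + exp_shift N a k\<close>, which must then be non-negative; the values at
    \<open>Inl p\<close> are free. The value \<open>undefined\<close> outside the index set restores
    extensionality.\<close>
  also have "\<dots> = (\<Sum>\<^sub>\<infinity>a\<in>admissible N n. of_real ((\<Prod>p\<in>ipairs N. bcoeff l (a p)) * gen_prod l N (\<lambda>k. n k + exp_shift N a k) z))"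
  proof (rule infsum_reindex_bij_witness[where
      i = "\<lambda>a s. if s \<in> series_index N then (case s of Inl p \<Rightarrow> a p | Inr k \<Rightarrow> nat (n k + exp_shift N a k)) else undefined"
      and j = "\<lambda>g. \<lambda>p\<in>ipairs N. g (Inl p)"])
    have exp_shift_restrict: "exp_shift N (\<lambda>p\<in>ipairs N. f p) = exp_shift N f" for f
      by (auto simp: exp_shift_def fun_eq_iff)
    fix g assume g: "g \<in> {g\<in>I. \<forall>j\<in>{1..N}. series_exp N n g j = 0}"
    then have gk: "int (g (Inr k)) = n k + exp_shift N (\<lambda>p. g (Inl p)) k" if "k \<in> {1..N}" for k
    proof -
      have "series_exp N n g k = 0" using g that by blast
      then show ?thesis by (simp add: series_exp_def)
    qed
    show "(\<lambda>s. if s \<in> series_index N then (case s of Inl p \<Rightarrow> (\<lambda>p\<in>ipairs N. g (Inl p)) p | Inr k \<Rightarrow> nat (n k + exp_shift N (\<lambda>p\<in>ipairs N. g (Inl p)) k)) else undefined) = g"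
    proof
      fix s
      show "(if s \<in> series_index N then (case s of Inl p \<Rightarrow> (\<lambda>p\<in>ipairs N. g (Inl p)) p | Inr k \<Rightarrow> nat (n k + exp_shift N (\<lambda>p\<in>ipairs N. g (Inl p)) k)) else undefined) = g s"
        using g gk unfolding exp_shift_restrict by (auto simp: series_index_def I_def PiE_def extensional_def gk[symmetric] split: sum.splits)
    qed
    have "0 \<le> n k + exp_shift N (\<lambda>p. g (Inl p)) k" if "k \<in> {1..N}" for k
      using gk[OF that] by linarith
    then show "(\<lambda>p\<in>ipairs N. g (Inl p)) \<in> admissible N n"
      unfolding admissible_def by (auto simp: exp_shift_restrict)
    have "(\<Prod>k=1..N. fps_nth (gen_series l {1..N} z) (g (Inr k))) = gen_prod l N (\<lambda>k. n k + exp_shift N (\<lambda>p. g (Inl p)) k) z"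
      unfolding gen_prod_def by (intro prod.cong refl) (simp add: gen_coeff_def gk[symmetric])
    then show "of_real ((\<Prod>p\<in>ipairs N. bcoeff l ((\<lambda>p\<in>ipairs N. g (Inl p)) p)) * gen_prod l N (\<lambda>k. n k + exp_shift N (\<lambda>p\<in>ipairs N. g (Inl p)) k) z) = of_real (series_coeff l N z g)"
      unfolding exp_shift_restrict series_coeff_def by simp
  next
    fix a assume a: "a \<in> admissible N n"
    define g where "g = (\<lambda>s. if s \<in> series_index N then (case s of Inl p \<Rightarrow> a p | Inr k \<Rightarrow> nat (n k + exp_shift N a k)) else undefined)"
    have gl: "g (Inl p) = a p" if "p \<in> ipairs N" for p using that by (simp add: g_def series_index_def)
    then have "exp_shift N (\<lambda>p. g (Inl p)) = exp_shift N a" by (auto simp: exp_shift_def fun_eq_iff)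
    moreover have "int (g (Inr k)) = n k + exp_shift N a k" if "k \<in> {1..N}" for k
      using a that by (simp add: g_def series_index_def admissible_def)
    moreover have "g \<in> I" by (auto simp: g_def I_def PiE_def extensional_def)
    ultimately show "g \<in> {g\<in>I. \<forall>j\<in>{1..N}. series_exp N n g j = 0}"
      by (auto simp: series_exp_def)
    show "(\<lambda>p\<in>ipairs N. g (Inl p)) = a"
      using a gl by (auto simp: fun_eq_iff admissible_def PiE_def extensional_def restrict_def)
  qed
  also have "\<dots> = of_real (f_poly l N n z)"
    by (simp add: f_poly_def)
  finally show ?thesis by (simp add: z_def[abs_def])
qed

subsection \<open>The recursion for the coefficients\<close>

definition step_pairs :: "nat \<Rightarrow> (nat \<times> nat) set" where
  "step_pairs N = {(j, k). 1 \<le> j \<and> j \<le> k \<and> k \<le> N}"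

abbreviation step_vec :: "nat \<times> nat \<Rightarrow> nat \<Rightarrow> nat \<Rightarrow> int" where
  "step_vec p \<equiv> shift_vec (fst p) (snd p)"

abbreviation step_coeff :: "nat \<Rightarrow> real \<Rightarrow> real \<Rightarrow> nat \<times> nat \<Rightarrow> nat \<Rightarrow> (nat \<Rightarrow> int) \<Rightarrow> real" where
  "step_coeff N l mu p \<equiv> g_coeff N l mu (fst p) (snd p)"

lemma finite_step_pairs [simp]: "finite (step_pairs N)"
  by (rule finite_subset[of _ "{1..N} \<times> {1..N}"]) (auto simp: step_pairs_def)

lemma pair_seqs_eq: "pair_seqs N s = {1..s} \<rightarrow>\<^sub>E step_pairs N"
  by (simp add: pair_seqs_def step_pairs_def)

lemma sum_shift_vec_weighted:
  fixes u :: "nat \<Rightarrow> int"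
  assumes "finite A"
  shows "(\<Sum>i\<in>A. u i * shift_vec j k \<nu> i) = (1 - int \<nu>) * (of_bool (j \<in> A) * u j) + int \<nu> * (of_bool (k \<in> A) * u k)"
proof -
  have *: "(\<Sum>i\<in>A. u i * of_bool (i = a)) = of_bool (a \<in> A) * u a" for a
    using assms by (simp add: of_bool_def if_distrib[of "\<lambda>x. _ * x"] cong: if_cong)
  have "(\<Sum>i\<in>A. u i * shift_vec j k \<nu> i) = (1 - int \<nu>) * (\<Sum>i\<in>A. u i * of_bool (i = j)) + int \<nu> * (\<Sum>i\<in>A. u i * of_bool (i = k))"
    unfolding sum_distrib_left sum.distrib[symmetric] by (intro sum.cong refl) (simp add: shift_vec_def algebra_simps)
  then show ?thesis unfolding * .
qed

lemma sum_step_vec_total: "p \<in> step_pairs N \<Longrightarrow> (\<Sum>i=1..N. step_vec p \<nu> i) = 1"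
  using sum_shift_vec_weighted[of "{1..N}" "\<lambda>_. 1" "fst p" "snd p" \<nu>] by (auto simp: step_pairs_def)

lemma sum_step_vec_tail:
  assumes "p \<in> step_pairs N"
  shows "0 \<le> (\<Sum>i=l..N. step_vec p \<nu> i)"
  using sum_shift_vec_weighted[of "{l..N}" "\<lambda>_. 1" "fst p" "snd p" \<nu>] assms by (auto simp: step_pairs_def)

text \<open>A step from (j,k) has weight j + \<nu> (k - j). For j < k this is at least \<nu>, and
  for j = k a non-zero coefficient forces \<nu> = 0. So the weighted sum of coordinates bounds
  \<nu>, which the plain sum cannot do.\<close>

lemma sum_step_vec_weight:
  assumes p: "p \<in> step_pairs N" and g: "step_coeff N l mu p \<nu> m \<noteq> 0"
  shows "int \<nu> \<le> (\<Sum>i=1..N. int i * step_vec p \<nu> i)"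
proof -
  have "(\<Sum>i=1..N. int i * step_vec p \<nu> i) = int (fst p) + int \<nu> * (int (snd p) - int (fst p))"
    using sum_shift_vec_weighted[of "{1..N}" int "fst p" "snd p" \<nu>] p by (auto simp: step_pairs_def algebra_simps)
  moreover have "\<nu> = 0 \<or> fst p < snd p"
    using g p by (auto simp: g_coeff_def step_pairs_def split: if_splits)
  moreover have "int \<nu> * 1 \<le> int \<nu> * (int (snd p) - int (fst p))" if "fst p < snd p"
    using that by (intro mult_left_mono) auto
  ultimately show ?thesis by auto
qed

lemma step_vec_outside: "p \<in> step_pairs N \<Longrightarrow> i \<notin> {1..N} \<Longrightarrow> step_vec p \<nu> i = 0"
  by (auto simp: shift_vec_def step_pairs_def)

lemma shift_sum_Suc: "shift_sum jk \<nu> (Suc s) i = shift_sum jk \<nu> s i + step_vec (jk (Suc s)) (\<nu> (Suc s)) i"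
  by (simp add: shift_sum_def)

lemma shift_sum_upd: "r \<le> s \<Longrightarrow> shift_sum (jk(Suc s := p)) (\<nu>(Suc s := v)) r = shift_sum jk \<nu> r"
  unfolding shift_sum_def by (intro ext sum.cong) auto

lemma sum_shift_sum: "(\<Sum>i\<in>A. u i * shift_sum jk \<nu> s i) = (\<Sum>r=1..s. \<Sum>i\<in>A. u i * step_vec (jk r) (\<nu> r) i)"
  unfolding shift_sum_def sum_distrib_left by (rule sum.swap)

text \<open>Each step has total 1, non-negative tail sums, and weight at least its \<nu>. Adding up
  the steps from m to n, the number of steps is determined, the tail sums of m stay below those of
  n, and every \<nu> is bounded; all finiteness statements about the coefficients rest on
  this.\<close>

lemma
  assumes jk: "jk \<in> pair_seqs N s" and nz: "alpha_term N l mu n m s jk \<nu> \<noteq> 0"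
  shows alpha_term_degree: "(\<Sum>i=1..N. n i - m i) = int s"
    and alpha_term_tail: "(\<Sum>i=k..N. m i) \<le> (\<Sum>i=k..N. n i)"
    and alpha_term_weight: "r \<in> {1..s} \<Longrightarrow> int (\<nu> r) \<le> (\<Sum>i=1..N. int i * (n i - m i))"
proof -
  have n: "n i - m i = shift_sum jk \<nu> s i" for i
  proof -
    have "(\<lambda>i. m i + shift_sum jk \<nu> s i) = n"
      by (rule ccontr) (use nz in \<open>simp add: alpha_term_def\<close>)
    then show ?thesis by auto
  qed
  have g: "step_coeff N l mu (jk r) (\<nu> r) (\<lambda>i. n i - shift_sum jk \<nu> r i) \<noteq> 0" if "r \<in> {1..s}" for r
    using nz that by (auto simp: alpha_term_def)
  have p: "jk r \<in> step_pairs N" if "r \<in> {1..s}" for r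
    using jk that by (auto simp: pair_seqs_eq)
  have "(\<Sum>i=1..N. n i - m i) = (\<Sum>r=1..s. \<Sum>i=1..N. step_vec (jk r) (\<nu> r) i)"
    using sum_shift_sum[of "\<lambda>_. 1" jk \<nu> s "{1..N}"] by (simp add: n)
  also have "\<dots> = (\<Sum>r=1..s. 1)" by (intro sum.cong refl sum_step_vec_total p)
  also have "\<dots> = int s" by simp
  finally show "(\<Sum>i=1..N. n i - m i) = int s" .
  have "(\<Sum>i=k..N. n i - m i) = (\<Sum>r=1..s. \<Sum>i=k..N. step_vec (jk r) (\<nu> r) i)"
    using sum_shift_sum[of "\<lambda>_. 1" jk \<nu> s "{k..N}"] by (simp add: n)
  also have "\<dots> \<ge> 0" by (intro sum_nonneg sum_step_vec_tail p)
  finally show "(\<Sum>i=k..N. m i) \<le> (\<Sum>i=k..N. n i)" by (simp add: sum_subtractf)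
  show "int (\<nu> r) \<le> (\<Sum>i=1..N. int i * (n i - m i))" if r: "r \<in> {1..s}"
  proof -
    have w: "int (\<nu> q) \<le> (\<Sum>i=1..N. int i * step_vec (jk q) (\<nu> q) i)" if "q \<in> {1..s}" for q
      using sum_step_vec_weight[OF p[OF that] g[OF that]] .
    have "int (\<nu> r) \<le> (\<Sum>i=1..N. int i * step_vec (jk r) (\<nu> r) i)" by (rule w[OF r])
    also have "\<dots> \<le> (\<Sum>q=1..s. \<Sum>i=1..N. int i * step_vec (jk q) (\<nu> q) i)"
      by (rule member_le_sum[OF r]) (use w in \<open>force intro: order_trans[of 0 "int _"]\<close>)+
    also have "\<dots> = (\<Sum>i=1..N. int i * (n i - m i))"
      unfolding n by (rule sum_shift_sum[symmetric])
    finally show ?thesis .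
  qed
qed

lemma alpha_term_bounded:
  assumes "jk \<in> pair_seqs N s" "\<nu> \<in> nat_seqs s" "alpha_term N l mu n m s jk \<nu> \<noteq> 0"
    and V: "(\<Sum>i=1..N. int i * (n i - m i)) \<le> int V"
  shows "\<nu> \<in> {1..s} \<rightarrow>\<^sub>E {..V}"
proof -
  have "\<nu> r \<le> V" if "r \<in> {1..s}" for r
    using alpha_term_weight[OF assms(1,3) that] V by linarith
  then show ?thesis using assms(2) by (auto simp: nat_seqs_def PiE_def)
qed

lemma finite_alpha_terms:
  "finite {(s, jk, \<nu>). 1 \<le> s \<and> jk \<in> pair_seqs N s \<and> \<nu> \<in> nat_seqs s \<and> alpha_term N l mu n m s jk \<nu> \<noteq> 0}"
proof -
  define s0 where "s0 = nat (\<Sum>i=1..N. n i - m i)"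
  define V where "V = nat (\<Sum>i=1..N. int i * (n i - m i))"
  have "finite ({s0} \<times> (({1..s0} \<rightarrow>\<^sub>E step_pairs N) \<times> ({1..s0} \<rightarrow>\<^sub>E {..V})))"
    by (intro finite_cartesian_product finite_PiE) auto
  moreover have "{(s, jk, \<nu>). 1 \<le> s \<and> jk \<in> pair_seqs N s \<and> \<nu> \<in> nat_seqs s \<and> alpha_term N l mu n m s jk \<nu> \<noteq> 0}
      \<subseteq> {s0} \<times> (({1..s0} \<rightarrow>\<^sub>E step_pairs N) \<times> ({1..s0} \<rightarrow>\<^sub>E {..V}))"
  proof (rule subsetI, elim CollectE case_prodE conjE, hypsubst)
    fix s jk \<nu> assume *: "jk \<in> pair_seqs N s" "\<nu> \<in> nat_seqs s" "alpha_term N l mu n m s jk \<nu> \<noteq> 0"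
    have "s = s0" using alpha_term_degree[OF *(1,3)] by (simp add: s0_def)
    moreover have "\<nu> \<in> {1..s} \<rightarrow>\<^sub>E {..V}" by (rule alpha_term_bounded[OF *]) (simp add: V_def)
    ultimately show "(s, jk, \<nu>) \<in> {s0} \<times> (({1..s0} \<rightarrow>\<^sub>E step_pairs N) \<times> ({1..s0} \<rightarrow>\<^sub>E {..V}))"
      using *(1) by (auto simp: pair_seqs_eq)
  qed
  ultimately show ?thesis by (rule finite_subset[rotated])
qed

text \<open>Formally the coefficient of f_m in (-4 L)^s f_n, kept without the factor 1 / (4^s
  s!).\<close>

definition alpha_s :: "nat \<Rightarrow> real \<Rightarrow> real \<Rightarrow> (nat \<Rightarrow> int) \<Rightarrow> nat \<Rightarrow> (nat \<Rightarrow> int) \<Rightarrow> real" where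
  "alpha_s N l mu n s m = (\<Sum>jk\<in>pair_seqs N s. \<Sum>\<^sub>\<infinity>\<nu>\<in>nat_seqs s. alpha_term N l mu n m s jk \<nu>)"

lemma alpha_s_finite:
  assumes "(\<Sum>i=1..N. int i * (n i - m i)) \<le> int V"
  shows "alpha_s N l mu n s m = (\<Sum>jk\<in>{1..s} \<rightarrow>\<^sub>E step_pairs N. \<Sum>\<nu>\<in>{1..s} \<rightarrow>\<^sub>E {..V}. alpha_term N l mu n m s jk \<nu>)"
  unfolding alpha_s_def pair_seqs_eq[symmetric]
proof (rule sum.cong[OF refl])
  fix jk assume jk: "jk \<in> pair_seqs N s"
  have "(\<Sum>\<^sub>\<infinity>\<nu>\<in>nat_seqs s. alpha_term N l mu n m s jk \<nu>) = (\<Sum>\<^sub>\<infinity>\<nu>\<in>{1..s} \<rightarrow>\<^sub>E {..V}. alpha_term N l mu n m s jk \<nu>)"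
    by (rule infsum_cong_neutral) (use alpha_term_bounded[OF jk _ _ assms] in \<open>auto simp: nat_seqs_def PiE_def\<close>)
  also have "\<dots> = (\<Sum>\<nu>\<in>{1..s} \<rightarrow>\<^sub>E {..V}. alpha_term N l mu n m s jk \<nu>)"
    by (intro infsum_finite finite_PiE) auto
  finally show "(\<Sum>\<^sub>\<infinity>\<nu>\<in>nat_seqs s. alpha_term N l mu n m s jk \<nu>) = (\<Sum>\<nu>\<in>{1..s} \<rightarrow>\<^sub>E {..V}. alpha_term N l mu n m s jk \<nu>)" .
qed

lemma alpha_s_nonzero:
  assumes "alpha_s N l mu n s m \<noteq> 0"
  shows "(\<Sum>i=1..N. n i - m i) = int s" "(\<Sum>i=k..N. m i) \<le> (\<Sum>i=k..N. n i)"
proof -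
  define V where "V = nat (\<Sum>i=1..N. int i * (n i - m i))"
  have "alpha_s N l mu n s m = (\<Sum>jk\<in>{1..s} \<rightarrow>\<^sub>E step_pairs N. \<Sum>\<nu>\<in>{1..s} \<rightarrow>\<^sub>E {..V}. alpha_term N l mu n m s jk \<nu>)"
    by (rule alpha_s_finite) (simp add: V_def)
  then obtain jk \<nu> where "jk \<in> {1..s} \<rightarrow>\<^sub>E step_pairs N" "alpha_term N l mu n m s jk \<nu> \<noteq> 0"
    using assms by (metis (no_types, lifting) sum.neutral)
  then show "(\<Sum>i=1..N. n i - m i) = int s" "(\<Sum>i=k..N. m i) \<le> (\<Sum>i=k..N. n i)"
    using alpha_term_degree alpha_term_tail unfolding pair_seqs_eq by blast+
qed

lemma alpha_s_0: "alpha_s N l mu n 0 m = of_bool (m = n)"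
  by (simp add: alpha_s_def pair_seqs_def nat_seqs_def alpha_term_def shift_sum_def)

lemma sum_PiE_Suc:
  "(\<Sum>f\<in>{1..Suc s} \<rightarrow>\<^sub>E S. h f) = (\<Sum>f\<in>{1..s} \<rightarrow>\<^sub>E S. \<Sum>y\<in>S. h (f(Suc s := y)))"
proof -
  have "(\<Sum>f\<in>{1..Suc s} \<rightarrow>\<^sub>E S. h f) = (\<Sum>f\<in>(\<lambda>(y, g). g(Suc s := y)) ` (S \<times> ({1..s} \<rightarrow>\<^sub>E S)). h f)"
    by (simp add: atLeastAtMostSuc_conv PiE_insert_eq)
  also have "\<dots> = (\<Sum>(y, f)\<in>S \<times> ({1..s} \<rightarrow>\<^sub>E S). h (f(Suc s := y)))"
    by (subst sum.reindex, rule inj_combinator) (simp_all add: case_prod_unfold)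
  also have "\<dots> = (\<Sum>y\<in>S. \<Sum>f\<in>{1..s} \<rightarrow>\<^sub>E S. h (f(Suc s := y)))"
    by (rule sum.cartesian_product[symmetric])
  also have "\<dots> = (\<Sum>f\<in>{1..s} \<rightarrow>\<^sub>E S. \<Sum>y\<in>S. h (f(Suc s := y)))"
    by (rule sum.swap)
  finally show ?thesis .
qed

text \<open>The last step is peeled off. Its coefficient is evaluated at n minus the total shift,
  which the Kronecker delta identifies with m.\<close>

lemma alpha_term_Suc:
  "alpha_term N l mu n m (Suc s) (jk(Suc s := p)) (\<nu>(Suc s := v)) =
    step_coeff N l mu p v m * alpha_term N l mu n (\<lambda>i. m i + step_vec p v i) s jk \<nu>"
proof (cases "(\<lambda>i. m i + shift_sum (jk(Suc s := p)) (\<nu>(Suc s := v)) (Suc s) i) = n")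
  case True
  have e: "shift_sum (jk(Suc s := p)) (\<nu>(Suc s := v)) (Suc s) i = shift_sum jk \<nu> s i + step_vec p v i" for i
    by (simp add: shift_sum_Suc shift_sum_upd)
  have n: "n = (\<lambda>i. m i + step_vec p v i + shift_sum jk \<nu> s i)"
    using True by (auto simp: e fun_eq_iff algebra_simps)
  have m: "(\<lambda>i. n i - shift_sum (jk(Suc s := p)) (\<nu>(Suc s := v)) (Suc s) i) = m"
    unfolding e n by auto
  have "(\<Prod>r=1..s. step_coeff N l mu ((jk(Suc s := p)) r) ((\<nu>(Suc s := v)) r) (\<lambda>i. n i - shift_sum (jk(Suc s := p)) (\<nu>(Suc s := v)) r i))
     = (\<Prod>r=1..s. step_coeff N l mu (jk r) (\<nu> r) (\<lambda>i. n i - shift_sum jk \<nu> r i))"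
    by (intro prod.cong refl) (simp add: shift_sum_upd)
  then show ?thesis
    unfolding alpha_term_def using True m n[symmetric] by (simp add: prod.nat_ivl_Suc')
next
  case False
  then have "(\<lambda>i. m i + step_vec p v i + shift_sum jk \<nu> s i) \<noteq> n"
    by (auto simp: shift_sum_Suc shift_sum_upd fun_eq_iff algebra_simps)
  then show ?thesis unfolding alpha_term_def using False by simp
qed

lemma alpha_s_Suc:
  assumes V: "(\<Sum>i=1..N. int i * (n i - m i)) \<le> int V"
  shows "alpha_s N l mu n (Suc s) m = (\<Sum>p\<in>step_pairs N. \<Sum>v\<le>V. step_coeff N l mu p v m * alpha_s N l mu n s (\<lambda>i. m i + step_vec p v i))"
proof -
  have "alpha_s N l mu n (Suc s) m = (\<Sum>jk\<in>{1..s} \<rightarrow>\<^sub>E step_pairs N. \<Sum>p\<in>step_pairs N. \<Sum>\<nu>\<in>{1..s} \<rightarrow>\<^sub>E {..V}. \<Sum>v\<le>V.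
       step_coeff N l mu p v m * alpha_term N l mu n (\<lambda>i. m i + step_vec p v i) s jk \<nu>)"
    unfolding alpha_s_finite[OF V] sum_PiE_Suc alpha_term_Suc ..
  also have "\<dots> = (\<Sum>p\<in>step_pairs N. \<Sum>jk\<in>{1..s} \<rightarrow>\<^sub>E step_pairs N. \<Sum>v\<le>V. \<Sum>\<nu>\<in>{1..s} \<rightarrow>\<^sub>E {..V}.
       step_coeff N l mu p v m * alpha_term N l mu n (\<lambda>i. m i + step_vec p v i) s jk \<nu>)"
    by (subst sum.swap) (intro sum.cong refl sum.swap)
  also have "\<dots> = (\<Sum>p\<in>step_pairs N. \<Sum>v\<le>V. \<Sum>jk\<in>{1..s} \<rightarrow>\<^sub>E step_pairs N. \<Sum>\<nu>\<in>{1..s} \<rightarrow>\<^sub>E {..V}.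
       step_coeff N l mu p v m * alpha_term N l mu n (\<lambda>i. m i + step_vec p v i) s jk \<nu>)"
    by (rule sum.cong[OF refl], rule sum.swap)
  also have "\<dots> = (\<Sum>p\<in>step_pairs N. \<Sum>v\<le>V. step_coeff N l mu p v m * alpha_s N l mu n s (\<lambda>i. m i + step_vec p v i))"
  proof (intro sum.cong refl)
    fix p v assume p: "p \<in> step_pairs N"
    show "(\<Sum>jk\<in>{1..s} \<rightarrow>\<^sub>E step_pairs N. \<Sum>\<nu>\<in>{1..s} \<rightarrow>\<^sub>E {..V}. step_coeff N l mu p v m * alpha_term N l mu n (\<lambda>i. m i + step_vec p v i) s jk \<nu>)
        = step_coeff N l mu p v m * alpha_s N l mu n s (\<lambda>i. m i + step_vec p v i)"
    proof (cases "step_coeff N l mu p v m = 0")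
      case False
      \<comment> \<open>The same bound \<open>V\<close> serves the shorter sequences: a step with
        non-zero coefficient has non-negative weight, so passing from m to m plus the step does not
        increase the weighted difference.\<close>
      have "(\<Sum>i=1..N. int i * (n i - (m i + step_vec p v i))) = (\<Sum>i=1..N. int i * (n i - m i)) - (\<Sum>i=1..N. int i * step_vec p v i)"
        by (simp add: algebra_simps sum.distrib sum_subtractf)
      also have "\<dots> \<le> int V" using V sum_step_vec_weight[OF p False] by linarith
      finally show ?thesis
        by (simp add: alpha_s_finite sum_distrib_left)
    qed simp
  qed
  finally show ?thesis .
qed

text \<open>Every step has total 1, so only the level s equal to the drop \<open>d\<close> in total
  degree can contribute. The separate Kronecker delta is level 0.\<close>

lemma alpha_eq:
  assumes "n \<in> int_vecs N" "m \<in> int_vecs N"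
  defines "d \<equiv> \<Sum>i=1..N. n i - m i"
  shows "alpha N l mu n m = (if d < 0 then 0 else alpha_s N l mu n (nat d) m / (4 ^ nat d * fact (nat d)))"
proof -
  have s: "alpha_s N l mu n s m = 0" if "int s \<noteq> d" for s
    using alpha_s_nonzero(1)[of N l mu n s m] that unfolding d_def by force
  have a: "alpha N l mu n m = of_bool (m = n) + (\<Sum>\<^sub>\<infinity>s\<in>{1..}. 1 / (4 ^ s * fact s) * alpha_s N l mu n s m)"
    by (simp add: alpha_def alpha_s_def)
  show ?thesis
  proof (cases "d \<le> 0")
    case True
    have "(\<Sum>\<^sub>\<infinity>s\<in>{1..}. 1 / (4 ^ s * fact s) * alpha_s N l mu n s m) = (\<Sum>\<^sub>\<infinity>s\<in>{1::nat..}. (0::real))"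
      using True by (intro infsum_cong) (auto simp: s)
    moreover have "m \<noteq> n" if "d < 0" using that by (auto simp: d_def)
    ultimately show ?thesis using True by (auto simp: a alpha_s_0)
  next
    case False
    have "(\<Sum>\<^sub>\<infinity>s\<in>{1..}. 1 / (4 ^ s * fact s) * alpha_s N l mu n s m) = (\<Sum>\<^sub>\<infinity>s\<in>{nat d}. 1 / (4 ^ s * fact s) * alpha_s N l mu n s m)"
      using False by (intro infsum_cong_neutral) (auto simp: s)
    moreover have "m \<noteq> n" using False by (auto simp: d_def)
    ultimately show ?thesis using False by (simp add: a)
  qed
qed

lemma alpha_tail:
  assumes "n \<in> int_vecs N" "m \<in> int_vecs N" "alpha N l mu n m \<noteq> 0"
  shows "(\<Sum>i=k..N. m i) \<le> (\<Sum>i=k..N. n i)"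
  using assms alpha_s_nonzero(2) by (auto simp: alpha_eq split: if_splits)

lemma int_vecs_add_step_vec: "m \<in> int_vecs N \<Longrightarrow> p \<in> step_pairs N \<Longrightarrow> (\<lambda>i. m i + step_vec p v i) \<in> int_vecs N"
  and int_vecs_diff_step_vec: "m \<in> int_vecs N \<Longrightarrow> p \<in> step_pairs N \<Longrightarrow> (\<lambda>i. m i - step_vec p v i) \<in> int_vecs N"
  using step_vec_outside by (auto simp: int_vecs_def)

text \<open>The coefficient form of the action of -4 L on exp(-L) f_n: the level rises from d - 1 to
  d, and the prefactor 1 / (4^s s!) changes by 4 d.\<close>

lemma alpha_recursion:
  assumes n: "n \<in> int_vecs N" and m: "m \<in> int_vecs N"
    and V: "(\<Sum>i=1..N. int i * (n i - m i)) \<le> int V"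
  shows "(\<Sum>p\<in>step_pairs N. \<Sum>v\<le>V. step_coeff N l mu p v m * alpha N l mu n (\<lambda>i. m i + step_vec p v i)) =
     4 * of_int (\<Sum>i=1..N. n i - m i) * alpha N l mu n m"
proof -
  define d where "d = (\<Sum>i=1..N. n i - m i)"
  have d1: "(\<Sum>i=1..N. n i - (m i + step_vec p v i)) = d - 1" if "p \<in> step_pairs N" for p v
  proof -
    have "(\<Sum>i=1..N. n i - (m i + step_vec p v i)) = d - (\<Sum>i=1..N. step_vec p v i)"
      by (simp add: d_def sum_subtractf sum.distrib)
    then show ?thesis using sum_step_vec_total[OF that, of v] by simp
  qed
  have e: "alpha N l mu n (\<lambda>i. m i + step_vec p v i) = (if d - 1 < 0 then 0 else
      alpha_s N l mu n (nat (d - 1)) (\<lambda>i. m i + step_vec p v i) / (4 ^ nat (d - 1) * fact (nat (d - 1))))" if "p \<in> step_pairs N" for p v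
    unfolding alpha_eq[OF n int_vecs_add_step_vec[OF m that]] d1[OF that] ..
  show ?thesis
  proof (cases "d \<le> 0")
    case True
    then have "(\<Sum>p\<in>step_pairs N. \<Sum>v\<le>V. step_coeff N l mu p v m * alpha N l mu n (\<lambda>i. m i + step_vec p v i)) = 0"
      by (intro sum.neutral ballI) (simp add: e)
    moreover have "d = 0 \<or> alpha N l mu n m = 0"
      using True unfolding alpha_eq[OF n m, of l mu] d_def[symmetric] by auto
    ultimately show ?thesis unfolding d_def[symmetric] by auto
  next
    case False
    then obtain t where t: "d = int (Suc t)" by (metis Suc_pred linorder_not_le nat_0_less_mult_iff pos_int_cases)
    have "(\<Sum>p\<in>step_pairs N. \<Sum>v\<le>V. step_coeff N l mu p v m * alpha N l mu n (\<lambda>i. m i + step_vec p v i)) =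
      (\<Sum>p\<in>step_pairs N. \<Sum>v\<le>V. step_coeff N l mu p v m * alpha_s N l mu n t (\<lambda>i. m i + step_vec p v i)) / (4 ^ t * fact t)"
      unfolding sum_divide_distrib by (intro sum.cong refl) (simp add: e t)
    also have "\<dots> = alpha_s N l mu n (Suc t) m / (4 ^ t * fact t)"
      unfolding alpha_s_Suc[OF V] ..
    also have "\<dots> = 4 * of_int d * alpha N l mu n m"
      unfolding alpha_eq[OF n m] d_def[symmetric] t nat_int power_Suc fact_Suc of_int_of_nat_eq
      by (simp add: field_simps del: of_nat_Suc)
    finally show ?thesis by (simp add: d_def)
  qed
qed

subsection \<open>The eigenvalue equation for the symmetric polynomials\<close>

text \<open>Outside of this finite set, \<open>\<alpha>\<^sub>n(m)\<close> vanishes (some tail sum of \<open>m\<close> exceeds that of \<open>n\<close>) or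
  \<open>f\<^sub>m\<close> does (some tail sum of \<open>m\<close> is negative).\<close>

definition support_box :: "nat \<Rightarrow> (nat \<Rightarrow> int) \<Rightarrow> (nat \<Rightarrow> int) set" where
  "support_box N n = {m \<in> int_vecs N. \<forall>l\<in>{1..N}. 0 \<le> (\<Sum>i=l..N. m i) \<and> (\<Sum>i=l..N. m i) \<le> (\<Sum>i=l..N. n i)}"

lemma finite_support_box [simp]: "finite (support_box N n)"
proof -
  \<comment> \<open>The range includes \<open>Suc N\<close>, whose tail is empty, so that each
    coordinate is a difference of two bounded tail sums.\<close>
  define B where "B = (\<Sum>l=1..Suc N. \<bar>\<Sum>i=l..N. n i\<bar>)"
  have B: "\<bar>\<Sum>i=l..N. n i\<bar> \<le> B" if "l \<in> {1..Suc N}" for l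
    unfolding B_def by (rule member_le_sum[OF that, of "\<lambda>l. \<bar>\<Sum>i=l..N. n i\<bar>"]) auto
  have "m k \<in> {- B..B}" if m: "m \<in> support_box N n" and k: "k \<in> {1..N}" for m k
  proof -
    have tail: "0 \<le> (\<Sum>i=l..N. m i) \<and> (\<Sum>i=l..N. m i) \<le> B" if "l \<in> {1..Suc N}" for l
    proof (cases "l = Suc N")
      case True
      then show ?thesis using B[OF that] by auto
    next
      case False
      then have "l \<in> {1..N}" using that by auto
      then show ?thesis using m B[OF that] unfolding support_box_def by force
    qed
    have "(\<Sum>i=k..N. m i) = m k + (\<Sum>i=Suc k..N. m i)"
      using k by (simp add: sum.atLeast_Suc_atMost)
    then show ?thesis using tail[of k] tail[of "Suc k"] k by auto
  qed
  then have "support_box N n \<subseteq> {f. \<forall>x. (x \<in> {1..N} \<longrightarrow> f x \<in> {- B..B}) \<and> (x \<notin> {1..N} \<longrightarrow> f x = 0)}"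
    unfolding support_box_def int_vecs_def by blast
  then show ?thesis
    by (rule finite_subset) (intro finite_set_of_finite_funs, auto)
qed

text \<open>A non-zero coefficient bounds the tail sums of \<open>m\<close> from above by those of
  \<open>n\<close>, a non-zero function bounds the tail sums of \<open>m'\<close> below by 0, and
  \<open>le\<close> transfers each bound to the other vector. The case \<open>m' = m\<close>
  describes the support; \<open>m'\<close> equal to \<open>m\<close> minus a step serves the
  re-indexing.\<close>

lemma support_box_memI:
  assumes "n \<in> int_vecs N" "m \<in> int_vecs N" "m' \<in> int_vecs N" "alpha N l mu n m \<noteq> 0" "f_poly l N m' z \<noteq> 0"
    and le: "\<And>l. l \<in> {1..N} \<Longrightarrow> (\<Sum>i=l..N. m' i) \<le> (\<Sum>i=l..N. m i)"
  shows "m \<in> support_box N n" "m' \<in> support_box N n"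
proof -
  have 1: "(\<Sum>i=k..N. m i) \<le> (\<Sum>i=k..N. n i)" if "k \<in> {1..N}" for k
    using alpha_tail assms by blast
  have 2: "0 \<le> (\<Sum>i=k..N. m' i)" if "k \<in> {1..N}" for k
    using f_poly_eq_0[OF that] assms(5) by (meson not_le)
  show "m \<in> support_box N n"
    unfolding support_box_def by (intro CollectI conjI ballI assms(2) 1 order_trans[OF 2 le])
  show "m' \<in> support_box N n"
    unfolding support_box_def by (intro CollectI conjI ballI assms(3) 2 order_trans[OF le 1])
qed

definition P_poly :: "nat \<Rightarrow> real \<Rightarrow> real \<Rightarrow> (nat \<Rightarrow> int) \<Rightarrow> (nat \<Rightarrow> real) \<Rightarrow> real" where
  "P_poly N l mu n z = (\<Sum>m\<in>support_box N n. alpha N l mu n m * f_poly l N m z)"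

lemma polyfun_P_poly: "polyfun {1..N} (P_poly N l mu n)"
  unfolding P_poly_def[abs_def] by (intro polyfun_sum polyfun_mult polyfun_const polyfun_f_poly)

lemma P_fun_eq_P_poly:
  assumes "N \<ge> 1" "\<epsilon> > 0" "n \<in> int_vecs N"
  shows "P_fun N l mu \<epsilon> n x = of_real (P_poly N l mu n (\<lambda>i. (x i)\<^sup>2))"
proof -
  have "P_fun N l mu \<epsilon> n x = (\<Sum>\<^sub>\<infinity>m\<in>int_vecs N. of_real (alpha N l mu n m * f_poly l N m (\<lambda>i. (x i)\<^sup>2)))"
    unfolding P_fun_def by (intro infsum_cong) (simp add: f_fun_eq_f_poly[OF assms(1,2)])
  also have "\<dots> = (\<Sum>\<^sub>\<infinity>m\<in>support_box N n. of_real (alpha N l mu n m * f_poly l N m (\<lambda>i. (x i)\<^sup>2)))"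
  proof (rule infsum_cong_neutral)
    fix m assume m: "m \<in> int_vecs N - support_box N n"
    then have "alpha N l mu n m = 0 \<or> f_poly l N m (\<lambda>i. (x i)\<^sup>2) = 0"
      using support_box_memI(1)[OF assms(3), of m m] by auto
    then show "of_real (alpha N l mu n m * f_poly l N m (\<lambda>i. (x i)\<^sup>2)) = (0::complex)" by auto
  qed (auto simp: support_box_def)
  finally show ?thesis by (simp add: P_poly_def)
qed

subsection \<open>The reduced eigenvalue equation\<close>

lemma step_pairs_eq: "step_pairs N = (\<lambda>k. (k, k)) ` {1..N} \<union> ipairs N"
  by (auto simp: step_pairs_def ipairs_def)

lemma sum_ipairs: "(\<Sum>p\<in>ipairs N. f (fst p) (snd p)) = (\<Sum>k=1..N. \<Sum>l\<in>{k<..N}. f k l)"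
  unfolding ipairs_def by (subst sum.Sigma) (auto simp: case_prod_unfold)

text \<open>The coefficient is taken at the index after the step, which is why the diagonal part
  sees \<open>m_tilde\<close> lowered by 1; writing y for that value plus \<mu> - \<lambda>, its
  factor - 2 (2 y + 1) is - 4 (y + 1/2). Off the diagonal the value \<nu> = 0 drops out and the
  potential terms remain.\<close>

lemma reduced_op_f_poly_steps:
  assumes z: "inj_on z {1..N}"
    and V: "\<And>l. l \<in> {1..N} \<Longrightarrow> (\<Sum>i=l..N. m i) \<le> int V"
  shows "- 4 * reduced_op N l mu (f_poly l N m) z =
    (\<Sum>p\<in>step_pairs N. \<Sum>v\<le>V. step_coeff N l mu p v (\<lambda>i. m i - step_vec p v i) * f_poly l N (\<lambda>i. m i - step_vec p v i) z)"
proof -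
  define T where "T j k v = g_coeff N l mu j k v (\<lambda>i. m i - shift_vec j k v i) * f_poly l N (\<lambda>i. m i - shift_vec j k v i) z" for j k v
  have S: "(\<Sum>v\<le>V. f v) = f 0 + (\<Sum>v=1..V. f v)" for f :: "nat \<Rightarrow> real"
  proof -
    have "{..V} = insert 0 {1..V}" by auto
    then show ?thesis by simp
  qed
  have diag: "(\<Sum>v\<le>V. T k k v) = - 4 * ((m_tilde N l m k - 1) * (m_tilde N l m k - 1 + 1 / 2 + mu - l) * f_poly l N (m(k := m k - 1)) z)" for k
  proof -
    have eqf: "(\<lambda>i. m i - shift_vec k k 0 i) = m(k := m k - 1)"
      by (auto simp: shift_vec_def fun_eq_iff)
    have eqt: "m_tilde N l (m(k := m k - 1)) k = m_tilde N l m k - 1"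
      by (simp add: m_tilde_def)
    have z: "(\<Sum>v=1..V. T k k v) = 0"
      by (intro sum.neutral) (simp add: T_def g_coeff_def)
    have "T k k 0 = - 2 * (2 * (m_tilde N l m k - 1 + mu - l) + 1) * (m_tilde N l m k - 1) * f_poly l N (m(k := m k - 1)) z"
      by (simp only: T_def eqf g_coeff_def eqt) (simp add: algebra_simps)
    then show ?thesis
      unfolding S z by (simp add: algebra_simps)
  qed
  have off: "(\<Sum>v\<le>V. T j k v) = 4 * (l * (l - 1)) * (\<Sum>v=1..V. (2 * real v - 1) * f_poly l N (\<lambda>i. m i - shift_vec j k v i) z)"
    if "k \<in> {j<..N}" for j k
    unfolding S sum_distrib_left using that
    by (auto simp: T_def g_coeff_def intro!: sum.cong)
  have "(\<Sum>p\<in>step_pairs N. \<Sum>v\<le>V. T (fst p) (snd p) v) =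
     (\<Sum>k=1..N. \<Sum>v\<le>V. T k k v) + (\<Sum>p\<in>ipairs N. \<Sum>v\<le>V. T (fst p) (snd p) v)"
    unfolding step_pairs_eq by (subst sum.union_disjoint) (auto simp: ipairs_def sum.reindex inj_on_def)
  also have "(\<Sum>p\<in>ipairs N. \<Sum>v\<le>V. T (fst p) (snd p) v) = (\<Sum>j=1..N. \<Sum>k\<in>{j<..N}. \<Sum>v\<le>V. T j k v)"
    by (rule sum_ipairs)
  also have "\<dots> = (\<Sum>j=1..N. \<Sum>k\<in>{j<..N}. 4 * (l * (l - 1)) * (\<Sum>v=1..V. (2 * real v - 1) * f_poly l N (\<lambda>i. m i - shift_vec j k v i) z))"
    by (intro sum.cong refl off)
  finally have sum: "(\<Sum>p\<in>step_pairs N. \<Sum>v\<le>V. T (fst p) (snd p) v) =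
      - 4 * (\<Sum>k=1..N. (m_tilde N l m k - 1) * (m_tilde N l m k - 1 + 1 / 2 + mu - l) * f_poly l N (m(k := m k - 1)) z) +
      4 * (l * (l - 1)) * (\<Sum>j=1..N. \<Sum>k\<in>{j<..N}. \<Sum>v=1..V. (2 * real v - 1) * f_poly l N (\<lambda>i. m i - shift_vec j k v i) z)"
    unfolding diag sum_distrib_left .
  have "reduced_op N l mu (f_poly l N m) z =
     (\<Sum>k=1..N. (m_tilde N l m k - 1) * (m_tilde N l m k - 1 + 1 / 2 + mu - l) * f_poly l N (m(k := m k - 1)) z)
     - l * (l - 1) * (\<Sum>j=1..N. \<Sum>k\<in>{j<..N}. \<Sum>v=1..V. (2 * real v - 1) * f_poly l N (\<lambda>i. m i - shift_vec j k v i) z)"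
    by (rule reduced_op_f_poly_real[OF z]) (rule V)
  then show ?thesis
    unfolding T_def[symmetric] sum by (simp only:) (simp add: right_diff_distrib)
qed

lemma euler_gen_prod: "(\<Sum>j=1..N. z j * pd j (gen_prod l N m) z) = of_int (\<Sum>k=1..N. m k) * gen_prod l N m z"
proof -
  have "pd j (gen_prod l N m) z = (\<Sum>k=1..N. pd j (gen_coeff l N (m k)) z * (\<Prod>i\<in>{1..N} - {k}. gen_coeff l N (m i) z))" for j
    unfolding gen_prod_def[abs_def] by (rule pd_prod[of _ "{1..N}"]) (simp_all only: finite_atLeastAtMost polyfun_gen_coeff)
  then have "(\<Sum>j=1..N. z j * pd j (gen_prod l N m) z) =
     (\<Sum>j=1..N. \<Sum>k=1..N. z j * pd j (gen_coeff l N (m k)) z * (\<Prod>i\<in>{1..N} - {k}. gen_coeff l N (m i) z))"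
    by (simp only: sum_distrib_left mult.assoc)
  also have "\<dots> = (\<Sum>k=1..N. (\<Sum>j=1..N. z j * pd j (gen_coeff l N (m k)) z) * (\<Prod>i\<in>{1..N} - {k}. gen_coeff l N (m i) z))"
    unfolding sum_distrib_right by (rule sum.swap)
  also have "\<dots> = (\<Sum>k=1..N. of_int (m k) * gen_prod l N m z)"
    unfolding gen_coeff_euler gen_prod_def by (intro sum.cong refl, subst prod.remove[of "{1..N}"]) auto
  finally show ?thesis by (simp add: sum_distrib_right)
qed

text \<open>Every exponent shift has total 0, so all products in \<open>f_poly\<close> are
  homogeneous of the same degree, the sum of \<open>m\<close>.\<close>

lemma euler_f_poly: "(\<Sum>j=1..N. z j * pd j (f_poly l N m) z) = of_int (\<Sum>k=1..N. m k) * f_poly l N m z"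
proof -
  have deg: "(\<Sum>k=1..N. m k + exp_shift N a k) = (\<Sum>k=1..N. m k)" for a
  proof -
    have "(\<Sum>k=1..N. exp_shift N a k) = 0"
      using sum_exp_shift[of "{1..N}" N "\<lambda>_. 1" a] by (simp, intro sum.neutral) (auto simp: ipairs_def)
    then show ?thesis by (simp add: sum.distrib)
  qed
  have "pd j (f_poly l N m) z = (\<Sum>a\<in>admissible N m. (\<Prod>p\<in>ipairs N. bcoeff l (a p)) * pd j (gen_prod l N (\<lambda>k. m k + exp_shift N a k)) z)" for j
    unfolding f_poly_def[abs_def]
    by (subst pd_sum[of _ "{1..N}"], intro polyfun_mult polyfun_const polyfun_gen_prod, intro sum.cong refl pd_cmult[OF polyfun_gen_prod])
  then have "(\<Sum>j=1..N. z j * pd j (f_poly l N m) z) =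
     (\<Sum>j=1..N. \<Sum>a\<in>admissible N m. (\<Prod>p\<in>ipairs N. bcoeff l (a p)) * (z j * pd j (gen_prod l N (\<lambda>k. m k + exp_shift N a k)) z))"
    by (simp only: sum_distrib_left mult_ac)
  also have "\<dots> = (\<Sum>a\<in>admissible N m. (\<Prod>p\<in>ipairs N. bcoeff l (a p)) * (\<Sum>j=1..N. z j * pd j (gen_prod l N (\<lambda>k. m k + exp_shift N a k)) z))"
    unfolding sum_distrib_left by (rule sum.swap)
  also have "\<dots> = of_int (\<Sum>k=1..N. m k) * f_poly l N m z"
    unfolding euler_gen_prod deg f_poly_def sum_distrib_left by (simp only: mult_ac)
  finally show ?thesis .
qed

text \<open>After re-indexing by the steps, \<open>alpha_recursion\<close> shows that -4 L
  multiplies the term of index m by 4 (|n| - |m|), where |m| is the sum of the coordinates. The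
  Euler operator contributes 4 |m|, and the sum 4 |n| no longer depends on m.\<close>

lemma P_poly_eigen:
  assumes n: "n \<in> int_vecs N" and z: "inj_on z {1..N}"
  shows "4 * (\<Sum>j=1..N. z j * pd j (P_poly N l mu n) z) - 4 * reduced_op N l mu (P_poly N l mu n) z = 4 * of_int (\<Sum>k=1..N. n k) * P_poly N l mu n z"
proof -
  define w where "w m = (\<Sum>i=1..N. int i * (n i - m i))" for m
  \<comment> \<open>One cutoff for all m in the box, large enough both for the weighted sums in
    \<open>alpha_recursion\<close> and for the tail sums in the expansion of the potential.\<close>
  define V where "V = (\<Sum>m\<in>support_box N n. nat (w m)) + (\<Sum>l=1..N. nat (\<Sum>i=l..N. n i))"
  have V1: "w m \<le> int V" if "m \<in> support_box N n" for m
  proof -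
    have "nat (w m) \<le> (\<Sum>m\<in>support_box N n. nat (w m))" by (rule member_le_sum[OF that]) auto
    then show ?thesis unfolding V_def by linarith
  qed
  have V2: "(\<Sum>i=l..N. m i) \<le> int V" if "m \<in> support_box N n" "l \<in> {1..N}" for m l
  proof -
    have "(\<Sum>i=l..N. m i) \<le> (\<Sum>i=l..N. n i)" using that by (auto simp: support_box_def)
    moreover have "nat (\<Sum>i=l..N. n i) \<le> (\<Sum>l=1..N. nat (\<Sum>i=l..N. n i))"
      by (rule member_le_sum[OF that(2), of "\<lambda>l. nat (\<Sum>i=l..N. n i)"]) auto
    ultimately show ?thesis unfolding V_def by linarith
  qed
  have "- 4 * reduced_op N l mu (P_poly N l mu n) z = (\<Sum>m\<in>support_box N n. alpha N l mu n m * (- 4 * reduced_op N l mu (f_poly l N m) z))"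
    unfolding P_poly_def[abs_def] by (subst reduced_op_linear[OF polyfun_f_poly]) (simp add: sum_distrib_left mult_ac)
  also have "\<dots> = (\<Sum>m\<in>support_box N n. \<Sum>p\<in>step_pairs N. \<Sum>v\<le>V. alpha N l mu n m * (step_coeff N l mu p v (\<lambda>i. m i - step_vec p v i) * f_poly l N (\<lambda>i. m i - step_vec p v i) z))"
    by (intro sum.cong refl, subst reduced_op_f_poly_steps[OF z V2]) (simp_all only: sum_distrib_left)
  also have "\<dots> = (\<Sum>p\<in>step_pairs N. \<Sum>v\<le>V. \<Sum>m\<in>support_box N n. alpha N l mu n m * (step_coeff N l mu p v (\<lambda>i. m i - step_vec p v i) * f_poly l N (\<lambda>i. m i - step_vec p v i) z))"
    by (rule trans[OF sum.swap], rule sum.cong[OF refl], rule sum.swap)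
  also have "\<dots> = (\<Sum>p\<in>step_pairs N. \<Sum>v\<le>V. \<Sum>m\<in>support_box N n. alpha N l mu n (\<lambda>i. m i + step_vec p v i) * (step_coeff N l mu p v m * f_poly l N m z))"
  proof (rule sum.cong[OF refl], rule sum.cong[OF refl])
    fix p v assume p: "p \<in> step_pairs N"
    define D where "D m = (\<lambda>i. m i - step_vec p v i)" for m
    define U where "U m = (\<lambda>i. m i + step_vec p v i)" for m
    have DU: "D (U m) = m" "U (D m) = m" for m by (auto simp: D_def U_def)
    have tail: "(\<Sum>i=l..N. D m i) \<le> (\<Sum>i=l..N. m i)" for m l
      using sum_step_vec_tail[OF p, where l = l and \<nu> = v] by (simp add: D_def sum_subtractf)
    have iv: "D m \<in> int_vecs N" "U m \<in> int_vecs N" if "m \<in> int_vecs N" for m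
      using int_vecs_add_step_vec[OF that p] int_vecs_diff_step_vec[OF that p] by (simp_all add: D_def U_def)
    have MI: "m \<in> int_vecs N" if "m \<in> support_box N n" for m using that by (simp add: support_box_def)
    show "(\<Sum>m\<in>support_box N n. alpha N l mu n m * (step_coeff N l mu p v (\<lambda>i. m i - step_vec p v i) * f_poly l N (\<lambda>i. m i - step_vec p v i) z)) =
        (\<Sum>m\<in>support_box N n. alpha N l mu n (\<lambda>i. m i + step_vec p v i) * (step_coeff N l mu p v m * f_poly l N m z))"
      unfolding D_def[symmetric] U_def[symmetric]
    \<comment> \<open>Subtracting a step does not map the box to itself; it is a bijection only
      between the non-zero terms, for which \<open>support_box_memI\<close> keeps both indices in
      the box.\<close>
    proof (rule sum.reindex_bij_witness_not_neutral[where i = U and j = D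
          and S' = "{m\<in>support_box N n. alpha N l mu n m * (step_coeff N l mu p v (D m) * f_poly l N (D m) z) = 0}"
          and T' = "{m\<in>support_box N n. alpha N l mu n (U m) * (step_coeff N l mu p v m * f_poly l N m z) = 0}"])
      show "D m \<in> support_box N n - {m\<in>support_box N n. alpha N l mu n (U m) * (step_coeff N l mu p v m * f_poly l N m z) = 0}"
        if "m \<in> support_box N n - {m\<in>support_box N n. alpha N l mu n m * (step_coeff N l mu p v (D m) * f_poly l N (D m) z) = 0}" for m
        using that support_box_memI(2)[OF n MI iv(1)[OF MI], of m m l mu z] tail DU by auto
      show "U m \<in> support_box N n - {m\<in>support_box N n. alpha N l mu n m * (step_coeff N l mu p v (D m) * f_poly l N (D m) z) = 0}"
        if "m \<in> support_box N n - {m\<in>support_box N n. alpha N l mu n (U m) * (step_coeff N l mu p v m * f_poly l N m z) = 0}" for m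
        using that support_box_memI(1)[OF n iv(2)[OF MI] MI, of m m l mu z] tail[where m = "U m"] DU by auto
    qed (auto simp: DU)
  qed
  also have "\<dots> = (\<Sum>m\<in>support_box N n. (\<Sum>p\<in>step_pairs N. \<Sum>v\<le>V. step_coeff N l mu p v m * alpha N l mu n (\<lambda>i. m i + step_vec p v i)) * f_poly l N m z)"
    unfolding sum_distrib_right
    by (rule sym, rule trans[OF sum.swap], rule sum.cong[OF refl], rule trans[OF sum.swap]) (simp only: mult_ac)
  also have "\<dots> = (\<Sum>m\<in>support_box N n. 4 * of_int (\<Sum>i=1..N. n i - m i) * alpha N l mu n m * f_poly l N m z)"
  proof (rule sum.cong[OF refl])
    fix m assume m: "m \<in> support_box N n"
    then have "m \<in> int_vecs N" by (simp add: support_box_def)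
    from alpha_recursion[OF n this V1[OF m, unfolded w_def], of l mu]
    show "(\<Sum>p\<in>step_pairs N. \<Sum>v\<le>V. step_coeff N l mu p v m * alpha N l mu n (\<lambda>i. m i + step_vec p v i)) * f_poly l N m z =
        4 * of_int (\<Sum>i=1..N. n i - m i) * alpha N l mu n m * f_poly l N m z"
      by (simp only:)
  qed
  finally have L: "- 4 * reduced_op N l mu (P_poly N l mu n) z = (\<Sum>m\<in>support_box N n. 4 * of_int (\<Sum>i=1..N. n i - m i) * alpha N l mu n m * f_poly l N m z)" .
  have "pd j (P_poly N l mu n) z = (\<Sum>m\<in>support_box N n. alpha N l mu n m * pd j (f_poly l N m) z)" for j
    unfolding P_poly_def[abs_def]
    by (subst pd_sum[of _ "{1..N}"], intro polyfun_mult polyfun_const polyfun_f_poly, intro sum.cong refl pd_cmult[OF polyfun_f_poly])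
  then have "(\<Sum>j=1..N. z j * pd j (P_poly N l mu n) z) = (\<Sum>j=1..N. \<Sum>m\<in>support_box N n. alpha N l mu n m * (z j * pd j (f_poly l N m) z))"
    by (simp only: sum_distrib_left mult_ac)
  also have "\<dots> = (\<Sum>m\<in>support_box N n. alpha N l mu n m * (\<Sum>j=1..N. z j * pd j (f_poly l N m) z))"
    unfolding sum_distrib_left by (rule sum.swap)
  finally have E: "(\<Sum>j=1..N. z j * pd j (P_poly N l mu n) z) = (\<Sum>m\<in>support_box N n. alpha N l mu n m * (of_int (\<Sum>k=1..N. m k) * f_poly l N m z))"
    unfolding euler_f_poly .
  have "4 * (\<Sum>j=1..N. z j * pd j (P_poly N l mu n) z) - 4 * reduced_op N l mu (P_poly N l mu n) z =
     (\<Sum>m\<in>support_box N n. 4 * (alpha N l mu n m * (of_int (\<Sum>k=1..N. m k) * f_poly l N m z)) + 4 * of_int (\<Sum>i=1..N. n i - m i) * alpha N l mu n m * f_poly l N m z)"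
    using L unfolding E sum.distrib sum_distrib_left by simp
  also have "\<dots> = (\<Sum>m\<in>support_box N n. 4 * of_int (\<Sum>k=1..N. n k) * (alpha N l mu n m * f_poly l N m z))"
    by (intro sum.cong refl) (simp add: sum_subtractf algebra_simps)
  finally show ?thesis unfolding P_poly_def sum_distrib_left .
qed

subsection \<open>Symmetric polynomials\<close>

definition monom_eval :: "(nat \<Rightarrow> real) \<Rightarrow> (nat \<Rightarrow>\<^sub>0 nat) \<Rightarrow> complex" where
  "monom_eval x e = (\<Prod>i\<in>Poly_Mapping.keys e. of_real (x i) ^ Poly_Mapping.lookup e i)"

lemma poly_eval_eq_lin_ext: "poly_eval p x = lin_ext (monom_eval x) p"
  by (simp add: poly_eval_def lin_ext_def monom_eval_def)

lemma monom_eval_add: "monom_eval x (e + e') = monom_eval x e * monom_eval x e'"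
proof -
  let ?A = "Poly_Mapping.keys e \<union> Poly_Mapping.keys e'"
  have *: "monom_eval x f = (\<Prod>i\<in>?A. of_real (x i) ^ Poly_Mapping.lookup f i)" if "Poly_Mapping.keys f \<subseteq> ?A" for f
    unfolding monom_eval_def by (rule prod.mono_neutral_left) (use that in \<open>auto simp: in_keys_iff\<close>)
  show ?thesis
    using Poly_Mapping.keys_add[of e e'] by (simp add: * lookup_add power_add prod.distrib)
qed

lemma poly_eval_add: "poly_eval (p + q) x = poly_eval p x + poly_eval q x"
  by (simp add: poly_eval_eq_lin_ext lin_ext_add)

lemma poly_eval_mult: "poly_eval (p * q) x = poly_eval p x * poly_eval q x"
  unfolding poly_eval_eq_lin_ext
proof (induction p rule: poly_mapping_additive_induct)
  case (single e c)
  show ?case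
  proof (induction q rule: poly_mapping_additive_induct)
    case (single e' c')
    show ?case by (simp add: mult_single lin_ext_single monom_eval_add)
  next
    case (add p q)
    then show ?case by (simp add: distrib_left lin_ext_add)
  qed
next
  case (add p q)
  then show ?case by (simp add: distrib_right lin_ext_add)
qed

text \<open>The variables of \<open>f\<close> are the squares of the x_i, so variable i is
  represented by the monomial with exponent 2 at i.\<close>

lemma polyfun_poly_eval:
  "polyfun V f \<Longrightarrow> \<exists>p. (\<forall>e\<in>Poly_Mapping.keys p. Poly_Mapping.keys e \<subseteq> V) \<and>
     (\<forall>x. of_real (f (\<lambda>i. (x i)\<^sup>2)) = poly_eval p x)"
proof (induction rule: polyfun.induct)
  case (polyfun_const c)
  show ?case
    by (rule exI[of _ "Poly_Mapping.single 0 (of_real c)"]) (simp add: poly_eval_eq_lin_ext lin_ext_single monom_eval_def)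
next
  case (polyfun_var i)
  then show ?case
    by (intro exI[of _ "Poly_Mapping.single (Poly_Mapping.single i 2) 1"])
      (simp add: poly_eval_eq_lin_ext lin_ext_single monom_eval_def)
next
  case (polyfun_add f g)
  then obtain p q where p: "\<forall>e\<in>Poly_Mapping.keys p. Poly_Mapping.keys e \<subseteq> V" "\<forall>x. of_real (f (\<lambda>i. (x i)\<^sup>2)) = poly_eval p x"
    and q: "\<forall>e\<in>Poly_Mapping.keys q. Poly_Mapping.keys e \<subseteq> V" "\<forall>x. of_real (g (\<lambda>i. (x i)\<^sup>2)) = poly_eval q x"
    by blast
  have "\<forall>e\<in>Poly_Mapping.keys (p + q). Poly_Mapping.keys e \<subseteq> V"
    using p(1) q(1) Poly_Mapping.keys_add[of p q] by blast
  then show ?case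
    using p(2) q(2) by (intro exI[of _ "p + q"]) (simp add: poly_eval_add)
next
  case (polyfun_mult f g)
  then obtain p q where p: "\<forall>e\<in>Poly_Mapping.keys p. Poly_Mapping.keys e \<subseteq> V" "\<forall>x. of_real (f (\<lambda>i. (x i)\<^sup>2)) = poly_eval p x"
    and q: "\<forall>e\<in>Poly_Mapping.keys q. Poly_Mapping.keys e \<subseteq> V" "\<forall>x. of_real (g (\<lambda>i. (x i)\<^sup>2)) = poly_eval q x"
    by blast
  have "Poly_Mapping.keys e \<subseteq> V" if e: "e \<in> Poly_Mapping.keys (p * q)" for e
  proof -
    obtain a b where "e = a + b" "a \<in> Poly_Mapping.keys p" "b \<in> Poly_Mapping.keys q"
      using e keys_mult[of p q] by blast
    then show ?thesis using p(1) q(1) Poly_Mapping.keys_add[of a b] by blast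
  qed
  then show ?case
    using p(2) q(2) by (intro exI[of _ "p * q"]) (simp add: poly_eval_mult)
qed

lemma gen_coeff_permute:
  assumes "\<pi> permutes {1..N}"
  shows "gen_coeff l N m (\<lambda>i. z (\<pi> i)) = gen_coeff l N m z"
  unfolding gen_coeff_def gen_series_def using prod.permute[OF assms, of "\<lambda>j. gen_factor l (z j)"] by (simp add: o_def)

lemma P_poly_permute: "\<pi> permutes {1..N} \<Longrightarrow> P_poly N l mu n (\<lambda>i. z (\<pi> i)) = P_poly N l mu n z"
  by (simp only: P_poly_def f_poly_def gen_prod_def gen_coeff_permute)

subsection \<open>The ground state\<close>

text \<open>The derivative of ln \<open>psi0\<close> with respect to x_j on the chamber.\<close>

definition logderiv :: "nat \<Rightarrow> real \<Rightarrow> real \<Rightarrow> nat \<Rightarrow> (nat \<Rightarrow> real) \<Rightarrow> real" where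
  "logderiv N l mu j x = - x j + mu / x j + 2 * l * (\<Sum>k\<in>{1..N} - {j}. x j / ((x j)\<^sup>2 - (x k)\<^sup>2))"

lemma chamber_pos: "x \<in> chamber N \<Longrightarrow> j \<in> {1..N} \<Longrightarrow> 0 < x j"
  by (simp add: chamber_def)

lemma chamber_less_sq:
  assumes "x \<in> chamber N" "j \<in> {1..N}" "k \<in> {j<..N}"
  shows "(x j)\<^sup>2 < (x k)\<^sup>2"
proof -
  have "x j < x k" using assms by (simp add: chamber_def)
  then show ?thesis
    using less_imp_le[OF chamber_pos[OF assms(1,2)]] by (intro power_strict_mono) auto
qed

lemma chamber_inj: "x \<in> chamber N \<Longrightarrow> inj_on (\<lambda>i. (x i)\<^sup>2) {1..N}"
proof (rule inj_onI)
  fix i j assume x: "x \<in> chamber N" and ij: "i \<in> {1..N}" "j \<in> {1..N}" "(x i)\<^sup>2 = (x j)\<^sup>2"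
  then show "i = j"
    using chamber_less_sq[OF x, of i j] chamber_less_sq[OF x, of j i] by (cases i j rule: linorder_cases) auto
qed

lemma psi0_eq_exp:
  assumes x: "x \<in> chamber N"
  shows "psi0 N l mu x = exp ((\<Sum>j=1..N. - (x j)\<^sup>2 / 2 + mu * ln (x j)) + (\<Sum>j=1..N. \<Sum>k\<in>{j<..N}. l * ln ((x k)\<^sup>2 - (x j)\<^sup>2)))"
proof -
  have 1: "exp (- (x j)\<^sup>2 / 2) * x j powr mu = exp (- (x j)\<^sup>2 / 2 + mu * ln (x j))" if "j \<in> {1..N}" for j
    unfolding exp_add using chamber_pos[OF x that] by (simp add: powr_def)
  have 2: "((x k)\<^sup>2 - (x j)\<^sup>2) powr l = exp (l * ln ((x k)\<^sup>2 - (x j)\<^sup>2))" if "j \<in> {1..N}" "k \<in> {j<..N}" for j k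
    using chamber_less_sq[OF x that] by (simp add: powr_def)
  have 3: "exp ((\<Sum>j=1..N. - (x j)\<^sup>2 / 2 + mu * ln (x j)) + (\<Sum>j=1..N. \<Sum>k\<in>{j<..N}. l * ln ((x k)\<^sup>2 - (x j)\<^sup>2))) =
      (\<Prod>j=1..N. exp (- (x j)\<^sup>2 / 2 + mu * ln (x j))) * (\<Prod>j=1..N. \<Prod>k\<in>{j<..N}. exp (l * ln ((x k)\<^sup>2 - (x j)\<^sup>2)))"
    by (subst exp_add) (simp only: exp_sum finite_atLeastAtMost finite_greaterThanAtMost)
  show ?thesis
    unfolding psi0_def 3 by (intro arg_cong2[of _ _ _ _ "(*)"] prod.cong refl 1 2)
qed

text \<open>The logarithmic form of \<open>psi0\<close> is valid on the chamber only, so the line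
  must stay in the chamber near \<open>t\<close> before it can be differentiated.\<close>

lemma psi0_has_derivative:
  assumes j: "j \<in> {1..N}" and y: "x(j := t) \<in> chamber N"
    and ev: "\<forall>\<^sub>F s in nhds t. x(j := s) \<in> chamber N"
  shows "((\<lambda>s. psi0 N l mu (x(j := s))) has_real_derivative psi0 N l mu (x(j := t)) * logderiv N l mu j (x(j := t))) (at t)"
proof -
  define y where "y = x(j := t)"
  define S where "S x = (\<Sum>j=1..N. - (x j)\<^sup>2 / 2 + mu * ln (x j)) + (\<Sum>j=1..N. \<Sum>k\<in>{j<..N}. l * ln ((x k)\<^sup>2 - (x j)\<^sup>2))" for x :: "nat \<Rightarrow> real"
  have yc: "y \<in> chamber N" using y by (simp add: y_def)
  let ?d = "\<lambda>i k. (of_bool (k = j) * (2 * t) - of_bool (i = j) * (2 * t)) / ((y k)\<^sup>2 - (y i)\<^sup>2)"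
  have d1: "((\<lambda>s. - ((x(j := s)) i)\<^sup>2 / 2 + mu * ln ((x(j := s)) i)) has_real_derivative of_bool (i = j) * (- t + mu / t)) (at t)"
    if "i \<in> {1..N}" for i
  proof (cases "i = j")
    case True
    have "t > 0" using chamber_pos[OF yc j] by (simp add: y_def)
    then show ?thesis using True by (auto intro!: derivative_eq_intros)
  qed simp
  have d2: "((\<lambda>s. l * ln (((x(j := s)) k)\<^sup>2 - ((x(j := s)) i)\<^sup>2)) has_real_derivative
       l * ?d i k) (at t)"
    if "i \<in> {1..N}" "k \<in> {i<..N}" for i k
  proof -
    have pos: "((x(j := t)) k)\<^sup>2 - ((x(j := t)) i)\<^sup>2 > 0"
      using chamber_less_sq[OF yc that] by (simp add: y_def)
    have "((\<lambda>s. ((x(j := s)) k)\<^sup>2 - ((x(j := s)) i)\<^sup>2) has_real_derivative of_bool (k = j) * (2 * t) - of_bool (i = j) * (2 * t)) (at t)"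
    proof -
      have "((\<lambda>s. ((x(j := s)) a)\<^sup>2) has_real_derivative of_bool (a = j) * (2 * t)) (at t)" for a
        by (cases "a = j") (auto intro!: derivative_eq_intros)
      then show ?thesis by (intro DERIV_diff)
    qed
    from DERIV_cmult[OF DERIV_chain2[OF DERIV_ln[OF pos] this], of l]
    show ?thesis by (simp add: y_def divide_inverse mult_ac)
  qed
  have "((\<lambda>s. S (x(j := s))) has_real_derivative
      (\<Sum>i=1..N. of_bool (i = j) * (- t + mu / t)) +
      (\<Sum>i=1..N. \<Sum>k\<in>{i<..N}. l * ?d i k)) (at t)"
    unfolding S_def by (intro DERIV_add DERIV_sum d1 d2)
  also have "(\<Sum>i=1..N. of_bool (i = j) * (- t + mu / t)) = - t + mu / t"
    using j by (simp add: of_bool_def if_distrib[of "\<lambda>x. x * _"] cong: if_cong)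
  also have "(\<Sum>i=1..N. \<Sum>k\<in>{i<..N}. l * ?d i k)
     = (\<Sum>i=1..N. \<Sum>k\<in>{i<..N}. of_bool (i = j) * (2 * l * (t / ((y i)\<^sup>2 - (y k)\<^sup>2))) + of_bool (k = j) * (2 * l * (t / ((y k)\<^sup>2 - (y i)\<^sup>2))))"
  proof (intro sum.cong refl)
    fix i k
    have inv: "inverse ((y i)\<^sup>2 - (y k)\<^sup>2) = - inverse ((y k)\<^sup>2 - (y i)\<^sup>2)"
      by (metis inverse_minus_eq minus_diff_eq)
    show "l * ?d i k =
        of_bool (i = j) * (2 * l * (t / ((y i)\<^sup>2 - (y k)\<^sup>2))) + of_bool (k = j) * (2 * l * (t / ((y k)\<^sup>2 - (y i)\<^sup>2)))"
      unfolding divide_inverse inv by algebra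
  qed
  also have "\<dots> = (\<Sum>i=1..N. of_bool (i = j) * (\<Sum>k\<in>{1..N} - {i}. 2 * l * (t / ((y i)\<^sup>2 - (y k)\<^sup>2))))"
    unfolding sum_distrib_left by (rule sum_offdiag_pairs[symmetric])
  also have "\<dots> = (\<Sum>k\<in>{1..N} - {j}. 2 * l * (t / ((y j)\<^sup>2 - (y k)\<^sup>2)))"
    using j by (simp add: of_bool_def if_distrib[of "\<lambda>x. x * _"] cong: if_cong)
  also have "- t + mu / t + \<dots> = logderiv N l mu j y"
    by (simp add: logderiv_def y_def sum_distrib_left)
  finally have "((\<lambda>s. S (x(j := s))) has_real_derivative logderiv N l mu j y) (at t)" .
  from DERIV_chain2[OF DERIV_exp this]
  have "((\<lambda>s. exp (S (x(j := s)))) has_real_derivative exp (S y) * logderiv N l mu j y) (at t)"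
    by (simp add: y_def)
  moreover have "\<forall>\<^sub>F s in nhds t. psi0 N l mu (x(j := s)) = exp (S (x(j := s)))"
    using ev by eventually_elim (simp only: psi0_eq_exp S_def)
  moreover have "psi0 N l mu y = exp (S y)" using psi0_eq_exp[OF yc] by (simp only: S_def)
  ultimately show ?thesis
    unfolding y_def[symmetric] by (subst DERIV_cong_ev[OF refl _ refl]) auto
qed

lemma logderiv_has_derivative:
  assumes j: "j \<in> {1..N}" and x: "x \<in> chamber N"
  shows "((\<lambda>s. logderiv N l mu j (x(j := s))) has_real_derivative
     - 1 - mu / (x j)\<^sup>2 + 2 * l * (\<Sum>k\<in>{1..N} - {j}. 1 / ((x j)\<^sup>2 - (x k)\<^sup>2) - 2 * (x j)\<^sup>2 / ((x j)\<^sup>2 - (x k)\<^sup>2)\<^sup>2)) (at (x j))"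
proof -
  let ?d = "\<lambda>k. 1 / ((x j)\<^sup>2 - (x k)\<^sup>2) - 2 * (x j)\<^sup>2 / ((x j)\<^sup>2 - (x k)\<^sup>2)\<^sup>2"
  have "((\<lambda>s. \<Sum>k\<in>{1..N} - {j}. s / (s\<^sup>2 - (x k)\<^sup>2)) has_real_derivative
     (\<Sum>k\<in>{1..N} - {j}. ?d k)) (at (x j))"
  proof (rule DERIV_sum)
    fix k assume "k \<in> {1..N} - {j}"
    then have ne: "(x j)\<^sup>2 - (x k)\<^sup>2 \<noteq> 0"
      using inj_onD[OF chamber_inj[OF x], of j k] j by auto
    have "((\<lambda>s. s / (s\<^sup>2 - (x k)\<^sup>2)) has_real_derivative (1 * ((x j)\<^sup>2 - (x k)\<^sup>2) - x j * (2 * x j)) / (((x j)\<^sup>2 - (x k)\<^sup>2) * ((x j)\<^sup>2 - (x k)\<^sup>2))) (at (x j))"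
      using ne by (intro DERIV_divide) (auto intro!: derivative_eq_intros)
    also have "(1 * ((x j)\<^sup>2 - (x k)\<^sup>2) - x j * (2 * x j)) / (((x j)\<^sup>2 - (x k)\<^sup>2) * ((x j)\<^sup>2 - (x k)\<^sup>2)) =
       ?d k"
    proof -
      have "(1 * D - x j * (2 * x j)) / (D * D) = 1 / D - 2 * (x j)\<^sup>2 / D\<^sup>2" if "D \<noteq> 0" for D
        using that by (simp add: diff_divide_distrib power2_eq_square)
      then show ?thesis using ne by blast
    qed
    finally show "((\<lambda>s. s / (s\<^sup>2 - (x k)\<^sup>2)) has_real_derivative
        ?d k) (at (x j))" .
  qed
  moreover have "((\<lambda>s. - s + mu / s) has_real_derivative - 1 - mu / (x j)\<^sup>2) (at (x j))"
    using chamber_pos[OF x j] by (auto intro!: derivative_eq_intros simp: power2_eq_square)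
  ultimately have "((\<lambda>s. - s + mu / s + 2 * l * (\<Sum>k\<in>{1..N} - {j}. s / (s\<^sup>2 - (x k)\<^sup>2))) has_real_derivative
     - 1 - mu / (x j)\<^sup>2 + 2 * l * (\<Sum>k\<in>{1..N} - {j}. ?d k)) (at (x j))"
    by (intro DERIV_add DERIV_cmult)
  moreover have "logderiv N l mu j (x(j := s)) = - s + mu / s + 2 * l * (\<Sum>k\<in>{1..N} - {j}. s / (s\<^sup>2 - (x k)\<^sup>2))" for s
    by (simp add: logderiv_def)
  ultimately show ?thesis by simp
qed

lemma eventually_chamber:
  assumes x: "x \<in> chamber N"
  shows "\<forall>\<^sub>F s in nhds (x j). x(j := s) \<in> chamber N"
proof -
  have tend: "((\<lambda>s. (x(j := s)) i) \<longlongrightarrow> x i) (nhds (x j))" for i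
    by (cases "i = j") (auto simp: filterlim_ident)
  have "\<forall>\<^sub>F s in nhds (x j). \<forall>i\<in>{1..N}. 0 < (x(j := s)) i"
    using x by (intro eventually_ball_finite ballI order_tendstoD(1)[OF tend]) (auto simp: chamber_def)
  moreover have "\<forall>\<^sub>F s in nhds (x j). \<forall>i\<in>{1..N}. \<forall>k\<in>{i<..N}. (x(j := s)) i < (x(j := s)) k"
  proof (intro eventually_ball_finite ballI)
    fix i k assume "i \<in> {1..N}" "k \<in> {i<..N}"
    then have "0 < x k - x i" using x by (auto simp: chamber_def)
    from order_tendstoD(1)[OF tendsto_diff[OF tend[of k] tend[of i]] this]
    show "\<forall>\<^sub>F s in nhds (x j). (x(j := s)) i < (x(j := s)) k"
      by eventually_elim simp
  qed auto
  ultimately show ?thesis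
    by eventually_elim (simp add: chamber_def)
qed

section \<open>Conjugation of the Hamiltonian by the ground state\<close>

lemma vector_derivative_of_real:
  assumes "(f has_real_derivative d) (at t)"
  shows "vector_derivative (\<lambda>s. of_real (f s) :: complex) (at t) = of_real d"
  using assms unfolding has_real_derivative_iff_has_vector_derivative
  by (intro vector_derivative_at bounded_linear.has_vector_derivative[OF bounded_linear_of_real])

text \<open>Two facts combine: the second derivative of \<open>psi0\<close> in x_j is (W^2 + W')
  times \<open>psi0\<close>, and along z_j = x_j^2 the chain rule gives a factor 2 x_j for each
  derivative of \<open>f\<close>.\<close>

lemma partial2_psi0:
  fixes f :: "(nat \<Rightarrow> real) \<Rightarrow> real" and N :: nat and l mu :: real
  assumes j: "j \<in> {1..N}" and x: "x \<in> chamber N" and f: "polyfun V f"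
  defines "z \<equiv> \<lambda>i. (x i)\<^sup>2" and "W \<equiv> logderiv N l mu j x"
  defines "W' \<equiv> - 1 - mu / (x j)\<^sup>2 + 2 * l * (\<Sum>k\<in>{1..N} - {j}. 1 / ((x j)\<^sup>2 - (x k)\<^sup>2) - 2 * (x j)\<^sup>2 / ((x j)\<^sup>2 - (x k)\<^sup>2)\<^sup>2)"
  shows "partial2 j (\<lambda>y. of_real (psi0 N l mu y * f (\<lambda>i. (y i)\<^sup>2)) :: complex) x =
    of_real (psi0 N l mu x * ((W\<^sup>2 + W') * f z + 4 * (x j * W) * pd j f z + 2 * pd j f z + 4 * (z j * pd j (pd j f) z)))"
proof -
  define p where "p y = psi0 N l mu y" for y
  have sq: "(\<lambda>i. ((x(j := s)) i)\<^sup>2) = z(j := s\<^sup>2)" for s by (auto simp: z_def)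
  have dsq: "((\<lambda>s. s\<^sup>2) has_real_derivative 2 * t) (at t)" for t :: real
    by (auto intro!: derivative_eq_intros)
  have df: "((\<lambda>s. g (z(j := s\<^sup>2))) has_real_derivative pd j g (z(j := t\<^sup>2)) * (2 * t)) (at t)" if "polyfun V g" for g t
    by (rule DERIV_chain2[OF has_derivative_pd[OF that] dsq])
  define R' where "R' t = p (x(j := t)) * (logderiv N l mu j (x(j := t)) * f (z(j := t\<^sup>2)) + 2 * t * pd j f (z(j := t\<^sup>2)))" for t
  \<comment> \<open>The inner derivative has to be known on a neighbourhood of x_j, not only at the
    point, before it can be differentiated again.\<close>
  have near: "\<forall>\<^sub>F t in nhds (x j). (\<forall>\<^sub>F s in nhds t. x(j := s) \<in> chamber N) \<and> x(j := t) \<in> chamber N"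
    using eventually_chamber[OF x, of j] by (simp add: eventually_conj_iff eventually_eventually)
  have first: "((\<lambda>s. p (x(j := s)) * f (z(j := s\<^sup>2))) has_real_derivative R' t) (at t)"
    if "\<forall>\<^sub>F s in nhds t. x(j := s) \<in> chamber N" "x(j := t) \<in> chamber N" for t
    using DERIV_mult[OF psi0_has_derivative[OF j that(2,1), of l mu] df[OF f, of t]]
    by (simp add: R'_def p_def algebra_simps)
  have pdx: "((\<lambda>s. p (x(j := s))) has_real_derivative p x * W) (at (x j))"
    using psi0_has_derivative[OF j _ eventually_chamber[OF x], of l mu] x by (simp add: W_def p_def)
  have Wdx: "((\<lambda>s. logderiv N l mu j (x(j := s))) has_real_derivative W') (at (x j))"
    unfolding W'_def by (rule logderiv_has_derivative[OF j x])
  have zj: "z(j := (x j)\<^sup>2) = z" by (auto simp: z_def)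
  have fdx: "((\<lambda>s. g (z(j := s\<^sup>2))) has_real_derivative pd j g z * (2 * x j)) (at (x j))" if "polyfun V g" for g
    using df[OF that, of "x j"] by (simp only: zj)
  have inner: "((\<lambda>s. logderiv N l mu j (x(j := s)) * f (z(j := s\<^sup>2)) + 2 * s * pd j f (z(j := s\<^sup>2))) has_real_derivative
      (W' * f z + pd j f z * (2 * x j) * W) + (2 * pd j f z + pd j (pd j f) z * (2 * x j) * (2 * x j))) (at (x j))"
  proof (rule DERIV_add)
    show "((\<lambda>s. logderiv N l mu j (x(j := s)) * f (z(j := s\<^sup>2))) has_real_derivative W' * f z + pd j f z * (2 * x j) * W) (at (x j))"
      using DERIV_mult[OF Wdx fdx[OF f]] by (simp add: zj W_def)
    have "((\<lambda>s. 2 * s) has_real_derivative 2) (at (x j))" by (auto intro!: derivative_eq_intros)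
    from DERIV_mult[OF this fdx[OF polyfun_pd[OF f]]]
    show "((\<lambda>s. 2 * s * pd j f (z(j := s\<^sup>2))) has_real_derivative 2 * pd j f z + pd j (pd j f) z * (2 * x j) * (2 * x j)) (at (x j))"
      by (simp add: zj)
  qed
  have "(R' has_real_derivative p x * ((W\<^sup>2 + W') * f z + 4 * (x j * W) * pd j f z + 2 * pd j f z + 4 * (z j * pd j (pd j f) z))) (at (x j))"
  proof -
    have "(R' has_real_derivative p x * W * (W * f z + 2 * x j * pd j f z) +
        ((W' * f z + pd j f z * (2 * x j) * W) + (2 * pd j f z + pd j (pd j f) z * (2 * x j) * (2 * x j))) * p x) (at (x j))"
      using DERIV_mult[OF pdx inner] unfolding R'_def[abs_def] by (simp only: zj W_def fun_upd_triv)
    also have "p x * W * (W * f z + 2 * x j * pd j f z) +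
        ((W' * f z + pd j f z * (2 * x j) * W) + (2 * pd j f z + pd j (pd j f) z * (2 * x j) * (2 * x j))) * p x =
        p x * ((W\<^sup>2 + W') * f z + 4 * (x j * W) * pd j f z + 2 * pd j f z + 4 * ((x j)\<^sup>2 * pd j (pd j f) z))"
      by (simp add: power2_eq_square algebra_simps)
    also have "(x j)\<^sup>2 = z j" by (simp add: z_def)
    finally show ?thesis .
  qed
  note second = vector_derivative_of_real[OF this]
  have "partial2 j (\<lambda>y. of_real (psi0 N l mu y * f (\<lambda>i. (y i)\<^sup>2)) :: complex) x =
     vector_derivative (\<lambda>t. vector_derivative (\<lambda>s. of_real (p (x(j := s)) * f (z(j := s\<^sup>2)))) (at t)) (at (x j))"
    unfolding partial2_def sq p_def ..
  also have "\<dots> = vector_derivative (\<lambda>t. of_real (R' t)) (at (x j))"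
  proof (rule vector_derivative_cong_eq)
    show "\<forall>\<^sub>F t in nhds (x j). t \<in> UNIV \<longrightarrow>
        vector_derivative (\<lambda>s. of_real (p (x(j := s)) * f (z(j := s\<^sup>2))) :: complex) (at t) = of_real (R' t)"
      using near by eventually_elim (use vector_derivative_of_real[OF first] in blast)
  qed auto
  finally show ?thesis unfolding second p_def .
qed

text \<open>In the variables z_j = x_j^2 the square of the logarithmic derivative again meets
  \<open>three_body_identity\<close>: the pair sums add up to - 4 l^2 S + 4 l S + 4 l (l - 1) S = 0.
  The sum of the \<open>A j\<close> is 0 by antisymmetry, and the sum of the
  \<open>z j * A j\<close> is N (N - 1) / 2, which gives the part of the energy linear in the
  coupling.\<close>

lemma ground_state_energy:
  fixes x :: "nat \<Rightarrow> real" and N :: nat and l mu :: real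
  assumes x: "x \<in> chamber N"
  defines "W \<equiv> \<lambda>j. logderiv N l mu j x"
  defines "W' \<equiv> \<lambda>j. - 1 - mu / (x j)\<^sup>2 + 2 * l * (\<Sum>k\<in>{1..N} - {j}. 1 / ((x j)\<^sup>2 - (x k)\<^sup>2) - 2 * (x j)\<^sup>2 / ((x j)\<^sup>2 - (x k)\<^sup>2)\<^sup>2)"
  shows "(\<Sum>j=1..N. - ((W j)\<^sup>2 + W' j) + ((x j)\<^sup>2 + mu * (mu - 1) / (x j)\<^sup>2))
     + 4 * l * (l - 1) * (\<Sum>j=1..N. \<Sum>k\<in>{j<..N}. ((x j)\<^sup>2 + (x k)\<^sup>2) / ((x j)\<^sup>2 - (x k)\<^sup>2)\<^sup>2)
     = real N * (1 + 2 * mu + 2 * l * (real N - 1))"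
proof -
  define z where "z i = (x i)\<^sup>2" for i
  define A where "A j = (\<Sum>k\<in>{1..N} - {j}. 1 / (z j - z k))" for j
  define S where "S = (\<Sum>j=1..N. \<Sum>k\<in>{1..N} - {j}. z j / (z j - z k)\<^sup>2)"
  have inj: "inj_on z {1..N}" using chamber_inj[OF x] by (simp add: z_def[abs_def])
  have A0: "(\<Sum>j=1..N. A j) = 0"
    unfolding A_def sum_offdiag_pairs
  proof (intro sum.neutral ballI)
    fix j k
    have inv: "inverse (z k - z j) = - inverse (z j - z k)" by (metis inverse_minus_eq minus_diff_eq)
    show "1 / (z j - z k) + 1 / (z k - z j) = 0" unfolding divide_inverse inv by simp
  qed
  have A1: "2 * (\<Sum>j=1..N. z j * A j) = real N * (real N - 1)"
  proof -
    have "2 * (\<Sum>j=1..N. z j * A j) = 2 * (\<Sum>j=1..N. \<Sum>k\<in>{1..N} - {j}. z j / (z j - z k))"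
      by (simp add: A_def sum_distrib_left)
    also have "\<dots> = (\<Sum>j=1..N. \<Sum>k\<in>{1..N} - {j}. z j / (z j - z k) + z k / (z k - z j))"
      by (rule sum_offdiag_symmetrize) simp
    also have "\<dots> = (\<Sum>j=1..N. \<Sum>k\<in>{1..N} - {j}. 1)"
    proof (intro sum.cong refl)
      fix j k assume "j \<in> {1..N}" "k \<in> {1..N} - {j}"
      then have ne: "z j - z k \<noteq> 0" using inj_onD[OF inj, of j k] by auto
      have inv: "inverse (z k - z j) = - inverse (z j - z k)" by (metis inverse_minus_eq minus_diff_eq)
      have "z j / (z j - z k) + z k / (z k - z j) = (z j - z k) * inverse (z j - z k)"
        unfolding divide_inverse inv by algebra
      then show "z j / (z j - z k) + z k / (z k - z j) = 1" using ne by simp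
    qed
    also have "\<dots> = (\<Sum>j=1..N. real N - 1)"
      by (intro sum.cong refl) (auto simp: of_nat_diff)
    finally show ?thesis by simp
  qed
  have A2: "(\<Sum>j=1..N. z j * (A j)\<^sup>2) = S"
    unfolding A_def S_def by (rule three_body_identity) (use inj in auto)
  have S2: "(\<Sum>j=1..N. \<Sum>k\<in>{j<..N}. ((x j)\<^sup>2 + (x k)\<^sup>2) / ((x j)\<^sup>2 - (x k)\<^sup>2)\<^sup>2) = S"
    unfolding S_def sum_offdiag_pairs z_def
  proof (intro sum.cong refl)
    fix j k
    show "((x j)\<^sup>2 + (x k)\<^sup>2) / ((x j)\<^sup>2 - (x k)\<^sup>2)\<^sup>2 = (x j)\<^sup>2 / ((x j)\<^sup>2 - (x k)\<^sup>2)\<^sup>2 + (x k)\<^sup>2 / ((x k)\<^sup>2 - (x j)\<^sup>2)\<^sup>2"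
      by (subst power2_commute[of "(x k)\<^sup>2"]) (rule add_divide_distrib)
  qed
  have T: "- ((W j)\<^sup>2 + W' j) + ((x j)\<^sup>2 + mu * (mu - 1) / (x j)\<^sup>2) =
     (1 + 2 * mu) + 4 * l * (z j * A j) - (4 * l * mu + 2 * l) * A j - 4 * l\<^sup>2 * (z j * (A j)\<^sup>2)
      + 4 * l * (\<Sum>k\<in>{1..N} - {j}. z j / (z j - z k)\<^sup>2)" if j: "j \<in> {1..N}" for j
  proof -
    have xj: "x j \<noteq> 0" using chamber_pos[OF x j] by simp
    define R where "R = (\<Sum>k\<in>{1..N} - {j}. z j / (z j - z k)\<^sup>2)"
    define v where "v = 1 / x j"
    have v: "x j * v = 1" using xj by (simp add: v_def)
    have W: "W j = - x j + mu * v + 2 * l * (x j * A j)"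
      by (simp add: W_def logderiv_def A_def z_def v_def sum_distrib_left)
    have W': "W' j = - 1 - mu * v\<^sup>2 + 2 * l * (A j - 2 * R)"
      by (simp add: W'_def A_def R_def z_def v_def sum_subtractf sum_distrib_left power_divide)
    have m: "mu * (mu - 1) / (x j)\<^sup>2 = mu * (mu - 1) * v\<^sup>2" by (simp add: v_def power_divide)
    have zx: "z j = (x j)\<^sup>2" by (simp add: z_def)
    have W2: "(W j)\<^sup>2 = (x j)\<^sup>2 + mu\<^sup>2 * v\<^sup>2 + 4 * l\<^sup>2 * (z j * (A j)\<^sup>2) - 2 * mu - 4 * l * (z j * A j) + 4 * l * mu * A j"
      unfolding W zx using v by algebra
    show ?thesis
      unfolding W2 W' m R_def[symmetric] by (simp add: zx power2_eq_square algebra_simps)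
  qed
  have "(\<Sum>j=1..N. - ((W j)\<^sup>2 + W' j) + ((x j)\<^sup>2 + mu * (mu - 1) / (x j)\<^sup>2)) =
      real N * (1 + 2 * mu) + 4 * l * (\<Sum>j=1..N. z j * A j) - (4 * l * mu + 2 * l) * (\<Sum>j=1..N. A j) - 4 * l\<^sup>2 * (\<Sum>j=1..N. z j * (A j)\<^sup>2) + 4 * l * S"
  proof -
    have "(\<Sum>j=1..N. - ((W j)\<^sup>2 + W' j) + ((x j)\<^sup>2 + mu * (mu - 1) / (x j)\<^sup>2)) =
      (\<Sum>j=1..N. (1 + 2 * mu) + 4 * l * (z j * A j) - (4 * l * mu + 2 * l) * A j - 4 * l\<^sup>2 * (z j * (A j)\<^sup>2)
      + 4 * l * (\<Sum>k\<in>{1..N} - {j}. z j / (z j - z k)\<^sup>2))"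
      by (rule sum.cong[OF refl T])
    also have "\<dots> = real N * (1 + 2 * mu) + 4 * l * (\<Sum>j=1..N. z j * A j) - (4 * l * mu + 2 * l) * (\<Sum>j=1..N. A j) - 4 * l\<^sup>2 * (\<Sum>j=1..N. z j * (A j)\<^sup>2) + 4 * l * S"
      unfolding S_def sum.distrib sum_subtractf sum_distrib_left by (simp add: distrib_left)
    finally show ?thesis .
  qed
  moreover have "4 * l * (\<Sum>j=1..N. z j * A j) = 2 * l * (real N * (real N - 1))"
    by (simp add: A1[symmetric])
  ultimately show ?thesis
    unfolding S2 A0 A2 by (simp add: power2_eq_square algebra_simps)
qed

text \<open>The terms free of derivatives of \<open>f\<close> are the ground state energy. In the
  first-order terms \<open>x j * W j\<close> is - z_j + \<mu> plus a pair sum: the part - z_j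
  becomes the Euler operator, and \<mu> joins the 1/2 from the second derivative of z_j = x_j^2 to
  give the constant \<mu> + 1/2 in \<open>reduced_op\<close>.\<close>

lemma H_BN_psi0_polyfun:
  assumes x: "x \<in> chamber N" and f: "polyfun V f"
  defines "z \<equiv> \<lambda>i. (x i)\<^sup>2"
  shows "H_BN N l mu (\<lambda>y. of_real (psi0 N l mu y * f (\<lambda>i. (y i)\<^sup>2))) x =
    of_real (psi0 N l mu x * (real N * (1 + 2 * mu + 2 * l * (real N - 1)) * f z
       + 4 * (\<Sum>j=1..N. z j * pd j f z) - 4 * reduced_op N l mu f z))"
proof -
  define W where "W j = logderiv N l mu j x" for j
  define W' where "W' j = - 1 - mu / (x j)\<^sup>2 + 2 * l * (\<Sum>k\<in>{1..N} - {j}. 1 / ((x j)\<^sup>2 - (x k)\<^sup>2) - 2 * (x j)\<^sup>2 / ((x j)\<^sup>2 - (x k)\<^sup>2)\<^sup>2)" for j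
  define S where "S = (\<Sum>j=1..N. \<Sum>k\<in>{j<..N}. ((x j)\<^sup>2 + (x k)\<^sup>2) / ((x j)\<^sup>2 - (x k)\<^sup>2)\<^sup>2)"
  define p where "p = psi0 N l mu x"
  let ?A = "\<lambda>j. ((W j)\<^sup>2 + W' j) * f z + 4 * (x j * W j) * pd j f z + 2 * pd j f z + 4 * (z j * pd j (pd j f) z)"
  let ?B = "\<lambda>j. - ((W j)\<^sup>2 + W' j) * f z - 4 * (x j * W j) * pd j f z - 2 * pd j f z - 4 * (z j * pd j (pd j f) z) + ((x j)\<^sup>2 + mu * (mu - 1) / (x j)\<^sup>2) * f z"
  let ?C = "\<lambda>j. - ((W j)\<^sup>2 + W' j) + ((x j)\<^sup>2 + mu * (mu - 1) / (x j)\<^sup>2)"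
  have D: "?B j
     = (?C j) * f z + 4 * (z j * pd j f z)
        - 4 * (z j * pd j (pd j f) z + (mu + 1 / 2) * pd j f z) - 8 * l * (\<Sum>k\<in>{1..N} - {j}. z j / (z j - z k) * pd j f z)"
    if j: "j \<in> {1..N}" for j
  proof -
    have xW: "x j * W j = - z j + mu + 2 * l * (\<Sum>k\<in>{1..N} - {j}. z j / (z j - z k))"
    proof -
      define s where "s = (\<Sum>k\<in>{1..N} - {j}. x j / ((x j)\<^sup>2 - (x k)\<^sup>2))"
      have "x j * s = (\<Sum>k\<in>{1..N} - {j}. z j / (z j - z k))"
        by (simp add: s_def z_def sum_distrib_left power2_eq_square)
      moreover have "x j * (mu / x j) = mu"
        using chamber_pos[OF x j] by simp
      moreover have "x j * (- x j + q + 2 * l * s) = - z j + x j * q + 2 * l * (x j * s)" for q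
        by (simp add: z_def power2_eq_square algebra_simps)
      ultimately show ?thesis
        by (simp only: W_def logderiv_def s_def)
    qed
    show ?thesis
      unfolding sum_distrib_right[symmetric] xW by (simp add: algebra_simps)
  qed
  have "H_BN N l mu (\<lambda>y. of_real (psi0 N l mu y * f (\<lambda>i. (y i)\<^sup>2))) x =
    (\<Sum>j=1..N. - of_real (p * ?A j)
        + of_real ((x j)\<^sup>2 + mu * (mu - 1) / (x j)\<^sup>2) * of_real (p * f z)) + of_real (4 * l * (l - 1) * S) * of_real (p * f z)"
    unfolding H_BN_def S_def
    by (intro arg_cong2[of _ _ _ _ "(+)"] sum.cong refl)
      (simp_all only: partial2_psi0[OF _ x f] W_def W'_def p_def z_def)
  also have "\<dots> = of_real (p * ((\<Sum>j=1..N. ?B j) + 4 * l * (l - 1) * S * f z))"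
  proof -
    have "(\<Sum>j=1..N. - of_real (p * ?A j)
        + of_real ((x j)\<^sup>2 + mu * (mu - 1) / (x j)\<^sup>2) * of_real (p * f z) :: complex)
      = of_real (\<Sum>j=1..N. p * ?B j)"
      unfolding of_real_sum
    proof (intro sum.cong refl)
      fix j
      have "- (p * ?A j)
        + ((x j)\<^sup>2 + mu * (mu - 1) / (x j)\<^sup>2) * (p * f z) = p * ?B j"
        by algebra
      from arg_cong[OF this, of complex_of_real]
      show "- of_real (p * ?A j)
        + of_real ((x j)\<^sup>2 + mu * (mu - 1) / (x j)\<^sup>2) * of_real (p * f z) = (of_real (p * ?B j) :: complex)"
        by (simp only: of_real_add of_real_minus of_real_mult)
    qed
    then show ?thesis
      by (simp only: sum_distrib_left[symmetric]) (simp add: algebra_simps)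
  qed
  also have "(\<Sum>j=1..N. ?B j) =
     (\<Sum>j=1..N. ?C j) * f z + 4 * (\<Sum>j=1..N. z j * pd j f z) - 4 * reduced_op N l mu f z"
  proof -
    have "(\<Sum>j=1..N. ?B j) =
      (\<Sum>j=1..N. (?C j) * f z + 4 * (z j * pd j f z)
        - 4 * (z j * pd j (pd j f) z + (mu + 1 / 2) * pd j f z) - 8 * l * (\<Sum>k\<in>{1..N} - {j}. z j / (z j - z k) * pd j f z))"
      by (rule sum.cong[OF refl D])
    also have "\<dots> = (\<Sum>j=1..N. ?C j) * f z + 4 * (\<Sum>j=1..N. z j * pd j f z)
        - 4 * (\<Sum>j=1..N. z j * pd j (pd j f) z + (mu + 1 / 2) * pd j f z) - 8 * l * (\<Sum>j=1..N. \<Sum>k\<in>{1..N} - {j}. z j / (z j - z k) * pd j f z)"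
      by (simp only: sum_subtractf sum.distrib[of "\<lambda>j. _ j * f z"] sum_distrib_left[symmetric] sum_distrib_right[symmetric])
    finally show ?thesis
      unfolding reduced_op_def by (simp only: distrib_left)
  qed
  also have "(\<Sum>j=1..N. ?C j) * f z + 4 * (\<Sum>j=1..N. z j * pd j f z) - 4 * reduced_op N l mu f z + 4 * l * (l - 1) * S * f z
     = real N * (1 + 2 * mu + 2 * l * (real N - 1)) * f z + 4 * (\<Sum>j=1..N. z j * pd j f z) - 4 * reduced_op N l mu f z"
    unfolding ground_state_energy[OF x, of l mu, folded W_def W'_def S_def, symmetric] by (simp add: distrib_right)
  finally show ?thesis by (simp only: p_def)
qed

theorem mainTheorem2:
  fixes N :: nat and lam \<mu> \<epsilon> :: real and n :: "nat \<Rightarrow> int"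
  assumes "N \<ge> 1" and "lam > 0" and "\<mu> > 0" and "\<epsilon> > 0" and "n \<in> int_vecs N"
  shows "(\<forall>m\<in>int_vecs N.
            finite {(s, jk, \<nu>). 1 \<le> s \<and> jk \<in> pair_seqs N s \<and> \<nu> \<in> nat_seqs s \<and>
                                alpha_term N lam \<mu> n m s jk \<nu> \<noteq> 0})
       \<and> finite {m \<in> int_vecs N. \<exists>x. of_real (alpha N lam \<mu> n m) * f_fun N lam \<epsilon> m x \<noteq> 0}
       \<and> reduced_polynomial_eigenfunction N lam \<mu> (P_fun N lam \<mu> \<epsilon> n) (E_val N lam \<mu> n)"
proof (intro conjI ballI)
  fix m
  show "finite {(s, jk, \<nu>). 1 \<le> s \<and> jk \<in> pair_seqs N s \<and> \<nu> \<in> nat_seqs s \<and> alpha_term N lam \<mu> n m s jk \<nu> \<noteq> 0}"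
    by (rule finite_alpha_terms)
next
  have "{m \<in> int_vecs N. \<exists>x. of_real (alpha N lam \<mu> n m) * f_fun N lam \<epsilon> m x \<noteq> 0} \<subseteq> support_box N n"
    using support_box_memI(1)[OF assms(5)] by (auto simp: f_fun_eq_f_poly[OF assms(1,4)])
  then show "finite {m \<in> int_vecs N. \<exists>x. of_real (alpha N lam \<mu> n m) * f_fun N lam \<epsilon> m x \<noteq> 0}"
    by (rule finite_subset) simp
next
  have P: "P_fun N lam \<mu> \<epsilon> n = (\<lambda>x. of_real (P_poly N lam \<mu> n (\<lambda>i. (x i)\<^sup>2)))"
    by (rule ext) (rule P_fun_eq_P_poly[OF assms(1,4,5)])
  have "symmetric_polynomial N (P_fun N lam \<mu> \<epsilon> n)"
    unfolding symmetric_polynomial_def P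
  proof (intro conjI allI impI)
    show "\<exists>p. (\<forall>e\<in>Poly_Mapping.keys p. Poly_Mapping.keys e \<subseteq> {1..N}) \<and> (\<forall>x. of_real (P_poly N lam \<mu> n (\<lambda>i. (x i)\<^sup>2)) = poly_eval p x)"
      by (rule polyfun_poly_eval[OF polyfun_P_poly])
    fix \<pi> and x :: "nat \<Rightarrow> real" assume "\<pi> permutes {1..N}"
    then show "complex_of_real (P_poly N lam \<mu> n (\<lambda>i. (x (\<pi> i))\<^sup>2)) = of_real (P_poly N lam \<mu> n (\<lambda>i. (x i)\<^sup>2))"
      using P_poly_permute[of \<pi> N lam \<mu> n "\<lambda>i. (x i)\<^sup>2"] by simp
  qed
  moreover have "H_BN N lam \<mu> (\<lambda>z. of_real (psi0 N lam \<mu> z) * P_fun N lam \<mu> \<epsilon> n z) x =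
      of_real (E_val N lam \<mu> n) * (of_real (psi0 N lam \<mu> x) * P_fun N lam \<mu> \<epsilon> n x)" if x: "x \<in> chamber N" for x
  proof -
    define z where "z i = (x i)\<^sup>2" for i
    have "4 * (\<Sum>j=1..N. z j * pd j (P_poly N lam \<mu> n) z) - 4 * reduced_op N lam \<mu> (P_poly N lam \<mu> n) z = 4 * of_int (\<Sum>k=1..N. n k) * P_poly N lam \<mu> n z"
      by (rule P_poly_eigen[OF assms(5)]) (use chamber_inj[OF x] in \<open>simp add: z_def[abs_def]\<close>)
    then have eq: "real N * (1 + 2 * \<mu> + 2 * lam * (real N - 1)) * P_poly N lam \<mu> n z + 4 * (\<Sum>j=1..N. z j * pd j (P_poly N lam \<mu> n) z)
        - 4 * reduced_op N lam \<mu> (P_poly N lam \<mu> n) z = E_val N lam \<mu> n * P_poly N lam \<mu> n z"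
      by (simp add: E_val_def distrib_right)
    have "H_BN N lam \<mu> (\<lambda>z. of_real (psi0 N lam \<mu> z) * P_fun N lam \<mu> \<epsilon> n z) x =
       H_BN N lam \<mu> (\<lambda>y. of_real (psi0 N lam \<mu> y * P_poly N lam \<mu> n (\<lambda>i. (y i)\<^sup>2))) x"
      by (simp add: P)
    also have "\<dots> = of_real (psi0 N lam \<mu> x * (E_val N lam \<mu> n * P_poly N lam \<mu> n z))"
      unfolding H_BN_psi0_polyfun[OF x polyfun_P_poly, folded z_def] eq ..
    also have "\<dots> = of_real (E_val N lam \<mu> n) * (of_real (psi0 N lam \<mu> x) * P_fun N lam \<mu> \<epsilon> n x)"
      by (simp add: P z_def[abs_def])
    finally show ?thesis .
  qed
  ultimately show "reduced_polynomial_eigenfunction N lam \<mu> (P_fun N lam \<mu> \<epsilon> n) (E_val N lam \<mu> n)"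
    by (simp add: reduced_polynomial_eigenfunction_def)
qed

end
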